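(* Given integers $\chi\geq 2$ and $m\geq 2$ and a real number $\varepsilon>0$, there exists an integer $n_0=n_0(\chi,m,\varepsilon)$ such that for all $n\geq n_0$, $$R(P^{(3)}_{n,2},H(TT_\chi,m))\leq\begin{cases}(1+\varepsilon)n & \text{if }\chi=2,\\ \left(\frac23+\varepsilon\right)(\vec{R}(\chi)-1)n & \text{if }\chi\geq 3.\end{cases}$$
   Context: $TT_\chi$ denotes the transitive (acyclic) tournament on $[\chi]$. For a tournament $T_\chi$ on $[\chi]$ and $m\ge1$, $H(T_\chi,m)$ is the $3$-uniform hypergraph whose vertex set is partitioned into sets $A_1,\dots,A_\chi$ each of size $m$, with edge set $\{xyz: x,y\in A_i,\ z\in A_j,\ (i,j)\text{ an arc of }T_\chi\}$. $\vec{R}(\ell)$ is the least $N$ such that every tournament on at least $N$ vertices contains a copy of $TT_\ell$. $R(G,H)$ is the least $N$ such that every red/blue colouring of the edges of $K^{(3)}_N$ contains a red copy of $G$ or a blue copy of $H$. The tight path $P^{(3)}_{n,2}$ has vertices $v_1,\dots,v_n$ and edges $\{v_i,v_{i+1},v_{i+2}\}$, $i\in[n-2]$. *)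

theory Defs
  imports Complex_Main
begin

text \<open>A 3-uniform hypergraph is given by a vertex set V and an edge set E (sets of 3 vertices).
  A red/blue colouring of the edges of the complete 3-graph on {0..<N} is a function
  c :: nat set \<Rightarrow> bool (True = red, False = blue); only its values on 3-subsets matter.\<close>

definition has_copy :: "nat \<Rightarrow> (nat set \<Rightarrow> bool) \<Rightarrow> bool \<Rightarrow> 'a set \<Rightarrow> 'a set set \<Rightarrow> bool" where
  "has_copy N c col V E \<longleftrightarrow>
     (\<exists>f. inj_on f V \<and> f ` V \<subseteq> {..<N} \<and> (\<forall>e\<in>E. c (f ` e) = col))"

definition ramsey3 :: "'a set \<Rightarrow> 'a set set \<Rightarrow> 'b set \<Rightarrow> 'b set set \<Rightarrow> nat" where
  "ramsey3 VG EG VH EH =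
     (LEAST N. \<forall>c :: nat set \<Rightarrow> bool. has_copy N c True VG EG \<or> has_copy N c False VH EH)"

definition tight_path_V :: "nat \<Rightarrow> nat set" where
  "tight_path_V n = {..<n}"

definition tight_path_E :: "nat \<Rightarrow> nat set set" where
  "tight_path_E n = {{i, i+1, i+2} | i. i + 2 < n}"

definition is_tournament :: "nat set \<Rightarrow> (nat \<Rightarrow> nat \<Rightarrow> bool) \<Rightarrow> bool" where
  "is_tournament V T \<longleftrightarrow> (\<forall>x\<in>V. \<not> T x x) \<and>
     (\<forall>x\<in>V. \<forall>y\<in>V. x \<noteq> y \<longrightarrow> (T x y \<longleftrightarrow> \<not> T y x))"

definition contains_TT :: "nat set \<Rightarrow> (nat \<Rightarrow> nat \<Rightarrow> bool) \<Rightarrow> nat \<Rightarrow> bool" where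
  "contains_TT V T l \<longleftrightarrow>
     (\<exists>f. inj_on f {..<l} \<and> f ` {..<l} \<subseteq> V \<and> (\<forall>i<l. \<forall>j<l. i < j \<longrightarrow> T (f i) (f j)))"

definition dir_ramsey :: "nat \<Rightarrow> nat" where
  "dir_ramsey l = (LEAST N. \<forall>n\<ge>N. \<forall>T. is_tournament {..<n} T \<longrightarrow> contains_TT {..<n} T l)"

definition H_V :: "nat \<Rightarrow> nat \<Rightarrow> (nat \<times> nat) set" where
  "H_V chi m = {(i, a). i < chi \<and> a < m}"

definition H_E :: "nat \<Rightarrow> (nat \<Rightarrow> nat \<Rightarrow> bool) \<Rightarrow> nat \<Rightarrow> (nat \<times> nat) set set" where
  "H_E chi T m = {{x, y, z} | x y z.
       x \<in> H_V chi m \<and> y \<in> H_V chi m \<and> z \<in> H_V chi m \<and>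
       fst x = fst y \<and> x \<noteq> y \<and> T (fst x) (fst z)}"

definition TT :: "nat \<Rightarrow> nat \<Rightarrow> bool" where
  "TT i j \<longleftrightarrow> i < j"

end

theory Submission
  imports Defs "HOL-Library.Ramsey" "HOL-Library.Disjoint_Sets"
begin

text \<open>
  Without a blue copy of the second hypergraph, Ramsey's theorem partitions almost all vertices into
  red cliques of constant size. Call two of them linked if vertices \<open>y, x\<close> of the first and \<open>z, w\<close> of
  the second form red edges \<open>yxz\<close> and \<open>xzw\<close>, robustly so in many disjoint ways; a tight path can then
  cross from one clique to the other. If no link exists between two sets \<open>P\<close> and \<open>Q\<close>, then after passing
  to homogeneous subsets all triples \<open>PPQ\<close> or all triples \<open>PQQ\<close> are blue. So \<open>R(\<chi>)\<close> pairwise unlinked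
  cliques would yield a transitive tournament of blue arcs and hence the forbidden blue copy, and the
  cliques are covered by fewer than \<open>R(\<chi>)\<close> walks of bounded multiplicity. Merging walks gives
  components without links between them, each spanned by a single red tight path.

  A path can also leave its component: if the homogeneous triples \<open>PPQ\<close> are red, half as many vertices
  of \<open>Q\<close> as there are in \<open>P\<close> can be inserted between the vertices of \<open>P\<close>. We cut the components into
  homogeneous tuples with one part in each of them. In every tuple a component fails to absorb only if
  it sends blue arcs to all others, and \<open>R(\<chi>) \<ge> R(\<chi> - 1) + 2\<close> with \<open>R(4) \<ge> 7\<close> implies that the
  number of parts and the number of such sources add up to less than \<open>R(\<chi>)\<close>, except for two sources
  when \<open>R(3) = 4\<close>, a case treated apart. Averaging over tuples and over
  the components with at least \<open>2n/3\<close> vertices finds a red tight path on \<open>n\<close> vertices.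
\<close>

section \<open>Tight paths through red cliques\<close>

text \<open>The factor 2/3 is the balance point of absorption. Measure sizes in units of
  \<open>n\<close>, up to error terms, and write R for \<open>dir_ramsey chi - 1\<close>. Let B be
  the components of size at least 1/3 and A those of size at least 2/3. The tuples take 2/3 from
  each member of A and 1/3 from each other member of B; a member of A that absorbed in every tuple
  would lengthen its path by 1/3. No red path has more than 1, and in each tuple at most R - |B|
  members of A are sources, so A holds at most 2|A|/3 + (R - |B|)/3 in total. The rest of B holds at
  most 2/3 each, the components outside B at most 1/3 each. The terms in |A| and |B| cancel and (R +
  |I|)/3 \<le> 2R/3 remains. The errors are controlled by the order in which the constants are
  chosen: the size of the tuples, then the number of vertices lost per clique, then a clique size
  that makes this loss negligible, and last the number of vertices left uncovered.\<close>

definition red_clique :: "('a set \<Rightarrow> bool) \<Rightarrow> 'a set \<Rightarrow> bool" where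
  "red_clique c X \<longleftrightarrow> (\<forall>e. e \<subseteq> X \<and> card e = 3 \<longrightarrow> c e)"

lemma red_cliqueD:
  assumes "red_clique c X" "x \<in> X" "y \<in> X" "z \<in> X" "x \<noteq> y" "x \<noteq> z" "y \<noteq> z"
  shows "c {x, y, z}"
proof -
  have "card {x, y, z} = 3" using assms by simp
  then show ?thesis using assms by (simp add: red_clique_def)
qed

lemma red_clique_subset: "red_clique c X \<Longrightarrow> Y \<subseteq> X \<Longrightarrow> red_clique c Y"
  by (auto simp: red_clique_def)

fun tight :: "('a set \<Rightarrow> bool) \<Rightarrow> 'a list \<Rightarrow> bool" where
  "tight c (x # y # z # xs) \<longleftrightarrow> c {x, y, z} \<and> tight c (y # z # xs)"
| "tight c _ \<longleftrightarrow> True"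

lemma tight_nth: "tight c xs \<Longrightarrow> i + 2 < length xs \<Longrightarrow> c {xs ! i, xs ! (i + 1), xs ! (i + 2)}"
proof (induction c xs arbitrary: i rule: tight.induct)
  case (1 c x y z xs)
  then show ?case by (cases i) auto
qed auto

lemma tight_append:
  assumes "tight c (u @ [a, b])" "tight c (d # e # v)" "c {a, b, d}" "c {b, d, e}"
  shows "tight c (u @ [a, b] @ d # e # v)"
  using assms(1)
proof (induction u rule: induct_list012)
  case (3 x y zs)
  then show ?case by (cases zs) auto
qed (use assms in auto)

text \<open>
  A tight path that starts with two vertices of \<open>P\<close> and ends with two vertices of \<open>Q\<close> can be
  continued inside any red clique containing \<open>Q\<close>, whatever its interior looks like.
\<close>
definition anchored :: "('a set \<Rightarrow> bool) \<Rightarrow> 'a set \<Rightarrow> 'a set \<Rightarrow> 'a list \<Rightarrow> bool" where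
  "anchored c P Q xs \<longleftrightarrow> distinct xs \<and> tight c xs \<and>
     (\<exists>a b u. xs = a # b # u \<and> a \<in> P \<and> b \<in> P) \<and>
     (\<exists>u a b. xs = u @ [a, b] \<and> a \<in> Q \<and> b \<in> Q)"

text \<open>Only the vertex set of the path survives: gluing needs the anchors and disjointness,
  never the order of the interior.\<close>

definition spans :: "('a set \<Rightarrow> bool) \<Rightarrow> 'a set \<Rightarrow> 'a set \<Rightarrow> 'a set \<Rightarrow> bool" where
  "spans c P Q X \<longleftrightarrow> (\<exists>xs. anchored c P Q xs \<and> set xs = X)"

text \<open>Concatenation creates just two new triples. They are drawn from the last two vertices of
  \<open>xs\<close> and the first two of \<open>ys\<close>, all of which lie in the red clique
  \<open>Q\<close>.\<close>

lemma anchored_append: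
  assumes "anchored c P Q xs" "anchored c Q R ys" "red_clique c Q" "set xs \<inter> set ys = {}"
  shows "anchored c P R (xs @ ys)"
proof -
  obtain u a b where x: "xs = u @ [a, b]" "a \<in> Q" "b \<in> Q" using assms(1) by (auto simp: anchored_def)
  obtain d e v where y: "ys = d # e # v" "d \<in> Q" "e \<in> Q" using assms(2) by (auto simp: anchored_def)
  have d: "distinct xs" "distinct ys" and t: "tight c xs" "tight c ys"
    using assms by (auto simp: anchored_def)
  have "c {a, b, d}" "c {b, d, e}"
    by (rule red_cliqueD[OF assms(3)]; use x y d assms(4) in auto)+
  then have "tight c (xs @ ys)" using tight_append[of c u a b d e v] t x y by simp
  moreover have "distinct (xs @ ys)" using d assms(4) by auto
  moreover have "\<exists>a b u. xs @ ys = a # b # u \<and> a \<in> P \<and> b \<in> P"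
  proof -
    obtain a' b' u' where "xs = a' # b' # u'" "a' \<in> P" "b' \<in> P"
      using assms(1) unfolding anchored_def by blast
    then show ?thesis by (intro exI[of _ a'] exI[of _ b'] exI[of _ "u' @ ys"]) auto
  qed
  moreover have "\<exists>u a b. xs @ ys = u @ [a, b] \<and> a \<in> R \<and> b \<in> R"
  proof -
    obtain u' a' b' where "ys = u' @ [a', b']" "a' \<in> R" "b' \<in> R"
      using assms(2) unfolding anchored_def by blast
    then show ?thesis by (intro exI[of _ "xs @ u'"]) auto
  qed
  ultimately show ?thesis by (simp add: anchored_def)
qed

lemma spans_Un:
  assumes "spans c P Q X" "spans c Q R Y" "red_clique c Q" "X \<inter> Y = {}"
  shows "spans c P R (X \<union> Y)"
proof -
  obtain xs ys where "anchored c P Q xs" "set xs = X" "anchored c Q R ys" "set ys = Y"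
    using assms by (auto simp: spans_def)
  with assms anchored_append[of c P Q xs R ys] show ?thesis
    unfolding spans_def by (intro exI[of _ "xs @ ys"]) auto
qed

lemma spans_UN:
  assumes "finite I" "I \<noteq> {}" "\<And>i. i \<in> I \<Longrightarrow> spans c Q Q (X i)" "red_clique c Q"
    "\<And>i j. i \<in> I \<Longrightarrow> j \<in> I \<Longrightarrow> i \<noteq> j \<Longrightarrow> X i \<inter> X j = {}"
  shows "spans c Q Q (\<Union>i\<in>I. X i)"
  using assms
proof (induction I rule: finite_ne_induct)
  case (insert i I)
  have "X i \<inter> X j = {}" if "j \<in> I" for j using insert.prems(3)[of i j] insert.hyps that by auto
  then have "X i \<inter> (\<Union>i\<in>I. X i) = {}" by blast
  moreover have "spans c Q Q (\<Union>i\<in>I. X i)" by (rule insert.IH) (use insert.prems in auto)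
  ultimately have "spans c Q Q (X i \<union> (\<Union>i\<in>I. X i))"
    using insert.prems(1,2) by (blast intro: spans_Un)
  then show ?case by simp
qed auto

lemma spans_mono: "spans c P Q X \<Longrightarrow> P \<subseteq> P' \<Longrightarrow> Q \<subseteq> Q' \<Longrightarrow> spans c P' Q' X"
proof -
  assume a: "spans c P Q X" "P \<subseteq> P'" "Q \<subseteq> Q'"
  then obtain xs a b u a' b' u' where "distinct xs" "tight c xs" "set xs = X" "xs = a # b # u" "a \<in> P" "b \<in> P"
     "xs = u' @ [a', b']" "a' \<in> Q" "b' \<in> Q" unfolding spans_def anchored_def by blast
  with a(2,3) show "spans c P' Q' X" unfolding spans_def anchored_def by blast
qed

lemma spans_finite: "spans c P Q X \<Longrightarrow> finite X"
  by (auto simp: spans_def)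

lemma spans_pair:
  assumes "a \<in> P" "b \<in> P" "a \<in> Q" "b \<in> Q" "a \<noteq> b"
  shows "spans c P Q {a, b}"
  unfolding spans_def anchored_def using assms by (intro exI[of _ "[a, b]"]) auto

lemma red_clique_tight:
  assumes "red_clique c (set xs)" "distinct xs"
  shows "tight c xs"
  using assms
proof (induction c xs rule: tight.induct)
  case (1 c x y z xs)
  have "red_clique c (set (y # z # xs))" using 1(2) by (rule red_clique_subset) auto
  moreover have "c {x, y, z}" by (rule red_cliqueD[OF 1(2)]) (use 1(3) in auto)
  ultimately show ?case using 1 by simp
qed auto

lemma spans_clique:
  assumes "finite X" "2 \<le> card X" "red_clique c X"
  shows "spans c X X X"
proof -
  obtain xs where xs: "set xs = X" "distinct xs" using assms(1) finite_distinct_list by blast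
  then have len: "2 \<le> length xs" using assms(2) by (metis distinct_card)
  have "tight c xs" using red_clique_tight assms(3) xs by blast
  moreover obtain a b u where "xs = a # b # u"
    using len by (cases xs; cases "tl xs") auto
  moreover obtain v d e where "xs = v @ [d, e]"
    using len by (cases xs rule: rev_cases; cases "butlast xs" rule: rev_cases) auto
  ultimately have "anchored c X X xs" using xs unfolding anchored_def
    by (metis in_set_conv_decomp list.set_intros(1) list.set_intros(2) Un_iff set_append)
  with xs show ?thesis unfolding spans_def by blast
qed

text \<open>The path has the pattern \<open>ccd ccd \<dots> ccd cc\<close>.\<close>
lemma spans_absorb:
  assumes "finite X" "finite Y" "card X = 2 * s + 2" "card Y = s" "X \<inter> Y = {}"
    "\<And>x x' y. x \<in> X \<Longrightarrow> x' \<in> X \<Longrightarrow> x \<noteq> x' \<Longrightarrow> y \<in> Y \<Longrightarrow> c {x, x', y}"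
  shows "spans c X X (X \<union> Y)"
  using assms
proof (induction s arbitrary: X Y)
  case 0
  then obtain a b where "X = {a, b}" "a \<noteq> b" by (auto simp: card_Suc_eq)
  with 0 show ?case using spans_pair[of a X b X c] by simp
next
  case (Suc s)
  obtain d where d: "d \<in> Y" using Suc.prems by fastforce
  obtain e where e: "e \<in> X" using Suc.prems by fastforce
  have "card (X - {e}) \<noteq> 0" using Suc.prems e by simp
  then obtain f where f: "f \<in> X - {e}" by (metis card.empty ex_in_conv)
  define X' where "X' = X - {e, f}"
  define Y' where "Y' = Y - {d}"
  have "card X' = 2 * s + 2" using Suc.prems e f by (auto simp: X'_def card_Diff_subset card_insert_if)
  moreover have "card Y' = s" using Suc.prems d by (simp add: Y'_def)
  ultimately have "spans c X' X' (X' \<union> Y')"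
    by (intro Suc.IH) (use Suc.prems in \<open>auto simp: X'_def Y'_def\<close>)
  then obtain xs where xs: "anchored c X' X' xs" "set xs = X' \<union> Y'" unfolding spans_def by blast
  obtain u a b where u: "xs = u @ [a, b]" "a \<in> X'" "b \<in> X'" using xs by (auto simp: anchored_def)
  have ab: "a \<noteq> b" using xs(1) u by (auto simp: anchored_def)
  \<comment> \<open>The shorter path ends in \<open>a, b\<close>. Appending \<open>d, e, f\<close>
    creates the triples \<open>abd\<close>, \<open>bde\<close> and \<open>def\<close>, each with two
    vertices in \<open>X\<close> and the vertex \<open>d\<close> of \<open>Y\<close>.\<close>
  have "c {a, b, d}" "c {b, f, d}" "c {e, f, d}" "c {b, e, d}"
    by (rule Suc.prems; use u ab e f d in \<open>auto simp: X'_def\<close>)+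
  then have cs: "c {a, b, d}" "c {b, d, e}" "c {d, e, f}" by (simp_all add: insert_commute)
  then have "tight c (xs @ [d, e, f])"
    using tight_append[of c u a b d e "[f]"] xs(1) u by (simp add: anchored_def)
  moreover have "distinct (xs @ [d, e, f])"
    using xs e f d Suc.prems by (auto simp: anchored_def X'_def Y'_def)
  moreover obtain a' b' v where "xs = a' # b' # v" "a' \<in> X'" "b' \<in> X'"
    using xs(1) by (auto simp: anchored_def)
  ultimately have "anchored c X X (xs @ [d, e, f])"
    unfolding anchored_def using e f by (auto simp: X'_def)
  moreover have "set (xs @ [d, e, f]) = X \<union> Y" using xs(2) e f d by (auto simp: X'_def Y'_def)
  ultimately show ?case unfolding spans_def by blast
qed

section \<open>Crossing from one clique to another\<close>

definition link :: "('a set \<Rightarrow> bool) \<Rightarrow> 'a set \<Rightarrow> 'a set \<Rightarrow> 'a set \<Rightarrow> bool" where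
  "link c P Q l \<longleftrightarrow> (\<exists>y x z w. l = {y, x, z, w} \<and> y \<noteq> x \<and> z \<noteq> w \<and> y \<in> P \<and> x \<in> P \<and> z \<in> Q \<and> w \<in> Q \<and>
     c {y, x, z} \<and> c {x, z, w})"

text \<open>Reading \<open>y, x, z, w\<close> backwards turns a crossing from \<open>P\<close> to
  \<open>Q\<close> into one from \<open>Q\<close> to \<open>P\<close>. Linkage is thus an undirected
  relation, as required for walks that are traversed in reverse.\<close>

lemma link_sym: "link c P Q l \<Longrightarrow> link c Q P l"
  unfolding link_def
  apply (elim exE conjE)
  subgoal for y x z w
    by (intro exI[of _ w] exI[of _ z] exI[of _ x] exI[of _ y]) (auto simp: insert_commute)
  done

lemma link_mono: "link c P Q l \<Longrightarrow> P \<subseteq> P' \<Longrightarrow> Q \<subseteq> Q' \<Longrightarrow> link c P' Q' l"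
  unfolding link_def by blast

lemma link_spans:
  assumes "link c P Q l" "P \<inter> Q = {}"
  shows "spans c P Q l"
proof -
  obtain y x z w where "l = {y, x, z, w}" "y \<noteq> x" "z \<noteq> w" "y \<in> P" "x \<in> P" "z \<in> Q" "w \<in> Q"
     "c {y, x, z}" "c {x, z, w}" using assms by (auto simp: link_def)
  with assms(2) show ?thesis unfolding spans_def anchored_def
    by (intro exI[of _ "[y, x, z, w]"]) auto
qed

lemma link_subset: "link c P Q l \<Longrightarrow> l \<subseteq> P \<union> Q"
  by (auto simp: link_def)

lemma link_card: "link c P Q l \<Longrightarrow> finite l \<and> card l \<le> 4"
  by (auto simp: link_def card_insert_if)

lemma link_nonempty: "link c P Q l \<Longrightarrow> l \<noteq> {}"
  by (auto simp: link_def)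

section \<open>Homogeneous tuples\<close>

text \<open>\<open>ramsey_full\<close> lives on \<open>{..<M}\<close>; an injection into
  \<open>X\<close> carries it over, with an \<open>M\<close> that works for all colourings and sets
  at once. Blue cliques are expressed as red cliques of the complementary colouring.\<close>

lemma red_clique_or_blue_clique:
  "\<exists>M::nat. \<forall>(c::'a set \<Rightarrow> bool) X. finite X \<and> M \<le> card X \<longrightarrow>
     (\<exists>Y\<subseteq>X. card Y = K \<and> red_clique c Y) \<or> (\<exists>Y\<subseteq>X. card Y = L \<and> red_clique (\<lambda>e. \<not> c e) Y)"
proof -
  obtain M :: nat where M: "partn_lst {..<M} [K, L] 3" using ramsey_full by blast
  have "(\<exists>Y\<subseteq>X. card Y = K \<and> red_clique c Y) \<or> (\<exists>Y\<subseteq>X. card Y = L \<and> red_clique (\<lambda>e. \<not> c e) Y)"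
    if X: "finite X" "M \<le> card X" for c :: "'a set \<Rightarrow> bool" and X
  proof -
    obtain h where h: "inj_on h {..<M}" "h ` {..<M} \<subseteq> X"
      using card_le_inj[of "{..<M}" X] X by auto
    define f where "f e = (if c (h ` e) then 0 else (1::nat))" for e
    have "f \<in> nsets {..<M} 3 \<rightarrow> {..<length [K, L]}" by (auto simp: f_def)
    from bspec[OF M[unfolded partn_lst_def] this]
    obtain i where "i < length [K, L]" and i0: "monochromatic {..<M} ([K, L] ! i) 3 f i" by blast
    then have i: "i < 2" by simp
    from i0 obtain H where H: "H \<in> nsets {..<M} ([K, L] ! i)" "f ` nsets H 3 \<subseteq> {i}"
      unfolding monochromatic_def by metis
    have sub: "H \<subseteq> {..<M}" and cH: "card (h ` H) = [K, L] ! i"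
      using H h by (auto simp: nsets_def card_image inj_on_subset)
    have *: "c e \<longleftrightarrow> i = 0" if e: "e \<subseteq> h ` H" "card e = 3" for e
    proof -
      obtain e' where e': "e' \<subseteq> H" "e = h ` e'" using e by (meson subset_imageE)
      have "inj_on h e'" using e' sub h(1) by (meson inj_on_subset)
      then have "card e' = 3" using e e' by (simp add: card_image)
      then have "e' \<in> nsets H 3" using e' by (auto simp: nsets_def card_ge_0_finite)
      then have "f e' = i" using H by auto
      then show ?thesis using e'(2) i by (auto simp: f_def split: if_splits)
    qed
    have HX: "h ` H \<subseteq> X" using h sub by auto
    from i consider "i = 0" | "i = 1" by linarith
    then show ?thesis
    proof cases
      case 1
      then have "card (h ` H) = K \<and> red_clique c (h ` H)" using * cH by (simp add: red_clique_def)
      then show ?thesis using HX by blast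
    next
      case 2
      then have "card (h ` H) = L \<and> red_clique (\<lambda>e. \<not> c e) (h ` H)" using * cH by (simp add: red_clique_def)
      then show ?thesis using HX by blast
    qed
  qed
  then show ?thesis by blast
qed

text \<open>The direction follows the edges of \<open>H_E\<close>: two vertices in \<open>P\<close>
  and one in \<open>Q\<close>. With \<open>b = False\<close> this is a blue arc from
  \<open>P\<close> to \<open>Q\<close>.\<close>

definition homog :: "('a set \<Rightarrow> bool) \<Rightarrow> bool \<Rightarrow> 'a set \<Rightarrow> 'a set \<Rightarrow> bool" where
  "homog c b P Q \<longleftrightarrow> (\<forall>x\<in>P. \<forall>x'\<in>P. \<forall>y\<in>Q. x \<noteq> x' \<longrightarrow> c {x, x', y} = b)"

lemma homog_mono: "homog c b P Q \<Longrightarrow> P' \<subseteq> P \<Longrightarrow> Q' \<subseteq> Q \<Longrightarrow> homog c b P' Q'"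
  unfolding homog_def by blast

text \<open>
  Colouring a triple \<open>a < b < d\<close> of indices by the vector of all colours of the triples that it
  induces in pairs of sets reduces the statement to the one-set Ramsey theorem: the \<open>i\<close>-th part
  is read off the \<open>i\<close>-th block of consecutive indices.
\<close>
lemma ramsey_tuple:
  "\<exists>S::nat. \<forall>(c::'a set \<Rightarrow> bool) (B::'b set) X. finite B \<and> card B \<le> k \<and>
      (\<forall>i\<in>B. finite (X i) \<and> S \<le> card (X i)) \<longrightarrow>
     (\<exists>Y. (\<forall>i\<in>B. Y i \<subseteq> X i \<and> card (Y i) = q) \<and>
        (\<forall>i\<in>B. \<forall>j\<in>B. i \<noteq> j \<longrightarrow> (\<exists>b. homog c b (Y i) (Y j))))"
proof -
  \<comment> \<open>A colour is a set of entries made of the numbers of two parts and a flag. The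
    palette depends on \<open>k\<close> only, so \<open>S\<close> can be chosen before the colouring
    and the parts are known.\<close>
  define D where "D = Pow ({..<k} \<times> {..<k} \<times> (UNIV :: bool set))"
  have "finite D" by (simp add: D_def)
  then obtain \<phi> where \<phi>: "bij_betw \<phi> D {0..<card D}" using ex_bij_betw_finite_nat by blast
  obtain S :: nat where S: "partn_lst {..<S} (replicate (card D) (k * q)) 3" using ramsey_full by blast
  have "\<exists>Y. (\<forall>i\<in>B. Y i \<subseteq> X i \<and> card (Y i) = q) \<and>
        (\<forall>i\<in>B. \<forall>j\<in>B. i \<noteq> j \<longrightarrow> (\<exists>b. homog c b (Y i) (Y j)))"
    if B: "finite B" "card B \<le> k" and X: "\<forall>i\<in>B. finite (X i) \<and> S \<le> card (X i)"
    for c :: "'a set \<Rightarrow> bool" and B :: "'b set" and X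
  proof -
    obtain \<nu> where \<nu>: "bij_betw \<nu> B {0..<card B}" using ex_bij_betw_finite_nat B by blast
    have "\<exists>h. inj_on h {..<S} \<and> h ` {..<S} \<subseteq> X i" if "i \<in> B" for i
      using card_le_inj[of "{..<S}" "X i"] X that by auto
    then obtain h where h: "\<And>i. i \<in> B \<Longrightarrow> inj_on (h i) {..<S} \<and> h i ` {..<S} \<subseteq> X i" by metis
    define g where "g e i = sorted_list_of_set e ! i" for e :: "nat set" and i
    have g: "g {a, b, d} 0 = a" "g {a, b, d} 1 = b" "g {a, b, d} 2 = d" if "a < b" "b < d" for a b d
      using that by (simp_all add: g_def)
    \<comment> \<open>The flag \<open>True\<close> marks triples whose single vertex, from part
      \<open>j\<close>, has the largest index; \<open>False\<close> marks those where it has the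
      smallest.\<close>
    define V where "V e = {(\<nu> i, \<nu> j, True) | i j. i \<in> B \<and> j \<in> B \<and> c {h i (g e 0), h i (g e 1), h j (g e 2)}}
       \<union> {(\<nu> i, \<nu> j, False) | i j. i \<in> B \<and> j \<in> B \<and> c {h j (g e 0), h i (g e 1), h i (g e 2)}}" for e
    have \<nu>k: "\<nu> i < k" if "i \<in> B" for i using bij_betwE[OF \<nu>] B(2) that by fastforce
    have VD: "V e \<in> D" for e using \<nu>k by (auto simp: V_def D_def)
    have "(\<lambda>e. \<phi> (V e)) \<in> nsets {..<S} 3 \<rightarrow> {..<card D}"
      using VD \<phi> by (fastforce simp: bij_betw_def)
    then obtain v M where v: "v < card D" and M: "M \<in> nsets {..<S} (k * q)"
       "(\<lambda>e. \<phi> (V e)) ` nsets M 3 \<subseteq> {v}"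
      using partn_lstE[OF S, of "\<lambda>e. \<phi> (V e)" "card D"] by (metis length_replicate nth_replicate)
    have MS: "M \<subseteq> {..<S}" "finite M" "card M = k * q" using M by (auto simp: nsets_def)
    have Veq: "V e = V e'" if "e \<in> nsets M 3" "e' \<in> nsets M 3" for e e'
    proof -
      have "\<phi> (V e) = \<phi> (V e')" using M(2) that by blast
      then show ?thesis using \<phi> VD by (metis bij_betw_def inj_onD)
    qed
    have in3: "{a, b, d} \<in> nsets M 3" if "a < b" "b < d" "a \<in> M" "b \<in> M" "d \<in> M" for a b d
      using that by (auto simp: nsets_def)
    have \<nu>inj: "\<nu> i = \<nu> j \<longleftrightarrow> i = j" if "i \<in> B" "j \<in> B" for i j
      using \<nu> that by (auto simp: bij_betw_def inj_on_def)
    have VT: "(\<nu> i, \<nu> j, True) \<in> V {a, b, d} \<longleftrightarrow> c {h i a, h i b, h j d}"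
      if "a < b" "b < d" "i \<in> B" "j \<in> B" for i j a b d
      using that \<nu>inj unfolding V_def g[OF that(1,2)] by auto
    have VF: "(\<nu> i, \<nu> j, False) \<in> V {a, b, d} \<longleftrightarrow> c {h j a, h i b, h i d}"
      if "a < b" "b < d" "i \<in> B" "j \<in> B" for i j a b d
      using that \<nu>inj unfolding V_def g[OF that(1,2)] by auto
    have up: "c {h i a, h i b, h j d} = c {h i a', h i b', h j d'}"
      if "a < b" "b < d" "a' < b'" "b' < d'" "i \<in> B" "j \<in> B" "{a, b, d, a', b', d'} \<subseteq> M" for i j a b d a' b' d'
    proof -
      have "V {a, b, d} = V {a', b', d'}" using that by (intro Veq in3) auto
      then show ?thesis using VT[of a b d i j] VT[of a' b' d' i j] that by auto
    qed
    have down: "c {h j a, h i b, h i d} = c {h j a', h i b', h i d'}"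
      if "a < b" "b < d" "a' < b'" "b' < d'" "i \<in> B" "j \<in> B" "{a, b, d, a', b', d'} \<subseteq> M" for i j a b d a' b' d'
    proof -
      have "V {a, b, d} = V {a', b', d'}" using that by (intro Veq in3) auto
      then show ?thesis using VF[of a b d i j] VF[of a' b' d' i j] that by auto
    qed
    obtain f where f: "bij_betw f {0..<k * q} M" "strict_mono_on {0..<k * q} f"
      using ex_bij_betw_strict_mono_card[OF MS(2)] MS(3) by (metis atLeast0LessThan)
    define I where "I i = {\<nu> i * q..<(\<nu> i + 1) * q}" for i
    have Ik: "I i \<subseteq> {0..<k * q}" if "i \<in> B" for i
    proof -
      have "(\<nu> i + 1) * q \<le> k * q" using \<nu>k[OF that] by (intro mult_le_mono1) auto
      then show ?thesis by (auto simp: I_def)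
    qed
    have fI: "f ` I i \<subseteq> M" if "i \<in> B" for i using f(1) Ik[OF that] by (auto simp: bij_betw_def)
    have less: "f a < f b" if "a \<in> I i" "b \<in> I j" "a < b" "i \<in> B" "j \<in> B" for a b i j
      using f(2) Ik that by (meson strict_mono_onD subsetD)
    \<comment> \<open>Blocks of different parts never interleave: an index of block \<open>j\<close>
      lies above or below every pair of block \<open>i\<close>, so the two flags cover all
      cases.\<close>
    have ord: "a < b" if "a \<in> I i" "b \<in> I j" "\<nu> i < \<nu> j" for a b i j
    proof -
      have "(\<nu> i + 1) * q \<le> \<nu> j * q" using that(3) by (intro mult_le_mono1) auto
      then show ?thesis using that by (auto simp: I_def)
    qed
    define Y where "Y i = (h i \<circ> f) ` I i" for i
    have "Y i \<subseteq> X i" if "i \<in> B" for i using fI[OF that] h[OF that] MS(1) by (auto simp: Y_def)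
    moreover have "card (Y i) = q" if "i \<in> B" for i
    proof -
      have "inj_on f (I i)" using f(1) Ik[OF that] by (auto simp: bij_betw_def inj_on_subset)
      moreover have "inj_on (h i) (f ` I i)" using h[OF that] fI[OF that] MS(1) by (meson inj_on_subset)
      ultimately have "card (Y i) = card (I i)" unfolding Y_def by (intro card_image comp_inj_on)
      then show ?thesis by (simp add: I_def)
    qed
    moreover have "\<exists>b. homog c b (Y i) (Y j)" if ij: "i \<in> B" "j \<in> B" "i \<noteq> j" for i j
    proof -
      have eq: "c {h i (f s), h i (f t), h j (f u)} = c {h i (f s'), h i (f t'), h j (f u')}"
        if st: "s \<in> I i" "t \<in> I i" "u \<in> I j" "s < t" "s' \<in> I i" "t' \<in> I i" "u' \<in> I j" "s' < t'"
        for s t u s' t' u'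
      proof (cases "\<nu> i < \<nu> j")
        case True
        have "f s < f t" "f s' < f t'" using less[of _ i _ i] st ij by auto
        moreover have "f t < f u" "f t' < f u'" using less[of _ i _ j] ord[of _ i _ j] True st ij by auto
        ultimately show ?thesis using up[of "f s" "f t" "f u" "f s'" "f t'" "f u'" i j] fI[OF ij(1)] fI[OF ij(2)] st ij
          by auto
      next
        case False
        then have "\<nu> j < \<nu> i" using \<nu>inj[OF ij(1,2)] ij(3) by linarith
        then have "f u < f s" "f u' < f s'" using less[of _ j _ i] ord[of _ j _ i] st ij by auto
        moreover have "f s < f t" "f s' < f t'" using less[of _ i _ i] st ij by auto
        ultimately have "c {h j (f u), h i (f s), h i (f t)} = c {h j (f u'), h i (f s'), h i (f t')}"
          using down[of "f u" "f s" "f t" "f u'" "f s'" "f t'" i j] fI[OF ij(1)] fI[OF ij(2)] st ij by auto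
        then show ?thesis by (simp add: insert_commute)
      qed
      show ?thesis
      proof (cases "\<exists>s t u. s \<in> I i \<and> t \<in> I i \<and> u \<in> I j \<and> s < t")
        case True
        then obtain s t u where stu: "s \<in> I i" "t \<in> I i" "u \<in> I j" "s < t" by blast
        have "homog c (c {h i (f s), h i (f t), h j (f u)}) (Y i) (Y j)"
          unfolding homog_def
        proof (intro ballI impI)
          fix x x' y assume "x \<in> Y i" "x' \<in> Y i" "y \<in> Y j" "x \<noteq> x'"
          then obtain s' t' u' where *: "s' \<in> I i" "t' \<in> I i" "u' \<in> I j" "x = h i (f s')" "x' = h i (f t')"
            "y = h j (f u')" "s' \<noteq> t'" by (auto simp: Y_def)
          show "c {x, x', y} = c {h i (f s), h i (f t), h j (f u)}"
          proof (cases "s' < t'")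
            case True
            then show ?thesis using eq[OF *(1,2,3) _ stu] *(4-6) by blast
          next
            case False
            then have "t' < s'" using *(7) by linarith
            then have "c {h i (f t'), h i (f s'), h j (f u')} = c {h i (f s), h i (f t), h j (f u)}"
              using eq[OF *(2,1,3) _ stu] by blast
            then show ?thesis using * by (simp add: insert_commute)
          qed
        qed
        then show ?thesis by blast
      next
        \<comment> \<open>With fewer than two indices in block \<open>i\<close>, or none in block
          \<open>j\<close>, homogeneity holds vacuously.\<close>
        case False
        have "homog c True (Y i) (Y j)"
          unfolding homog_def
        proof (intro ballI impI)
          fix x x' y assume "x \<in> Y i" "x' \<in> Y i" "y \<in> Y j" "x \<noteq> x'"
          then obtain s' t' u' where "s' \<in> I i" "t' \<in> I i" "u' \<in> I j" "s' \<noteq> t'" by (auto simp: Y_def)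
          then show "c {x, x', y} = True" using False by (metis linorder_neqE_nat)
        qed
        then show ?thesis by blast
      qed
    qed
    ultimately show ?thesis by blast
  qed
  then show ?thesis by blast
qed

section \<open>Covering by few walks\<close>

lemma successively_rev_symp:
  assumes "symp G"
  shows "successively G (rev xs) = successively G xs"
proof -
  have "(\<lambda>a b. G b a) = G" using assms by (intro ext) (metis sympD)
  then show ?thesis unfolding successively_rev by (rule arg_cong[where f = "\<lambda>R. successively R xs"])
qed

text \<open>From its last vertex the walk returns along itself to \<open>x\<close>; the appended
  part \<open>t\<close> is the reversed suffix without its first vertex. It visits a vertex at most
  as often as the suffix does, hence the factor 2.\<close>

lemma walk_ending_at:
  assumes "successively G W" "symp G" "x \<in> set W"
  shows "\<exists>W'. successively G W' \<and> W' \<noteq> [] \<and> set W' = set W \<and> last W' = x \<and>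
    (\<forall>z. count_list W' z \<le> 2 * count_list W z)"
proof -
  obtain u v where W: "W = u @ x # v" using assms(3) by (meson split_list)
  obtain e t where et: "rev (x # v) = e # t" by (cases "rev (x # v)") auto
  note sG = successively_rev_symp[OF assms(2)]
  have "successively G (x # v)" using assms(1) W by (simp add: successively_append_iff)
  then have "successively G (e # t)" using et sG by metis
  moreover have le: "last (x # v) = e"
  proof -
    have "hd (rev (x # v)) = last (x # v)" by (rule hd_rev)
    then show ?thesis using et by simp
  qed
  then have lW: "last W = e" using W by (simp del: last.simps)
  ultimately have "successively G (W @ t)"
    using assms(1) lW by (auto simp: successively_append_iff successively_Cons)
  moreover have "last (W @ t) = x"
  proof (cases "t = []")
    case True
    then have "v = []" using et by (cases v) auto
    then show ?thesis using True W by simp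
  next
    case False
    have "last (e # t) = x" unfolding et[symmetric] by simp
    then show ?thesis using False by simp
  qed
  moreover have setet: "set (e # t) = set (x # v)" by (metis et set_rev)
  then have "set (W @ t) = set W" using W by auto
  moreover have "count_list (W @ t) z \<le> 2 * count_list W z" for z
  proof -
    have "count_list t z \<le> count_list (e # t) z" by simp
    also have "\<dots> = count_list (x # v) z" by (metis et count_list_rev)
    also have "\<dots> \<le> count_list W z" using W by simp
    finally show ?thesis by simp
  qed
  ultimately show ?thesis using W by (intro exI[of _ "W @ t"]) auto
qed

text \<open>
  A vertex cover by as few walks as possible, where a cover by \<open>k\<close> walks may use each vertex
  \<open>2 ^ (r - k)\<close> times. As long as \<open>k \<ge> r\<close> two last vertices are adjacent and the walks can be
  concatenated for free; for \<open>k < r\<close>, joining two walks along any edge between them at most doubles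
  the multiplicities.
\<close>
lemma walk_cover:
  assumes "finite C" "symp G"
    and noind: "\<And>I. I \<subseteq> C \<Longrightarrow> card I = r \<Longrightarrow> \<exists>x\<in>I. \<exists>y\<in>I. x \<noteq> y \<and> G x y"
  obtains \<W> where "finite \<W>" "card \<W> < r"
    "\<And>W. W \<in> \<W> \<Longrightarrow> W \<noteq> [] \<and> successively G W \<and> (\<forall>x. count_list W x \<le> 2 ^ r)"
    "\<And>W W'. W \<in> \<W> \<Longrightarrow> W' \<in> \<W> \<Longrightarrow> W \<noteq> W' \<Longrightarrow> set W \<inter> set W' = {}"
    "(\<Union>W\<in>\<W>. set W) = C"
    "\<And>W W' x y. W \<in> \<W> \<Longrightarrow> W' \<in> \<W> \<Longrightarrow> W \<noteq> W' \<Longrightarrow> x \<in> set W \<Longrightarrow> y \<in> set W' \<Longrightarrow> \<not> G x y"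
proof -
  define cover where "cover k \<W> \<longleftrightarrow> finite \<W> \<and> card \<W> = k \<and>
     (\<forall>W\<in>\<W>. W \<noteq> [] \<and> successively G W \<and> (\<forall>x. count_list W x \<le> 2 ^ (r - k))) \<and>
     (\<forall>W\<in>\<W>. \<forall>W'\<in>\<W>. W \<noteq> W' \<longrightarrow> set W \<inter> set W' = {}) \<and> (\<Union>W\<in>\<W>. set W) = C" for k \<W>
  \<comment> \<open>Two walks are replaced by one on the same vertices. Against a minimal
    \<open>k\<close>, this is the contradiction at which both arguments below aim.\<close>
  have merge: "\<exists>\<W>'. cover (k - 1) \<W>'"
    if cov: "cover k \<W>" and W12: "W1 \<in> \<W>" "W2 \<in> \<W>" "W1 \<noteq> W2"
      and W: "W \<noteq> []" "successively G W" "\<And>x. count_list W x \<le> 2 ^ (r - (k - 1))" "set W = set W1 \<union> set W2"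
    for k \<W> W1 W2 W
  proof -
    define \<V> where "\<V> = \<W> - {W1, W2}"
    have dj: "set U \<inter> set V = {}" if "U \<in> \<W>" "V \<in> \<W>" "U \<noteq> V" for U V
      using cov that by (simp add: cover_def)
    have disj: "set W \<inter> set V = {}" if "V \<in> \<V>" for V
      using dj[of W1 V] dj[of W2 V] that W12 W(4) by (auto simp: \<V>_def)
    then have "W \<notin> \<V>" using W(1) by (metis Int_absorb set_empty)
    moreover have "card \<V> = k - 2" using cov W12 by (simp add: cover_def \<V>_def card_Diff_subset)
    moreover have "k \<ge> 2"
    proof -
      have "card {W1, W2} \<le> card \<W>" using cov W12 by (intro card_mono) (auto simp: cover_def)
      then show ?thesis using cov W12 by (simp add: cover_def)
    qed
    moreover have fin: "finite \<V>" using cov by (simp add: cover_def \<V>_def)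
    ultimately have "card (insert W \<V>) = k - 1" by simp
    moreover have "count_list V x \<le> 2 ^ (r - (k - 1))" if "V \<in> \<V>" for V x
    proof -
      have "count_list V x \<le> 2 ^ (r - k)" using that cov by (simp add: cover_def \<V>_def)
      also have "\<dots> \<le> 2 ^ (r - (k - 1))" by (intro power_increasing) auto
      finally show ?thesis .
    qed
    moreover have "(\<Union>V\<in>insert W \<V>. set V) = C"
    proof -
      have "\<W> = insert W1 (insert W2 \<V>)" using W12 by (auto simp: \<V>_def)
      moreover have "(\<Union>V\<in>\<W>. set V) = C" using cov by (simp add: cover_def)
      ultimately show ?thesis using W(4) by auto
    qed
    moreover have "\<forall>U\<in>insert W \<V>. \<forall>V\<in>insert W \<V>. U \<noteq> V \<longrightarrow> set U \<inter> set V = {}"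
    proof (intro ballI impI)
      fix U V assume UV: "U \<in> insert W \<V>" "V \<in> insert W \<V>" "U \<noteq> V"
      consider "U = W" "V \<in> \<V>" | "V = W" "U \<in> \<V>" | "U \<in> \<V>" "V \<in> \<V>" using UV by blast
      then show "set U \<inter> set V = {}"
      proof cases
        case 3
        then show ?thesis using dj UV(3) by (simp add: \<V>_def)
      qed (use disj in blast)+
    qed
    moreover have "\<forall>V\<in>\<V>. V \<noteq> [] \<and> successively G V" using cov by (simp add: cover_def \<V>_def)
    ultimately have "cover (k - 1) (insert W \<V>)" unfolding cover_def using W fin by simp
    then show ?thesis by blast
  qed
  note sG = successively_rev_symp[OF assms(2)]
  have "cover (card C) ((\<lambda>x. [x]) ` C)"
    unfolding cover_def using assms(1) by (auto simp: card_image inj_on_def)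
  then have ex: "\<exists>k \<W>. cover k \<W>" by blast
  define k where "k = (LEAST k. \<exists>\<W>. cover k \<W>)"
  obtain \<W> where \<W>: "cover k \<W>" unfolding k_def using LeastI_ex[OF ex] by blast
  have least: "\<not> cover (k - 1) \<V>" if "k > 0" for \<V>
    using not_less_Least[of "k - 1" "\<lambda>k. \<exists>\<W>. cover k \<W>"] that unfolding k_def by auto
  have kpos: "k > 0" if "W \<in> \<W>" for W using \<W> that by (auto simp: cover_def card_gt_0_iff)
  have disj: "set W \<inter> set W' = {}" if "W \<in> \<W>" "W' \<in> \<W>" "W \<noteq> W'" for W W'
    using \<W> that by (simp add: cover_def)
  have "k < r"
  proof (rule ccontr)
    assume k: "\<not> k < r"
    then obtain \<V> where \<V>: "\<V> \<subseteq> \<W>" "card \<V> = r"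
      using \<W> obtain_subset_with_card_n[of r \<W>] by (auto simp: cover_def)
    have last: "last W \<in> set W" if "W \<in> \<W>" for W using \<W> that by (simp add: cover_def)
    have inj: "inj_on last \<V>"
    proof (rule inj_onI)
      fix V W assume a: "V \<in> \<V>" "W \<in> \<V>" "last V = last W"
      then have "last V \<in> set V \<inter> set W" using last[of V] last[of W] \<V> by auto
      then show "V = W" using disj[of V W] a \<V> by auto
    qed
    have C: "C = (\<Union>W\<in>\<W>. set W)" using \<W> by (simp add: cover_def)
    have sub: "last ` \<V> \<subseteq> C" using last \<V>(1) unfolding C by blast
    have "card (last ` \<V>) = r" using inj \<V> by (simp add: card_image)
    from noind[OF sub this] obtain x y where xy: "x \<in> last ` \<V>" "y \<in> last ` \<V>" "x \<noteq> y" "G x y" by blast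
    then obtain W1 W2 where W: "W1 \<in> \<W>" "W2 \<in> \<W>" "W1 \<noteq> W2" "G (last W1) (last W2)"
      using \<V> by auto
    have W': "W1 \<noteq> []" "W2 \<noteq> []" "successively G W1" "successively G W2" using W \<W> by (simp_all add: cover_def)
    have "count_list (W1 @ rev W2) x \<le> 2 ^ (r - (k - 1))" for x
    proof -
      \<comment> \<open>Here \<open>r - k\<close> is 0: the two disjoint walks visit each vertex at
        most once, and so does their concatenation.\<close>
      have c: "count_list W1 x \<le> 1" "count_list W2 x \<le> 1" using W \<W> k by (simp_all add: cover_def)
      have "x \<notin> set W1 \<or> x \<notin> set W2" using disj[of W1 W2] W by auto
      then have "count_list (W1 @ rev W2) x \<le> 1" using c by (auto simp: count_list_0_iff)
      also have "1 \<le> (2::nat) ^ (r - (k - 1))" by simp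
      finally show ?thesis .
    qed
    moreover have "successively G (W1 @ rev W2)" using W(4) W'
      by (simp add: successively_append_iff hd_rev sG del: successively_rev)
    ultimately have "\<exists>\<W>'. cover (k - 1) \<W>'" using W'(1)
      by (intro merge[OF \<W> W(1,2,3), of "W1 @ rev W2"]) simp_all
    then show False using least kpos[OF W(1)] by blast
  qed
  have noedge: "\<not> G x y" if W: "W1 \<in> \<W>" "W2 \<in> \<W>" "W1 \<noteq> W2" and xy: "x \<in> set W1" "y \<in> set W2" for W1 W2 x y
  proof
    assume Gxy: "G x y"
    have W': "successively G W1" "successively G W2" using W \<W> by (simp_all add: cover_def)
    obtain V1 where V1: "successively G V1" "V1 \<noteq> []" "set V1 = set W1" "last V1 = x"
      "\<And>z. count_list V1 z \<le> 2 * count_list W1 z" using walk_ending_at[OF W'(1) assms(2) xy(1)] by blast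
    obtain V2 where V2: "successively G V2" "V2 \<noteq> []" "set V2 = set W2" "last V2 = y"
      "\<And>z. count_list V2 z \<le> 2 * count_list W2 z" using walk_ending_at[OF W'(2) assms(2) xy(2)] by blast
    have "count_list (V1 @ rev V2) z \<le> 2 ^ (r - (k - 1))" for z
    proof -
      have c: "count_list W1 z \<le> 2 ^ (r - k)" "count_list W2 z \<le> 2 ^ (r - k)" using W \<W> by (simp_all add: cover_def)
      have "z \<notin> set W1 \<or> z \<notin> set W2" using disj[of W1 W2] W by auto
      then have "count_list W1 z = 0 \<or> count_list W2 z = 0" by (auto simp: count_list_0_iff)
      then have "count_list (V1 @ rev V2) z \<le> 2 * 2 ^ (r - k)" using c V1(5)[of z] V2(5)[of z] by auto
      also have "\<dots> = 2 ^ Suc (r - k)" by simp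
      \<comment> \<open>The doubling costs one power of 2, which is exactly what lowering the number
        of walks by one allows.\<close>
      also have "Suc (r - k) = r - (k - 1)" using \<open>k < r\<close> kpos[OF W(1)] by simp
      finally show ?thesis .
    qed
    moreover have "successively G (V1 @ rev V2)" using V1 V2 Gxy
      by (simp add: successively_append_iff hd_rev sG del: successively_rev)
    ultimately have "\<exists>\<W>'. cover (k - 1) \<W>'" using V1(2,3) V2(3)
      by (intro merge[OF \<W> W, of "V1 @ rev V2"]) simp_all
    then show False using least kpos[OF W(1)] by blast
  qed
  have mult: "\<forall>x. count_list W x \<le> 2 ^ r" if "W \<in> \<W>" for W
  proof
    fix x
    have "count_list W x \<le> 2 ^ (r - k)" using \<W> that by (simp add: cover_def)
    also have "\<dots> \<le> 2 ^ r" by (intro power_increasing) auto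
    finally show "count_list W x \<le> 2 ^ r" .
  qed
  show thesis
  proof (rule that[of \<W>])
    show "finite \<W>" "card \<W> < r" "(\<Union>W\<in>\<W>. set W) = C" using \<W> \<open>k < r\<close> by (simp_all add: cover_def)
    show "W \<noteq> [] \<and> successively G W \<and> (\<forall>x. count_list W x \<le> 2 ^ r)" if "W \<in> \<W>" for W
      using \<W> mult that by (simp add: cover_def)
  qed (use disj noedge in blast)+
qed

section \<open>Transitive subtournaments\<close>

text \<open>\<open>contains_TT\<close> for vertices of any type; below they are cliques or
  walks.\<close>

definition has_TT :: "'b set \<Rightarrow> ('b \<Rightarrow> 'b \<Rightarrow> bool) \<Rightarrow> nat \<Rightarrow> bool" where
  "has_TT B T l \<longleftrightarrow> (\<exists>f. inj_on f {..<l} \<and> f ` {..<l} \<subseteq> B \<and> (\<forall>i j. i < j \<and> j < l \<longrightarrow> T (f i) (f j)))"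

text \<open>Arcs in both directions are allowed, because all triples between two homogeneous sets
  may be blue.\<close>

definition semicomplete :: "'b set \<Rightarrow> ('b \<Rightarrow> 'b \<Rightarrow> bool) \<Rightarrow> bool" where
  "semicomplete B T \<longleftrightarrow> (\<forall>x\<in>B. \<forall>y\<in>B. x \<noteq> y \<longrightarrow> T x y \<or> T y x)"

lemma contains_TT_iff: "contains_TT V T l \<longleftrightarrow> has_TT V T l"
  unfolding contains_TT_def has_TT_def
  by (intro ex_cong1 conj_cong refl) (meson order.strict_trans)

lemma has_TT_0: "has_TT B T 0"
  by (simp add: has_TT_def)

lemma has_TT_antimono: "has_TT B T l \<Longrightarrow> l' \<le> l \<Longrightarrow> has_TT B T l'"
  unfolding has_TT_def
proof (elim exE conjE)
  fix f assume f: "l' \<le> l" "inj_on f {..<l}" "f ` {..<l} \<subseteq> B" "\<forall>i j. i < j \<and> j < l \<longrightarrow> T (f i) (f j)"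
  have "{..<l'} \<subseteq> {..<l}" using f(1) by auto
  then have "inj_on f {..<l'}" "f ` {..<l'} \<subseteq> B" using f(2,3) by (auto intro: inj_on_subset)
  moreover have "\<forall>i j. i < j \<and> j < l' \<longrightarrow> T (f i) (f j)" using f(1,4) by auto
  ultimately show "\<exists>f. inj_on f {..<l'} \<and> f ` {..<l'} \<subseteq> B \<and> (\<forall>i j. i < j \<and> j < l' \<longrightarrow> T (f i) (f j))"
    by blast
qed

lemma has_TT_mono: "has_TT B T l \<Longrightarrow> B \<subseteq> B' \<Longrightarrow> has_TT B' T l"
  unfolding has_TT_def by (meson order_trans)

lemma has_TTE:
  assumes "has_TT B T l"
  obtains f where "inj_on f {..<l}" "f ` {..<l} \<subseteq> B" "\<And>i j. i < j \<Longrightarrow> j < l \<Longrightarrow> T (f i) (f j)"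
proof -
  obtain f where "inj_on f {..<l} \<and> f ` {..<l} \<subseteq> B \<and> (\<forall>i j. i < j \<and> j < l \<longrightarrow> T (f i) (f j))"
    using assms unfolding has_TT_def by (elim exE)
  with that[of f] show thesis by simp
qed

lemma has_TT_first:
  assumes "has_TT B T l" "v \<notin> B" "\<And>x. x \<in> B \<Longrightarrow> T v x"
  shows "has_TT (insert v B) T (Suc l)"
proof -
  obtain f where f: "inj_on f {..<l}" "f ` {..<l} \<subseteq> B" "\<And>i j. i < j \<Longrightarrow> j < l \<Longrightarrow> T (f i) (f j)"
    by (rule has_TTE[OF assms(1)]) (rule that; simp)
  define g where "g i = (case i of 0 \<Rightarrow> v | Suc i \<Rightarrow> f i)" for i
  have "inj_on g {..<Suc l}"
    using f(1,2) assms(2) by (auto simp: inj_on_def g_def split: nat.splits)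
  moreover have "g ` {..<Suc l} \<subseteq> insert v B" using f(2) by (force simp: g_def less_Suc_eq_0_disj split: nat.splits)
  moreover have "T (g i) (g j)" if "i < j" "j < Suc l" for i j
    using that f(2,3) assms(3) by (auto simp: g_def split: nat.splits)
  ultimately show ?thesis unfolding has_TT_def by (intro exI[of _ g]) simp
qed

lemma has_TT_last:
  assumes "has_TT B T l" "v \<notin> B" "\<And>x. x \<in> B \<Longrightarrow> T x v"
  shows "has_TT (insert v B) T (Suc l)"
proof -
  obtain f where f: "inj_on f {..<l}" "f ` {..<l} \<subseteq> B" "\<And>i j. i < j \<Longrightarrow> j < l \<Longrightarrow> T (f i) (f j)"
    by (rule has_TTE[OF assms(1)]) (rule that; simp)
  define g where "g = f(l := v)"
  have "inj_on g {..<Suc l}"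
    using f(1,2) assms(2) by (fastforce simp: inj_on_def g_def less_Suc_eq)
  moreover have "g ` {..<Suc l} \<subseteq> insert v B" using f(2) by (force simp: g_def less_Suc_eq)
  moreover have "T (g i) (g j)" if "i < j" "j < Suc l" for i j
    using that f(2,3) assms(3) by (auto simp: g_def less_Suc_eq)
  ultimately show ?thesis unfolding has_TT_def by (intro exI[of _ g]) simp
qed

text \<open>The vertices of \<open>U\<close> dominate each other in both directions, so in any order
  they can be put in front of a transitive subtournament of \<open>B\<close>.\<close>

lemma has_TT_sources:
  assumes "finite U" "has_TT B T l" "U \<inter> B = {}" "\<And>x y. x \<in> U \<Longrightarrow> y \<in> U \<union> B \<Longrightarrow> x \<noteq> y \<Longrightarrow> T x y"
  shows "has_TT (U \<union> B) T (l + card U)"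
  using assms
proof (induction U rule: finite_induct)
  case (insert v U)
  have "has_TT (insert v (U \<union> B)) T (Suc (l + card U))"
    by (rule has_TT_first) (use insert in auto)
  with insert show ?case by simp
qed simp

text \<open>In the inductive step a vertex \<open>v\<close> either has \<open>2 ^ l\<close>
  out-neighbours and goes first, or misses \<open>2 ^ l\<close> vertices, which are in-neighbours by
  semicompleteness, and goes last. The bound shows that the minimum defining
  \<open>dir_ramsey\<close> exists.\<close>

lemma has_TT_large:
  assumes "finite B" "2 ^ l \<le> card B" "semicomplete B T"
  shows "has_TT B T l"
  using assms
proof (induction l arbitrary: B)
  case (Suc l)
  then have "card B \<noteq> 0" by (metis not_one_le_zero one_le_power one_le_numeral order_trans)
  then obtain v where v: "v \<in> B" by fastforce
  define O' where "O' = {x \<in> B - {v}. T v x}"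
  define I where "I = {x \<in> B - {v}. \<not> T v x}"
  have OI: "O' \<union> I = B - {v}" "O' \<inter> I = {}" by (auto simp: O'_def I_def)
  have fin: "finite O'" "finite I" using Suc.prems(1) by (auto simp: O'_def I_def)
  have "card O' + card I = card B - 1" using OI fin v Suc.prems(1) by (metis card_Un_disjoint card_Diff_singleton)
  moreover have "2 * 2 ^ l \<le> card B" using Suc.prems by simp
  ultimately have "2 ^ l \<le> card O' \<or> 2 ^ l \<le> card I" using \<open>card B \<noteq> 0\<close> by linarith
  then show ?case
  proof
    assume "2 ^ l \<le> card O'"
    then have "has_TT O' T l" using Suc.prems fin
      by (intro Suc.IH) (auto simp: semicomplete_def O'_def)
    then have "has_TT (insert v O') T (Suc l)" by (rule has_TT_first) (auto simp: O'_def)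
    then show ?thesis by (rule has_TT_mono) (use v in \<open>auto simp: O'_def\<close>)
  next
    assume "2 ^ l \<le> card I"
    then have "has_TT I T l" using Suc.prems fin
      by (intro Suc.IH) (auto simp: semicomplete_def I_def)
    then have "has_TT (insert v I) T (Suc l)"
      by (rule has_TT_last) (use v Suc.prems(3) in \<open>auto simp: I_def semicomplete_def\<close>)
    then show ?thesis by (rule has_TT_mono) (use v in \<open>auto simp: I_def\<close>)
  qed
qed (simp add: has_TT_0)

lemma is_tournament_semicomplete: "is_tournament V T \<Longrightarrow> semicomplete V T"
  unfolding is_tournament_def semicomplete_def by blast

lemma dir_ramsey_contains:
  assumes "dir_ramsey l \<le> n" "is_tournament {..<n} T"
  shows "has_TT {..<n} T l"
proof -
  have "\<exists>N. \<forall>n\<ge>N. \<forall>T. is_tournament {..<n} T \<longrightarrow> contains_TT {..<n} T l"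
    unfolding contains_TT_iff
  proof (intro exI[of _ "2 ^ l"] allI impI)
    fix n T assume "2 ^ l \<le> n" "is_tournament {..<n} T"
    then show "has_TT {..<n} T l" by (intro has_TT_large is_tournament_semicomplete; simp)
  qed
  from LeastI_ex[OF this]
  have "\<forall>n\<ge>dir_ramsey l. \<forall>T. is_tournament {..<n} T \<longrightarrow> contains_TT {..<n} T l"
    unfolding dir_ramsey_def .
  then show ?thesis using assms unfolding contains_TT_iff by simp
qed

lemma has_TT_if_dir_ramsey_le:
  assumes "finite B" "semicomplete B T" "dir_ramsey l \<le> card B"
  shows "has_TT B T l"
proof -
  obtain g where g: "bij_betw g {..<card B} B"
    using ex_bij_betw_nat_finite[OF assms(1)] by (metis atLeast0LessThan)
  \<comment> \<open>Between two vertices joined both ways only the arc from the smaller index is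
    kept, which makes \<open>T'\<close> a tournament inside \<open>T\<close>.\<close>
  define T' where "T' i j \<longleftrightarrow> i \<noteq> j \<and> T (g i) (g j) \<and> (i < j \<or> \<not> T (g j) (g i))" for i j
  have gin: "g i \<in> B" if "i < card B" for i using g that by (auto simp: bij_betw_def)
  have ginj: "g i = g j \<longleftrightarrow> i = j" if "i < card B" "j < card B" for i j
    using g that by (auto simp: bij_betw_def inj_on_def)
  have sc: "T (g i) (g j) \<or> T (g j) (g i)" if "i < card B" "j < card B" "i \<noteq> j" for i j
    using assms(2) gin ginj that unfolding semicomplete_def by blast
  have "is_tournament {..<card B} T'"
    unfolding is_tournament_def
  proof (intro conjI ballI impI)
    fix x y assume "x \<in> {..<card B}" "y \<in> {..<card B}" "x \<noteq> y"
    then show "T' x y = (\<not> T' y x)" using sc[of x y] unfolding T'_def by (cases "x < y") auto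
  qed (simp add: T'_def)
  note TT = dir_ramsey_contains[OF assms(3) this]
  obtain f where f: "inj_on f {..<l}" "f ` {..<l} \<subseteq> {..<card B}" "\<And>i j. i < j \<Longrightarrow> j < l \<Longrightarrow> T' (f i) (f j)"
    by (rule has_TTE[OF TT]) (rule that; simp)
  have "inj_on (g \<circ> f) {..<l}" using f g by (meson bij_betw_def comp_inj_on inj_on_subset)
  moreover have "(g \<circ> f) ` {..<l} \<subseteq> B" using f(2) gin by auto
  ultimately show ?thesis
    unfolding has_TT_def using f(3) by (intro exI[of _ "g \<circ> f"]) (auto simp: T'_def)
qed

section \<open>Lower bounds for \<open>dir_ramsey\<close>\<close>

lemma less_dir_ramsey:
  assumes "is_tournament {..<n} T" "\<not> has_TT {..<n} T l"
  shows "n < dir_ramsey l"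
  using dir_ramsey_contains assms by (meson not_less)

text \<open>Minimality only provides a bad tournament on some \<open>n' \<ge> n\<close> vertices;
  \<open>less_dir_ramsey\<close> gives \<open>n' < Suc n\<close>, so \<open>n' = n\<close>.\<close>

lemma tournament_without_TT:
  assumes "dir_ramsey l = Suc n"
  obtains T where "is_tournament {..<n} T" "\<not> has_TT {..<n} T l"
proof -
  have "\<not> (\<forall>n'\<ge>n. \<forall>T. is_tournament {..<n'} T \<longrightarrow> contains_TT {..<n'} T l)"
    using not_less_Least[of n "\<lambda>N. \<forall>n\<ge>N. \<forall>T. is_tournament {..<n} T \<longrightarrow> contains_TT {..<n} T l"] assms
    unfolding dir_ramsey_def by simp
  then obtain n' T where n': "n' \<ge> n" "is_tournament {..<n'} T" "\<not> has_TT {..<n'} T l"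
    by (auto simp: contains_TT_iff)
  then have "n' < Suc n" using less_dir_ramsey assms by metis
  then have "n' = n" using n' by simp
  then show thesis using that n' by blast
qed

lemma has_TT_card: "has_TT B T l \<Longrightarrow> finite B \<Longrightarrow> l \<le> card B"
  unfolding has_TT_def by (metis card_inj_on_le card_lessThan)

lemma le_dir_ramsey: "l \<le> dir_ramsey l"
proof (cases l)
  case (Suc k)
  have "is_tournament {..<k} (<)" by (auto simp: is_tournament_def)
  moreover have "\<not> has_TT {..<k} (<) l" using has_TT_card[of "{..<k}" "(<)" l] Suc by auto
  ultimately show ?thesis using less_dir_ramsey[of k "(<)" l] Suc by simp
qed simp

lemma dir_ramsey_2: "dir_ramsey 2 = 2"
proof (rule antisym)
  show "dir_ramsey 2 \<le> 2"
    unfolding dir_ramsey_def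
  proof (rule Least_le, intro allI impI)
    fix n :: nat and T assume n: "n \<ge> 2" "is_tournament {..<n} T"
    have "0 \<in> {..<n}" "1 \<in> {..<n}" "(0::nat) \<noteq> 1" using n(1) by simp_all
    then have "T 0 1 \<or> T 1 0" using n(2) unfolding is_tournament_def by blast
    then obtain a b :: nat where ab: "a < 2" "b < 2" "a \<noteq> b" "T a b"
      by (metis one_less_numeral_iff semiring_norm(76) zero_less_numeral zero_neq_one)
    show "contains_TT {..<n} T 2"
      unfolding contains_TT_def
      using ab n by (intro exI[of _ "\<lambda>i. if i = 0 then a else b"]) (auto simp: inj_on_def less_2_cases_iff)
  qed
qed (rule le_dir_ramsey)

text \<open>Blow up one vertex of an extremal tournament to a cyclic triangle.\<close>
lemma dir_ramsey_Suc:
  assumes "l \<ge> 2"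
  shows "dir_ramsey l + 2 \<le> dir_ramsey (Suc l)"
proof -
  obtain n where n: "dir_ramsey l = Suc n" using le_dir_ramsey[of l] assms by (cases "dir_ramsey l") auto
  then have n0: "n > 0" using le_dir_ramsey[of l] assms by simp
  obtain T where T: "is_tournament {..<n} T" "\<not> has_TT {..<n} T l" by (rule tournament_without_TT[OF n])
  \<comment> \<open>\<open>\<pi>\<close> collapses the triangle \<open>0, n, n + 1\<close> to the
    blown-up vertex \<open>0\<close>.\<close>
  define \<pi> where "\<pi> z = (if z < n then z else 0)" for z
  define T' where "T' x y \<longleftrightarrow> (if \<pi> x = \<pi> y then (x, y) \<in> {(0, n), (n, n + 1), (n + 1, 0)} else T (\<pi> x) (\<pi> y))" for x y
  have \<pi>n: "\<pi> z < n" for z using n0 by (simp add: \<pi>_def)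
  have cls: "\<pi> x = \<pi> y \<Longrightarrow> x \<noteq> y \<Longrightarrow> x \<in> {..<n + 2} \<Longrightarrow> y \<in> {..<n + 2} \<Longrightarrow> x \<in> {0, n, n + 1} \<and> y \<in> {0, n, n + 1}" for x y
    by (auto simp: \<pi>_def split: if_splits)
  have cyc: "(x, y) \<in> {(0, n), (n, n + 1), (n + 1, 0)} \<longleftrightarrow> (y, x) \<notin> {(0, n), (n, n + 1), (n + 1, 0)}"
    if "x \<in> {0, n, n + 1}" "y \<in> {0, n, n + 1}" "x \<noteq> y" for x y
    using that n0 by auto
  have "is_tournament {..<n + 2} T'"
    unfolding is_tournament_def
  proof (intro conjI ballI impI)
    fix x y assume xy: "x \<in> {..<n + 2}" "y \<in> {..<n + 2}" "x \<noteq> y"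
    show "T' x y = (\<not> T' y x)"
    proof (cases "\<pi> x = \<pi> y")
      case True
      then have "x \<in> {0, n, n + 1}" "y \<in> {0, n, n + 1}" using cls xy by blast+
      with cyc[OF this xy(3)] show ?thesis using True by (simp add: T'_def)
    next
      case False
      moreover have "\<pi> x \<in> {..<n}" "\<pi> y \<in> {..<n}" using \<pi>n by simp_all
      ultimately have "T (\<pi> x) (\<pi> y) = (\<not> T (\<pi> y) (\<pi> x))" using T(1) unfolding is_tournament_def by blast
      then show ?thesis using False by (simp add: T'_def)
    qed
  qed (use n0 in \<open>auto simp: T'_def\<close>)
  moreover have "\<not> has_TT {..<n + 2} T' (Suc l)"
  proof
    assume TT: "has_TT {..<n + 2} T' (Suc l)"
    obtain f where f: "inj_on f {..<Suc l}" "f ` {..<Suc l} \<subseteq> {..<n + 2}"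
      "\<And>i j. i < j \<Longrightarrow> j < Suc l \<Longrightarrow> T' (f i) (f j)"
      by (rule has_TTE[OF TT]) (rule that; simp)
    have fi: "f i \<in> {..<n + 2}" if "i < Suc l" for i using f(2) that by auto
    have fne: "f i \<noteq> f j" if "i < Suc l" "j < Suc l" "i \<noteq> j" for i j
      using f(1) that by (auto simp: inj_on_def)
    have pair: "f i \<in> {0, n, n + 1} \<and> f j \<in> {0, n, n + 1}" if "i < Suc l" "j < Suc l" "i \<noteq> j" "\<pi> (f i) = \<pi> (f j)" for i j
      using cls[OF that(4) fne[OF that(1-3)] fi[OF that(1)] fi[OF that(2)]] .
    have \<pi>0: "\<pi> x = 0" if "x \<in> {0, n, n + 1}" for x using that by (auto simp: \<pi>_def)
    \<comment> \<open>A transitive subtournament cannot contain a whole cyclic triangle.\<close>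
    have no3: False if "p < q" "q < s" "s < Suc l" "f p \<in> {0, n, n + 1}" "f q \<in> {0, n, n + 1}" "f s \<in> {0, n, n + 1}" for p q s
    proof -
      have "T' (f p) (f q)" "T' (f q) (f s)" "T' (f p) (f s)" using f(3) that by auto
      moreover have "\<pi> (f p) = 0" "\<pi> (f q) = 0" "\<pi> (f s) = 0" using \<pi>0 that by blast+
      ultimately have "(f p, f q) \<in> {(0, n), (n, n + 1), (n + 1, 0)}" "(f q, f s) \<in> {(0, n), (n, n + 1), (n + 1, 0)}"
        "(f p, f s) \<in> {(0, n), (n, n + 1), (n + 1, 0)}" unfolding T'_def by presburger+
      then show False using n0 by auto
    qed
    \<comment> \<open>After one index \<open>b\<close> is dropped, \<open>\<pi>\<close> is injective
      on the remaining \<open>l\<close> vertices, and their images form a transitive subtournament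
      of \<open>T\<close>.\<close>
    obtain b where b: "b < Suc l"
      "\<And>i j. i < j \<Longrightarrow> j < Suc l \<Longrightarrow> i \<noteq> b \<Longrightarrow> j \<noteq> b \<Longrightarrow> \<pi> (f i) \<noteq> \<pi> (f j)"
    proof (cases "\<exists>a b. a < b \<and> b < Suc l \<and> \<pi> (f a) = \<pi> (f b)")
      case True
      then obtain a b where ab: "a < b" "b < Suc l" "\<pi> (f a) = \<pi> (f b)" by blast
      show thesis
      proof (rule that[of b])
        fix i j assume ij: "i < j" "j < Suc l" "i \<noteq> b" "j \<noteq> b"
        show "\<pi> (f i) \<noteq> \<pi> (f j)"
        proof
          assume "\<pi> (f i) = \<pi> (f j)"
          then have "f i \<in> {0, n, n + 1}" "f j \<in> {0, n, n + 1}" using pair[of i j] ij by auto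
          moreover have "f b \<in> {0, n, n + 1}" using pair[of a b] ab by auto
          ultimately show False
            using no3[of i j b] no3[of i b j] no3[of b i j] ij ab(2) by (meson linorder_neqE_nat)
        qed
      qed (fact ab)
    next
      case False
      then show thesis using that[of l] by blast
    qed
    define h where "h i = (if i < b then i else Suc i)" for i
    have h: "h i < h j" "h j < Suc l" "h i \<noteq> b" "h j \<noteq> b" if "i < j" "j < l" for i j
      using that by (auto simp: h_def)
    have ne: "\<pi> (f (h i)) \<noteq> \<pi> (f (h j))" if "i < j" "j < l" for i j using b(2) h[OF that] by blast
    have "inj_on (\<lambda>i. \<pi> (f (h i))) {..<l}"
      using ne by (intro inj_onI) (metis lessThan_iff linorder_neqE_nat)
    moreover have "T (\<pi> (f (h i))) (\<pi> (f (h j)))" if "i < j" "j < l" for i j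
      using f(3)[OF h(1,2)[OF that]] ne[OF that] by (simp add: T'_def)
    ultimately have "has_TT {..<n} T l" unfolding has_TT_def using \<pi>n
      by (intro exI[of _ "\<lambda>i. \<pi> (f (h i))"]) auto
    with T show False by blast
  qed
  ultimately have "n + 2 < dir_ramsey (Suc l)" by (rule less_dir_ramsey)
  then show ?thesis using n by simp
qed

lemma dir_ramsey_add:
  assumes "l \<ge> 2"
  shows "dir_ramsey l + 2 * u \<le> dir_ramsey (l + u)"
proof (induction u)
  case (Suc u)
  then show ?case using dir_ramsey_Suc[of "l + u"] assms by simp
qed simp

text \<open>The witness is the Paley tournament on seven vertices with one vertex deleted.\<close>
lemma dir_ramsey_4: "7 \<le> dir_ramsey 4"
proof -
  \<comment> \<open>Row \<open>x\<close> holds \<open>x + 1\<close>, \<open>x + 2\<close> and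
    \<open>x + 4\<close> modulo 7, without the deleted vertex 6; the numbers 1, 2, 4 are the nonzero
    squares modulo 7.\<close>
  define out :: "nat list list" where "out = [[1, 2, 4], [2, 3, 5], [3, 4], [4, 5, 0], [5, 1], [0, 2]]"
  define T where "T x y \<longleftrightarrow> x < 6 \<and> y \<in> set (out ! x)" for x y :: nat
  have six: "{..<6::nat} = {0, 1, 2, 3, 4, 5}" by auto
  have "is_tournament {..<6} T" unfolding is_tournament_def six by (simp add: T_def out_def)
  moreover have "\<not> has_TT {..<6} T 4"
  proof
    assume TT: "has_TT {..<6} T 4"
    obtain f where f: "\<And>i j :: nat. i < j \<Longrightarrow> j < 4 \<Longrightarrow> T (f i) (f j)"
      by (rule has_TTE[OF TT]) (rule that; simp)
    have "\<forall>a\<in>{0, 1, 2, 3, 4, 5}. \<forall>b\<in>set (out ! a). \<forall>c\<in>set (out ! b). c \<in> set (out ! a) \<longrightarrow>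
       (\<forall>d\<in>set (out ! c). \<not> (d \<in> set (out ! a) \<and> d \<in> set (out ! b)))"
      by (simp add: out_def)
    moreover have "T (f 0) (f 1)" "T (f 0) (f 2)" "T (f 0) (f 3)" "T (f 1) (f 2)" "T (f 1) (f 3)" "T (f 2) (f 3)"
      by (rule f; simp)+
    moreover from this(1) have "f 0 \<in> {0, 1, 2, 3, 4, 5}" unfolding six[symmetric] by (simp add: T_def)
    ultimately show False unfolding T_def by metis
  qed
  ultimately have "6 < dir_ramsey 4" by (rule less_dir_ramsey)
  then show ?thesis by simp
qed

text \<open>All of \<open>U\<close> can precede a transitive subtournament of \<open>B - U\<close>,
  so |B - U| < R(l - |U|). If l - |U| \<ge> 2, then |B| + |U| = |B - U| + 2|U| stays below R(l) by
  \<open>dir_ramsey_add\<close>. Otherwise |U| = l - 1 and \<open>B = U\<close>, and the claim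
  becomes 2(l - 1) < R(l). For l \<ge> 4 this follows from R(4) \<ge> 7; for l = 3 it reads 4 <
  R(3), while |B| = 3 excludes the situation altogether.\<close>

lemma card_plus_sources_le:
  assumes "finite B" "semicomplete B T" "\<not> has_TT B T l"
    and U: "U \<subseteq> B" "\<And>x y. x \<in> U \<Longrightarrow> y \<in> B \<Longrightarrow> x \<noteq> y \<Longrightarrow> T x y"
    and l: "l \<ge> 4 \<or> l = 3 \<and> (card B = 3 \<or> 4 < dir_ramsey 3)"
  shows "card B + card U < dir_ramsey l"
proof -
  have fU: "finite U" using assms finite_subset by blast
  have UB: "U \<union> (B - U) = B" using U by blast
  have add: "has_TT B T (p + card U)" if "has_TT (B - U) T p" for p
    using has_TT_sources[OF fU that] U UB by auto
  have Ul: "card U < l"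
  proof (rule ccontr)
    assume "\<not> card U < l"
    then show False using add[OF has_TT_0] has_TT_antimono[of B T "0 + card U" l] assms(3) by simp
  qed
  have cB: "card B = card (B - U) + card U" using assms(1) U fU
    by (metis UB Diff_disjoint card_Un_disjoint finite_Diff add.commute)
  have semi: "semicomplete (B - U) T" using assms(2) by (auto simp: semicomplete_def)
  have less: "card (B - U) < dir_ramsey (l - card U)"
  proof (rule ccontr)
    assume "\<not> ?thesis"
    then have "has_TT (B - U) T (l - card U)"
      using assms(1) semi by (intro has_TT_if_dir_ramsey_le) auto
    from add[OF this] show False using assms(3) Ul by simp
  qed
  show ?thesis
  proof (cases "l - card U \<ge> 2")
    case True
    from dir_ramsey_add[OF this, of "card U"] show ?thesis using less cB Ul by simp
  next
    case False
    then have lU: "l = Suc (card U)" using Ul by simp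
    have "B - U = {}"
    proof (rule ccontr)
      assume "B - U \<noteq> {}"
      then obtain x where "x \<in> B - U" by blast
      then have "has_TT (B - U) T 1" unfolding has_TT_def by (intro exI[of _ "\<lambda>_. x"]) (auto simp: inj_on_def)
      from add[OF this] show False using assms(3) lU by simp
    qed
    then have BU: "card B = card U" using U(1) by (simp add: subset_antisym)
    show ?thesis
    proof (cases "l \<ge> 4")
      case False
      then show ?thesis using l lU BU by auto
    next
      case l4: True
      then have "dir_ramsey 4 + 2 * (l - 4) \<le> dir_ramsey l" using dir_ramsey_add[of 4 "l - 4"] by simp
      then show ?thesis using dir_ramsey_4 BU lU l4 by linarith
    qed
  qed
qed

section \<open>Disjoint links along a walk\<close>

text \<open>Among \<open>k\<close> disjoint links one survives the deletion of any fewer than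
  \<open>k\<close> vertices; this is the robustness that lets links be chosen disjointly along a
  walk.\<close>

definition rlinked :: "('a set \<Rightarrow> bool) \<Rightarrow> nat \<Rightarrow> 'a set \<Rightarrow> 'a set \<Rightarrow> bool" where
  "rlinked c k P Q \<longleftrightarrow> (\<exists>F. finite F \<and> card F = k \<and> (\<forall>l\<in>F. link c P Q l) \<and> disjoint F)"

lemma rlinked_sym: "rlinked c k P Q \<Longrightarrow> rlinked c k Q P"
  unfolding rlinked_def using link_sym by metis

text \<open>A maximal family of disjoint links that falls short of \<open>k\<close> has a union that
  meets every link, and each link has at most four vertices. Deleting this small set destroys all
  links.\<close>

lemma not_rlinked:
  "rlinked c k P Q \<or> (\<exists>Z. finite Z \<and> card Z \<le> 4 * k \<and> (\<forall>l. link c P Q l \<longrightarrow> l \<inter> Z \<noteq> {}))"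
proof (induction k)
  case 0
  then show ?case by (auto simp: rlinked_def intro!: exI[of _ "{}"])
next
  case (Suc k)
  then show ?case
  proof
    assume "rlinked c k P Q"
    then obtain F where F: "finite F" "card F = k" "\<forall>l\<in>F. link c P Q l" "disjoint F"
      unfolding rlinked_def by metis
    have fin: "finite (\<Union>F)" using F link_card by (metis finite_Union)
    have "card (\<Union>F) \<le> (\<Sum>l\<in>F. card l)" by (rule card_Union_le_sum_card)
    also have "\<dots> \<le> (\<Sum>l\<in>F. 4)" using F(3) link_card by (intro sum_mono) blast
    finally have card: "card (\<Union>F) \<le> 4 * Suc k" using F(2) by simp
    show ?thesis
    proof (cases "\<forall>l. link c P Q l \<longrightarrow> l \<inter> \<Union>F \<noteq> {}")
      case True
      then show ?thesis using fin card by (intro disjI2 exI[of _ "\<Union>F"]) simp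
    next
      case False
      then obtain l where l: "link c P Q l" "l \<inter> \<Union>F = {}" by metis
      then have "l \<notin> F" using link_nonempty[of c P Q l] by auto
      moreover have "disjoint (insert l F)" using F(4) l(2)
        unfolding disjoint_def by (metis Int_commute Union_disjoint insert_iff)
      ultimately have "rlinked c (Suc k) P Q" using F l unfolding rlinked_def
        by (intro exI[of _ "insert l F"]) simp
      then show ?thesis ..
    qed
  next
    assume "\<exists>Z. finite Z \<and> card Z \<le> 4 * k \<and> (\<forall>l. link c P Q l \<longrightarrow> l \<inter> Z \<noteq> {})"
    then obtain Z where "finite Z" "card Z \<le> 4 * k" "\<forall>l. link c P Q l \<longrightarrow> l \<inter> Z \<noteq> {}" by metis
    then show ?thesis by (intro disjI2 exI[of _ Z]) simp
  qed
qed

lemma disjoint_family_avoids: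
  assumes "disjoint F" "finite Z" "card Z < card F"
  shows "\<exists>l\<in>F. l \<inter> Z = {}"
proof (rule ccontr)
  assume "\<not> ?thesis"
  then have "\<forall>l\<in>F. \<exists>z. z \<in> l \<inter> Z" by auto
  then obtain g where g: "\<And>l. l \<in> F \<Longrightarrow> g l \<in> l \<inter> Z" by metis
  have "inj_on g F"
  proof (rule inj_onI)
    fix k l assume "k \<in> F" "l \<in> F" "g k = g l"
    then show "k = l" using g[of k] g[of l] assms(1) unfolding disjoint_def by (metis IntD1 IntI empty_iff)
  qed
  moreover have "g ` F \<subseteq> Z" using g by auto
  ultimately have "card F \<le> card Z" using assms(2) by (intro card_inj_on_le)
  then show False using assms(3) by simp
qed

text \<open>Each visit to \<open>Q\<close> takes part in at most two steps, the one that enters and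
  the one that leaves.\<close>

lemma card_steps_le:
  assumes "\<And>Q. count_list W Q \<le> w"
  shows "finite {t. t + 1 < length W \<and> (W ! t = Q \<or> W ! (t + 1) = Q)}"
    and "card {t. t + 1 < length W \<and> (W ! t = Q \<or> W ! (t + 1) = Q)} \<le> 2 * w"
proof -
  let ?A = "{t. t < length W \<and> W ! t = Q}"
  have A: "card ?A \<le> w" using assms[of Q] by (simp add: count_list_eq_length_filter length_filter_conv_card eq_commute)
  have sub: "{t. t + 1 < length W \<and> (W ! t = Q \<or> W ! (t + 1) = Q)} \<subseteq> ?A \<union> Suc -` ?A" by auto
  have "finite (Suc -` ?A)" by (rule finite_vimageI) auto
  then have fin: "finite (?A \<union> Suc -` ?A)" by simp
  show "finite {t. t + 1 < length W \<and> (W ! t = Q \<or> W ! (t + 1) = Q)}" using sub fin by (rule finite_subset)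
  have "card {t. t + 1 < length W \<and> (W ! t = Q \<or> W ! (t + 1) = Q)} \<le> card (?A \<union> Suc -` ?A)"
    by (rule card_mono[OF fin sub])
  also have "\<dots> \<le> card ?A + card (Suc -` ?A)" by (rule card_Un_le)
  also have "card (Suc -` ?A) \<le> card ?A" using card_vimage_inj_on_le[of Suc UNIV ?A] by simp
  finally show "card {t. t + 1 < length W \<and> (W ! t = Q \<or> W ! (t + 1) = Q)} \<le> 2 * w" using A by simp
qed

text \<open>The cliques are disjoint, so only links of steps at \<open>Q\<close> touch
  \<open>Q\<close>: at most \<open>2 * w\<close> steps with four vertices each.\<close>

lemma links_meeting_clique:
  assumes mult: "\<And>Q. count_list W Q \<le> w"
    and disj: "disjoint (set W)"
    and links: "\<And>t. t \<in> I \<Longrightarrow> t + 1 < length W \<and> link c (W ! t) (W ! (t + 1)) (L t)"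
    and Q: "Q \<in> set W"
  shows "finite (\<Union>t\<in>I. L t \<inter> Q)" "card (\<Union>t\<in>I. L t \<inter> Q) \<le> 8 * w"
proof -
  define J where "J = {t. t + 1 < length W \<and> (W ! t = Q \<or> W ! (t + 1) = Q)}"
  have sub: "(\<Union>t\<in>I. L t \<inter> Q) \<subseteq> (\<Union>t\<in>I \<inter> J. L t)"
  proof
    fix x assume "x \<in> (\<Union>t\<in>I. L t \<inter> Q)"
    then obtain t where t: "t \<in> I" "x \<in> L t" "x \<in> Q" by auto
    have "x \<in> W ! t \<or> x \<in> W ! (t + 1)" using link_subset links[OF t(1)] t(2) by blast
    moreover have "W ! t \<in> set W" "W ! (t + 1) \<in> set W" using links[OF t(1)] by auto
    ultimately have "W ! t = Q \<or> W ! (t + 1) = Q" using disj Q t(3) unfolding disjoint_def by blast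
    then have "t \<in> J" using links[OF t(1)] by (simp add: J_def)
    then show "x \<in> (\<Union>t\<in>I \<inter> J. L t)" using t by auto
  qed
  have J: "finite J" "card J \<le> 2 * w" unfolding J_def by (rule card_steps_le[OF mult])+
  have Lc: "finite (L t)" "card (L t) \<le> 4" if "t \<in> I" for t using links[OF that] link_card by metis+
  have fin: "finite (\<Union>t\<in>I \<inter> J. L t)" using J Lc by auto
  then show "finite (\<Union>t\<in>I. L t \<inter> Q)" using sub finite_subset by blast
  have "card (\<Union>t\<in>I. L t \<inter> Q) \<le> card (\<Union>t\<in>I \<inter> J. L t)" by (rule card_mono[OF fin sub])
  also have "\<dots> \<le> (\<Sum>t\<in>I \<inter> J. card (L t))" using J by (intro card_UN_le) simp
  also have "\<dots> \<le> (\<Sum>t\<in>I \<inter> J. 4)" using Lc by (intro sum_mono) simp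
  also have "\<dots> \<le> 4 * card J" using J by (simp add: card_mono)
  finally show "card (\<Union>t\<in>I. L t \<inter> Q) \<le> 8 * w" using J by simp
qed

text \<open>The links are chosen greedily. Earlier ones occupy at most \<open>8 * w\<close> vertices
  in each of the two cliques of the current step, so one of more than \<open>16 * w\<close> disjoint
  links avoids them.\<close>

lemma walk_links:
  assumes W: "successively (rlinked c k) W" and mult: "\<And>Q. count_list W Q \<le> w"
    and disj: "disjoint (set W)" and k: "k > 16 * w"
  shows "\<exists>L. (\<forall>t. t + 1 < length W \<longrightarrow> link c (W ! t) (W ! (t + 1)) (L t)) \<and>
     (\<forall>t t'. t + 1 < length W \<longrightarrow> t' + 1 < length W \<longrightarrow> t \<noteq> t' \<longrightarrow> L t \<inter> L t' = {})"
proof -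
  have "\<exists>L. (\<forall>t<n. link c (W ! t) (W ! (t + 1)) (L t)) \<and> (\<forall>t<n. \<forall>t'<n. t \<noteq> t' \<longrightarrow> L t \<inter> L t' = {})"
    if "n < length W \<or> n = 0" for n
    using that
  proof (induction n)
    case (Suc n)
    then have n: "n + 1 < length W" by simp
    then obtain L where L: "\<forall>t<n. link c (W ! t) (W ! (t + 1)) (L t)"
      "\<forall>t<n. \<forall>t'<n. t \<noteq> t' \<longrightarrow> L t \<inter> L t' = {}" using Suc.IH by auto
    have "rlinked c k (W ! n) (W ! (n + 1))" using W n by (simp add: successively_conv_nth)
    then obtain F where F: "finite F" "card F = k" "\<forall>l\<in>F. link c (W ! n) (W ! (n + 1)) l" "disjoint F"
      unfolding rlinked_def by metis
    have links: "t + 1 < length W \<and> link c (W ! t) (W ! (t + 1)) (L t)" if "t \<in> {..<n}" for t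
      using L n that by auto
    have inW: "W ! n \<in> set W" "W ! (n + 1) \<in> set W" using n by auto
    define Z where "Z = (\<Union>t<n. L t \<inter> W ! n) \<union> (\<Union>t<n. L t \<inter> W ! (n + 1))"
    note l1 = links_meeting_clique[where I = "{..<n}", OF mult disj links inW(1)]
    note l2 = links_meeting_clique[where I = "{..<n}", OF mult disj links inW(2)]
    have fZ: "finite Z" unfolding Z_def using l1(1) l2(1) by simp
    have "card Z \<le> 8 * w + 8 * w" unfolding Z_def using l1(2) l2(2) by (intro order_trans[OF card_Un_le] add_mono)
    then obtain l where l: "l \<in> F" "l \<inter> Z = {}" using disjoint_family_avoids[OF F(4) fZ] F(2) k by auto
    have "l \<subseteq> W ! n \<union> W ! (n + 1)" using F(3) l(1) link_subset by metis
    then have dl: "l \<inter> L t = {}" if "t < n" for t using l(2) that unfolding Z_def by blast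
    show ?case
    proof (intro exI[of _ "L(n := l)"] conjI allI impI)
      fix t assume "t < Suc n"
      then show "link c (W ! t) (W ! (t + 1)) ((L(n := l)) t)" using L(1) F(3) l(1) by (auto simp: less_Suc_eq)
    next
      fix t t' assume "t < Suc n" "t' < Suc n" "t \<noteq> t'"
      then show "(L(n := l)) t \<inter> (L(n := l)) t' = {}" using L(2) dl by (auto simp: less_Suc_eq)
    qed
  qed simp
  from this[of "length W - 1"] show ?thesis by (cases "length W") auto
qed

text \<open>The path uses up \<open>X Q\<close> on the first visit to \<open>Q\<close>. On later
  visits the incoming and the outgoing link are joined directly, as their ends lie in the red clique
  \<open>Q\<close>. So each piece is used once, however often the walk returns.\<close>

lemma walk_spans:
  assumes n: "n < length W"
    and cl: "\<And>Q. Q \<in> set W \<Longrightarrow> red_clique c Q" and disj: "disjoint (set W)"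
    and step: "\<And>t. t < n \<Longrightarrow> W ! t \<noteq> W ! (t + 1)"
    and L: "\<And>t. t < n \<Longrightarrow> link c (W ! t) (W ! (t + 1)) (L t)"
      "\<And>t t'. t < n \<Longrightarrow> t' < n \<Longrightarrow> t \<noteq> t' \<Longrightarrow> L t \<inter> L t' = {}"
    and X: "\<And>Q. Q \<in> set W \<Longrightarrow> spans c Q Q (X Q)"
      "\<And>Q t. Q \<in> set W \<Longrightarrow> t < n \<Longrightarrow> X Q \<inter> L t = {}"
      "\<And>Q Q'. Q \<in> set W \<Longrightarrow> Q' \<in> set W \<Longrightarrow> Q \<noteq> Q' \<Longrightarrow> X Q \<inter> X Q' = {}"
  shows "spans c (W ! 0) (W ! n) ((\<Union>t<n. L t) \<union> (\<Union>t\<le>n. X (W ! t)))"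
  using n step L X(2)
proof (induction n)
  case 0
  then show ?case using X(1)[of "W ! 0"] by simp
next
  case (Suc n)
  define A where "A = (\<Union>t<n. L t) \<union> (\<Union>t\<le>n. X (W ! t))"
  have IH: "spans c (W ! 0) (W ! n) A"
    unfolding A_def using Suc.prems by (intro Suc.IH) auto
  have inW: "W ! n \<in> set W" "W ! Suc n \<in> set W" using Suc.prems(1) by auto
  have "W ! n \<inter> W ! Suc n = {}" using Suc.prems(2)[of n] inW disj unfolding disjoint_def by auto
  then have sp: "spans c (W ! n) (W ! Suc n) (L n)" using Suc.prems(3)[of n] link_spans by simp
  have dA: "A \<inter> L n = {}"
  proof -
    have "L t \<inter> L n = {}" if "t < n" for t using Suc.prems(4)[of t n] that by simp
    moreover have "X (W ! t) \<inter> L n = {}" if "t \<le> n" for t using Suc.prems(5)[of "W ! t" n] that Suc.prems(1) by simp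
    ultimately show ?thesis unfolding A_def by blast
  qed
  have AL: "spans c (W ! 0) (W ! Suc n) (A \<union> L n)"
    by (rule spans_Un[OF IH sp cl[OF inW(1)] dA])
  have eq: "(\<Union>t<Suc n. L t) \<union> (\<Union>t\<le>Suc n. X (W ! t)) = A \<union> L n \<union> X (W ! Suc n)"
    unfolding A_def lessThan_Suc atMost_Suc by auto
  show ?case
  proof (cases "\<exists>t\<le>n. W ! t = W ! Suc n")
    case True
    then have "X (W ! Suc n) \<subseteq> A" unfolding A_def by (metis UN_upper Un_upper2 atMost_iff order_trans)
    then have "A \<union> L n \<union> X (W ! Suc n) = A \<union> L n" by auto
    then show ?thesis unfolding eq using AL by simp
  next
    case False
    have d1: "L t \<inter> X (W ! Suc n) = {}" if "t < Suc n" for t using Suc.prems(5)[OF inW(2) that] by auto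
    have d2: "X (W ! t) \<inter> X (W ! Suc n) = {}" if "t \<le> n" for t
      using X(3)[of "W ! t" "W ! Suc n"] False that Suc.prems(1) by auto
    have False if x: "x \<in> A \<union> L n" "x \<in> X (W ! Suc n)" for x
    proof -
      from x(1) consider t where "t < Suc n" "x \<in> L t" | t where "t \<le> n" "x \<in> X (W ! t)"
        unfolding A_def by (auto intro: less_SucI)
      then show False
      proof cases
        case (1 t)
        with d1[of t] x(2) show ?thesis by auto
      next
        case (2 t)
        with d2[of t] x(2) show ?thesis by auto
      qed
    qed
    then have "(A \<union> L n) \<inter> X (W ! Suc n) = {}" by (meson disjoint_iff)
    then show ?thesis unfolding eq using spans_Un[OF AL X(1)[OF inW(2)] cl[OF inW(2)]] by simp
  qed
qed

section \<open>Extracting homogeneous tuples\<close>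

text \<open>Semicompleteness of the blue arcs says that no two parts are red in both directions;
  this is what the absence of links provides.\<close>

definition good_tuple :: "('a set \<Rightarrow> bool) \<Rightarrow> 'b set \<Rightarrow> ('b \<Rightarrow> 'a set) \<Rightarrow> bool" where
  "good_tuple c B Y \<longleftrightarrow>
     (\<forall>i\<in>B. \<forall>j\<in>B. i \<noteq> j \<longrightarrow> homog c False (Y i) (Y j) \<or> homog c True (Y i) (Y j)) \<and>
     semicomplete B (\<lambda>i j. homog c False (Y i) (Y j))"

lemma good_tuple_mono:
  assumes "good_tuple c B Y" "\<And>i. i \<in> B \<Longrightarrow> Y' i \<subseteq> Y i"
  shows "good_tuple c B Y'"
proof -
  have "homog c b (Y' i) (Y' j)" if "homog c b (Y i) (Y j)" "i \<in> B" "j \<in> B" for b i j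
    using homog_mono[OF that(1)] assms(2) that(2,3) by simp
  then show ?thesis using assms(1) unfolding good_tuple_def semicomplete_def by metis
qed

text \<open>With two vertices on each side, one direction gives the red edge \<open>yxz\<close> and
  the other \<open>zwx\<close>: together a link.\<close>

lemma not_both_red:
  assumes "homog c True P Q" "homog c True Q P" "2 \<le> card P" "2 \<le> card Q"
  shows "\<exists>l. link c P Q l"
proof -
  obtain y x where yx: "y \<in> P" "x \<in> P" "y \<noteq> x"
    using assms(3) by (metis card_le_Suc0_iff_eq card.infinite not_less_eq_eq numeral_2_eq_2 zero_le)
  obtain z w where zw: "z \<in> Q" "w \<in> Q" "z \<noteq> w"
    using assms(4) by (metis card_le_Suc0_iff_eq card.infinite not_less_eq_eq numeral_2_eq_2 zero_le)
  have "c {y, x, z}" using assms(1) yx zw unfolding homog_def by blast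
  moreover have "c {z, w, x}" using assms(2) yx zw unfolding homog_def by blast
  then have "c {x, z, w}" by (simp add: insert_commute)
  ultimately show ?thesis using yx zw unfolding link_def by blast
qed

text \<open>For each of at most \<open>k * k\<close> ordered pairs, some set of at most
  \<open>4 * n\<close> vertices meets all links. Once these sets are deleted,
  \<open>ramsey_tuple\<close> applies, and two parts red in both directions would contain a link
  that avoids the deleted vertices. The hypothesis concerns whole cliques \<open>P\<close>, while
  the tuple is taken from what is left of them in \<open>X\<close>.\<close>

lemma ex_good_tuple:
  fixes k n q :: nat
  assumes "q \<ge> 2"
  shows "\<exists>S::nat. \<forall>(c::'a set \<Rightarrow> bool) (B::'b set) P X. finite B \<and> card B \<le> k \<and>
     (\<forall>i\<in>B. X i \<subseteq> P i \<and> finite (X i) \<and> S \<le> card (X i)) \<and>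
     (\<forall>i\<in>B. \<forall>j\<in>B. i \<noteq> j \<longrightarrow> \<not> rlinked c n (P i) (P j)) \<longrightarrow>
     (\<exists>Y. (\<forall>i\<in>B. Y i \<subseteq> X i \<and> card (Y i) = q) \<and> good_tuple c B Y)"
proof -
  obtain S :: nat where S: "\<forall>(c::'a set \<Rightarrow> bool) (B::'b set) X. finite B \<and> card B \<le> k \<and>
      (\<forall>i\<in>B. finite (X i) \<and> S \<le> card (X i)) \<longrightarrow>
     (\<exists>Y. (\<forall>i\<in>B. Y i \<subseteq> X i \<and> card (Y i) = q) \<and>
        (\<forall>i\<in>B. \<forall>j\<in>B. i \<noteq> j \<longrightarrow> (\<exists>b. homog c b (Y i) (Y j))))"
    using ramsey_tuple[where k = k and q = q] by (elim exE)
  have claim: "\<exists>Y. (\<forall>i\<in>B. Y i \<subseteq> X i \<and> card (Y i) = q) \<and> good_tuple c B Y"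
    if B: "finite B" "card B \<le> k"
      and X: "\<And>i. i \<in> B \<Longrightarrow> X i \<subseteq> P i \<and> finite (X i) \<and> S + k * k * (4 * n) \<le> card (X i)"
      and nl: "\<And>i j. i \<in> B \<Longrightarrow> j \<in> B \<Longrightarrow> i \<noteq> j \<Longrightarrow> \<not> rlinked c n (P i) (P j)"
    for c :: "'a set \<Rightarrow> bool" and B :: "'b set" and P X
  proof -
    have "\<exists>Z. finite Z \<and> card Z \<le> 4 * n \<and> (i \<in> B \<and> j \<in> B \<and> i \<noteq> j \<longrightarrow> (\<forall>l. link c (P i) (P j) l \<longrightarrow> l \<inter> Z \<noteq> {}))"
      for i j
    proof (cases "i \<in> B \<and> j \<in> B \<and> i \<noteq> j")
      case True
      with nl[of i j] not_rlinked[of c n "P i" "P j"] show ?thesis by blast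
    next
      case False
      then show ?thesis by (intro exI[of _ "{}"]) auto
    qed
    then obtain Z where Z: "\<And>i j. finite (Z i j)" "\<And>i j. card (Z i j) \<le> 4 * n"
      "\<And>i j l. i \<in> B \<Longrightarrow> j \<in> B \<Longrightarrow> i \<noteq> j \<Longrightarrow> link c (P i) (P j) l \<Longrightarrow> l \<inter> Z i j \<noteq> {}"
      by metis
    define ZZ where "ZZ = (\<Union>p\<in>B \<times> B. Z (fst p) (snd p))"
    have fZ: "finite ZZ" unfolding ZZ_def using B Z(1) by simp
    have "card ZZ \<le> (\<Sum>p\<in>B \<times> B. card (Z (fst p) (snd p)))" unfolding ZZ_def using B by (intro card_UN_le) simp
    also have "\<dots> \<le> (\<Sum>p\<in>B \<times> B. 4 * n)" using Z(2) by (intro sum_mono) simp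
    also have "\<dots> = card B * card B * (4 * n)" by (simp add: card_cartesian_product)
    also have "\<dots> \<le> k * k * (4 * n)" using B(2) by (intro mult_le_mono) simp_all
    finally have cZ: "card ZZ \<le> k * k * (4 * n)" .
    have "finite (X i - ZZ) \<and> S \<le> card (X i - ZZ)" if "i \<in> B" for i
    proof -
      have "card (X i) - card ZZ \<le> card (X i - ZZ)" using fZ by (rule diff_card_le_card_Diff)
      then show ?thesis using X[OF that] cZ by auto
    qed
    with S[rule_format, of B "\<lambda>i. X i - ZZ" c] B
    obtain Y where Y: "\<And>i. i \<in> B \<Longrightarrow> Y i \<subseteq> X i - ZZ" "\<And>i. i \<in> B \<Longrightarrow> card (Y i) = q"
      and hom: "\<And>i j. i \<in> B \<Longrightarrow> j \<in> B \<Longrightarrow> i \<noteq> j \<Longrightarrow> \<exists>b. homog c b (Y i) (Y j)"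
      by (metis (no_types, lifting))
    have hom': "homog c False (Y i) (Y j) \<or> homog c True (Y i) (Y j)" if ij: "i \<in> B" "j \<in> B" "i \<noteq> j" for i j
      using hom[OF ij] by (metis (full_types))
    have "homog c False (Y i) (Y j) \<or> homog c False (Y j) (Y i)" if ij: "i \<in> B" "j \<in> B" "i \<noteq> j" for i j
    proof (rule ccontr)
      assume "\<not> ?thesis"
      then have "homog c True (Y i) (Y j)" "homog c True (Y j) (Y i)" using hom'[of i j] hom'[of j i] ij by auto
      then obtain l where l: "link c (Y i) (Y j) l" using not_both_red Y(2) ij assms by metis
      have "Y i \<subseteq> P i" "Y j \<subseteq> P j" using Y(1) X ij by blast+
      then have "l \<inter> Z i j \<noteq> {}" using Z(3)[OF ij] link_mono[OF l] by simp
      moreover have "Z i j \<subseteq> ZZ" unfolding ZZ_def using ij by force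
      moreover have "l \<subseteq> Y i \<union> Y j" using link_subset[OF l] .
      ultimately show False using Y(1)[OF ij(1)] Y(1)[OF ij(2)] by blast
    qed
    then have "good_tuple c B Y" unfolding good_tuple_def semicomplete_def using hom' by simp
    moreover have "Y i \<subseteq> X i" if "i \<in> B" for i using Y(1)[OF that] by blast
    ultimately show ?thesis using Y(2) by (intro exI[of _ Y]) simp
  qed
  show ?thesis
  proof (intro exI[of _ "S + k * k * (4 * n)"] allI impI, elim conjE)
    fix c :: "'a set \<Rightarrow> bool" and B :: "'b set" and P X
    assume "finite B" "card B \<le> k" "\<forall>i\<in>B. X i \<subseteq> P i \<and> finite (X i) \<and> S + k * k * (4 * n) \<le> card (X i)"
      "\<forall>i\<in>B. \<forall>j\<in>B. i \<noteq> j \<longrightarrow> \<not> rlinked c n (P i) (P j)"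
    then show "\<exists>Y. (\<forall>i\<in>B. Y i \<subseteq> X i \<and> card (Y i) = q) \<and> good_tuple c B Y"
      by (intro claim[where P = P]) simp_all
  qed
qed

lemma blue_copy:
  assumes TT: "has_TT B (\<lambda>i j. homog c False (Y i) (Y j)) chi"
    and Y: "\<And>i. i \<in> B \<Longrightarrow> Y i \<subseteq> {..<N}" "\<And>i. i \<in> B \<Longrightarrow> m \<le> card (Y i)"
    and disj: "\<And>i j. i \<in> B \<Longrightarrow> j \<in> B \<Longrightarrow> i \<noteq> j \<Longrightarrow> Y i \<inter> Y j = {}"
  shows "has_copy N c False (H_V chi m) (H_E chi TT m)"
proof -
  obtain f where f: "inj_on f {..<chi}" "f ` {..<chi} \<subseteq> B"
    "\<And>i j. i < j \<Longrightarrow> j < chi \<Longrightarrow> homog c False (Y (f i)) (Y (f j))"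
    by (rule has_TTE[OF TT]) (rule that; simp)
  have fB: "f i \<in> B" if "i < chi" for i using f(2) that by auto
  have "\<exists>g. inj_on g {..<m} \<and> g ` {..<m} \<subseteq> Y (f i)" if "i < chi" for i
  proof -
    have "finite (Y (f i))" using Y(1)[OF fB[OF that]] finite_subset by blast
    then show ?thesis using card_le_inj[of "{..<m}" "Y (f i)"] Y(2)[OF fB[OF that]] by auto
  qed
  then obtain g where g: "\<And>i. i < chi \<Longrightarrow> inj_on (g i) {..<m}" "\<And>i. i < chi \<Longrightarrow> g i ` {..<m} \<subseteq> Y (f i)"
    by metis
  define h where "h p = g (fst p) (snd p)" for p
  have hY: "h p \<in> Y (f (fst p))" if "p \<in> H_V chi m" for p
    using that g(2)[of "fst p"] by (auto simp: H_V_def h_def image_subset_iff)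
  have "inj_on h (H_V chi m)"
  proof (rule inj_onI)
    fix p p' assume p: "p \<in> H_V chi m" "p' \<in> H_V chi m" "h p = h p'"
    have lt: "fst p < chi" "fst p' < chi" "snd p < m" "snd p' < m" using p by (auto simp: H_V_def)
    have "h p \<in> Y (f (fst p)) \<inter> Y (f (fst p'))" using hY[OF p(1)] hY[OF p(2)] p(3) by simp
    then have "f (fst p) = f (fst p')" using disj[of "f (fst p)" "f (fst p')"] fB lt by blast
    then have eq: "fst p = fst p'" using f(1) lt by (auto simp: inj_on_def)
    then have "snd p = snd p'" using g(1)[OF lt(1)] p(3) lt by (auto simp: inj_on_def h_def)
    with eq show "p = p'" by (simp add: prod_eq_iff)
  qed
  moreover have "h ` H_V chi m \<subseteq> {..<N}"
  proof
    fix v assume "v \<in> h ` H_V chi m"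
    then obtain p where p: "p \<in> H_V chi m" "v = h p" by blast
    then have "fst p < chi" by (auto simp: H_V_def)
    then show "v \<in> {..<N}" using hY[OF p(1)] Y(1)[OF fB] p(2) by blast
  qed
  moreover have "c (h ` e) = False" if eE: "e \<in> H_E chi TT m" for e
  proof -
    obtain x y z where e: "e = {x, y, z}" "x \<in> H_V chi m" "y \<in> H_V chi m" "z \<in> H_V chi m"
      "fst x = fst y" "x \<noteq> y" "fst x < fst z" 
      using eE unfolding H_E_def TT_def mem_Collect_eq by (elim exE conjE) (rule that)
    have "fst z < chi" using e(4) by (auto simp: H_V_def)
    then have "homog c False (Y (f (fst x))) (Y (f (fst z)))" using f(3) e(7) by simp
    moreover have "h x \<noteq> h y" using \<open>inj_on h (H_V chi m)\<close> e by (auto simp: inj_on_def)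
    ultimately have "c {h x, h y, h z} = False"
      using hY[OF e(2)] hY[OF e(3)] hY[OF e(4)] e(5) unfolding homog_def by auto
    then show ?thesis using e(1) by simp
  qed
  ultimately show ?thesis unfolding has_copy_def by (intro exI[of _ h]) simp
qed

lemma extract_tuples:
  fixes R :: "'b \<Rightarrow> 'q \<Rightarrow> 'a set" and p :: "'b \<Rightarrow> nat"
  assumes fin: "\<And>i. i \<in> B \<Longrightarrow> finite (Qs i)" "\<And>i Q. i \<in> B \<Longrightarrow> Q \<in> Qs i \<Longrightarrow> finite (R i Q) \<and> 2 \<le> card (R i Q)"
    and disj: "\<And>i Q Q'. i \<in> B \<Longrightarrow> Q \<in> Qs i \<Longrightarrow> Q' \<in> Qs i \<Longrightarrow> Q \<noteq> Q' \<Longrightarrow> R i Q \<inter> R i Q' = {}"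
    and p: "\<And>i. i \<in> B \<Longrightarrow> 0 < p i \<and> p i + 2 \<le> S"
    and ex: "\<And>cl X. (\<And>i. i \<in> B \<Longrightarrow> cl i \<in> Qs i \<and> X i \<subseteq> R i (cl i) \<and> S \<le> card (X i)) \<Longrightarrow>
       \<exists>Y. (\<forall>i\<in>B. Y i \<subseteq> X i \<and> card (Y i) = p i) \<and> Good Y"
    and size: "\<And>i. i \<in> B \<Longrightarrow> p i * T + S * card (Qs i) \<le> (\<Sum>Q\<in>Qs i. card (R i Q))"
  shows "\<exists>cl Y. (\<forall>\<tau><T. Good (Y \<tau>) \<and> (\<forall>i\<in>B. cl \<tau> i \<in> Qs i \<and> Y \<tau> i \<subseteq> R i (cl \<tau> i) \<and> card (Y \<tau> i) = p i)) \<and>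
     (\<forall>i\<in>B. (\<forall>\<tau><T. \<forall>\<sigma><T. \<tau> \<noteq> \<sigma> \<longrightarrow> Y \<tau> i \<inter> Y \<sigma> i = {}) \<and> (\<forall>Q\<in>Qs i. 2 \<le> card (R i Q - (\<Union>\<tau><T. Y \<tau> i))))"
proof -
  have "\<forall>i\<in>B. p i * T + S * card (Qs i) \<le> (\<Sum>Q\<in>Qs i. card (R i Q))" using size by simp
  then show ?thesis
  proof (induction T)
    case 0
    then show ?case using fin(2) by simp
  next
    case (Suc T)
    have "\<forall>i\<in>B. p i * T + S * card (Qs i) \<le> (\<Sum>Q\<in>Qs i. card (R i Q))"
    proof
      fix i assume "i \<in> B"
      with Suc.prems show "p i * T + S * card (Qs i) \<le> (\<Sum>Q\<in>Qs i. card (R i Q))" by fastforce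
    qed
    from Suc.IH[OF this] obtain cl Y where Y0:
      "\<forall>\<tau><T. Good (Y \<tau>) \<and> (\<forall>i\<in>B. cl \<tau> i \<in> Qs i \<and> Y \<tau> i \<subseteq> R i (cl \<tau> i) \<and> card (Y \<tau> i) = p i)"
      "\<forall>i\<in>B. (\<forall>\<tau><T. \<forall>\<sigma><T. \<tau> \<noteq> \<sigma> \<longrightarrow> Y \<tau> i \<inter> Y \<sigma> i = {}) \<and> (\<forall>Q\<in>Qs i. 2 \<le> card (R i Q - (\<Union>\<tau><T. Y \<tau> i)))"
      by (elim exE conjE)
    then have Y: "\<And>\<tau>. \<tau> < T \<Longrightarrow> Good (Y \<tau>)"
        "\<And>\<tau> i. \<tau> < T \<Longrightarrow> i \<in> B \<Longrightarrow> cl \<tau> i \<in> Qs i \<and> Y \<tau> i \<subseteq> R i (cl \<tau> i) \<and> card (Y \<tau> i) = p i"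
        "\<And>i \<tau> \<sigma>. i \<in> B \<Longrightarrow> \<tau> < T \<Longrightarrow> \<sigma> < T \<Longrightarrow> \<tau> \<noteq> \<sigma> \<Longrightarrow> Y \<tau> i \<inter> Y \<sigma> i = {}"
        "\<And>i Q. i \<in> B \<Longrightarrow> Q \<in> Qs i \<Longrightarrow> 2 \<le> card (R i Q - (\<Union>\<tau><T. Y \<tau> i))"
      by simp_all
    define U where "U i = (\<Union>\<tau><T. Y \<tau> i)" for i
    have "\<exists>Q\<in>Qs i. S \<le> card (R i Q - U i)" if i: "i \<in> B" for i
    proof (rule ccontr)
      assume "\<not> ?thesis"
      \<comment> \<open>If every clique of component \<open>i\<close> has at most \<open>S\<close>
        vertices left, then, as earlier tuples used only \<open>p i * T\<close>, the component is
        smaller than the size assumed for \<open>Suc T\<close> tuples.\<close>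
      then have less: "card (R i Q - U i) \<le> S" if "Q \<in> Qs i" for Q using that by (meson linear)
      have fY: "finite (Y \<tau> i)" if "\<tau> < T" for \<tau>
        using Y(2)[OF that i] fin(2)[OF i] finite_subset by blast
      then have fU: "finite (U i)" unfolding U_def by simp
      have "(\<Sum>Q\<in>Qs i. card (R i Q)) \<le> (\<Sum>Q\<in>Qs i. S + card (R i Q \<inter> U i))"
      proof (rule sum_mono)
        fix Q assume Q: "Q \<in> Qs i"
        have "card (R i Q) = card (R i Q - U i) + card (R i Q \<inter> U i)"
          using fin(2)[OF i Q] by (metis Int_commute card_Diff_subset_Int card_Int_Diff add.commute)
        then show "card (R i Q) \<le> S + card (R i Q \<inter> U i)" using less[OF Q] by simp
      qed
      also have "\<dots> = S * card (Qs i) + (\<Sum>Q\<in>Qs i. card (R i Q \<inter> U i))" by (simp add: sum.distrib)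
      also have "(\<Sum>Q\<in>Qs i. card (R i Q \<inter> U i)) = card (\<Union>Q\<in>Qs i. R i Q \<inter> U i)"
      proof (rule card_UN_disjoint[symmetric])
        show "\<forall>Q\<in>Qs i. \<forall>Q'\<in>Qs i. Q \<noteq> Q' \<longrightarrow> R i Q \<inter> U i \<inter> (R i Q' \<inter> U i) = {}" using disj[OF i] by blast
      qed (use fin i fU in auto)
      also have "\<dots> \<le> card (U i)" by (rule card_mono[OF fU]) auto
      also have "\<dots> \<le> (\<Sum>\<tau><T. card (Y \<tau> i))" unfolding U_def by (rule card_UN_le) simp
      also have "\<dots> = p i * T" using Y(2) i by simp
      finally show False using bspec[OF Suc.prems i] p[OF i] by simp
    qed
    then obtain cl' where cl': "\<And>i. i \<in> B \<Longrightarrow> cl' i \<in> Qs i \<and> S \<le> card (R i (cl' i) - U i)" by metis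
    have "\<exists>Y'. (\<forall>i\<in>B. Y' i \<subseteq> R i (cl' i) - U i \<and> card (Y' i) = p i) \<and> Good Y'"
      by (rule ex[of cl']) (use cl' in auto)
    then obtain Y' where Y': "\<And>i. i \<in> B \<Longrightarrow> Y' i \<subseteq> R i (cl' i) - U i" "\<And>i. i \<in> B \<Longrightarrow> card (Y' i) = p i" "Good Y'"
      by metis
    define Y2 where "Y2 = Y(T := Y')"
    define cl2 where "cl2 = cl(T := cl')"
    have U2: "(\<Union>\<tau><Suc T. Y2 \<tau> i) = U i \<union> Y' i" for i
      unfolding U_def Y2_def lessThan_Suc by auto
    have dis: "Y' i \<inter> Y \<tau> i = {}" if "i \<in> B" "\<tau> < T" for i \<tau>
      using Y'(1)[OF that(1)] that(2) unfolding U_def by blast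
    show ?case
    proof (intro exI[of _ cl2] exI[of _ Y2] conjI allI impI ballI)
      fix \<tau> assume \<tau>: "\<tau> < Suc T"
      show "Good (Y2 \<tau>)" using Y(1)[of \<tau>] Y'(3) \<tau> by (auto simp: Y2_def less_Suc_eq)
      fix i assume i: "i \<in> B"
      show "cl2 \<tau> i \<in> Qs i" using Y(2)[of \<tau> i] cl'[OF i] i \<tau> by (auto simp: cl2_def less_Suc_eq)
      show "Y2 \<tau> i \<subseteq> R i (cl2 \<tau> i)"
      proof (cases "\<tau> = T")
        case True
        then show ?thesis using Y'(1)[OF i] by (auto simp: Y2_def cl2_def)
      next
        case False
        then show ?thesis using Y(2)[of \<tau> i] i \<tau> by (simp add: Y2_def cl2_def)
      qed
      show "card (Y2 \<tau> i) = p i" using Y(2)[of \<tau> i] Y'(2)[OF i] i \<tau> by (auto simp: Y2_def less_Suc_eq)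
    next
      fix i \<tau> \<sigma> assume i: "i \<in> B" and *: "\<tau> < Suc T" "\<sigma> < Suc T" "\<tau> \<noteq> \<sigma>"
      consider "\<tau> = T" "\<sigma> < T" | "\<sigma> = T" "\<tau> < T" | "\<sigma> < T" "\<tau> < T" using * by linarith
      then show "Y2 \<tau> i \<inter> Y2 \<sigma> i = {}"
        by cases (use dis[OF i] Y(3)[OF i] * in \<open>simp_all add: Y2_def Int_commute\<close>)
    next
      fix i Q assume i: "i \<in> B" and Q: "Q \<in> Qs i"
      \<comment> \<open>Only \<open>cl' i\<close> loses vertices in this round, and it keeps at
        least \<open>S - p i\<close> of them.\<close>
      show "2 \<le> card (R i Q - (\<Union>\<tau><Suc T. Y2 \<tau> i))"
      proof (cases "Q = cl' i")
        case True
        have fY': "finite (Y' i)" using Y'(2)[OF i] p[OF i] by (metis card.infinite less_numeral_extra(3))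
        have "card (R i Q - U i) - card (Y' i) \<le> card (R i Q - U i - Y' i)" using fY' by (rule diff_card_le_card_Diff)
        moreover have "S \<le> card (R i Q - U i)" using cl'[OF i] True by simp
        ultimately have "2 \<le> card (R i Q - U i - Y' i)" using p[OF i] Y'(2)[OF i] by linarith
        moreover have "R i Q - (\<Union>\<tau><Suc T. Y2 \<tau> i) = R i Q - U i - Y' i" unfolding U2 by auto
        ultimately show ?thesis by (simp only:)
      next
        case False
        have "R i Q \<inter> R i (cl' i) = {}" using disj[OF i Q _ False] cl'[OF i] by simp
        then have "R i Q - (\<Union>\<tau><Suc T. Y2 \<tau> i) = R i Q - U i" unfolding U2 using Y'(1)[OF i] by blast
        then show ?thesis using Y(4)[OF i Q] by (simp add: U_def)
      qed
    qed
  qed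
qed

text \<open>
  \<open>R Q\<close> is what remains of the clique \<open>Q\<close> when the connecting links are removed; the path absorbs
  the sets \<open>D \<tau>\<close> while it runs through the cliques of the walk.
\<close>
lemma walk_path:
  assumes W: "W \<noteq> []" "disjoint (set W)" "\<And>Q. Q \<in> set W \<Longrightarrow> red_clique c Q"
    and step: "\<And>t. t + 1 < length W \<Longrightarrow> W ! t \<noteq> W ! (t + 1)"
    and L: "\<And>t. t + 1 < length W \<Longrightarrow> link c (W ! t) (W ! (t + 1)) (L t)"
      "\<And>t t'. t + 1 < length W \<Longrightarrow> t' + 1 < length W \<Longrightarrow> t \<noteq> t' \<Longrightarrow> L t \<inter> L t' = {}"
    and R: "\<And>Q. Q \<in> set W \<Longrightarrow> R Q \<subseteq> Q \<and> finite (R Q)"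
      "\<And>Q t. Q \<in> set W \<Longrightarrow> t + 1 < length W \<Longrightarrow> R Q \<inter> L t = {}"
    and I: "finite I" "\<And>\<tau>. \<tau> \<in> I \<Longrightarrow> cl \<tau> \<in> set W \<and> Y \<tau> \<subseteq> R (cl \<tau>) \<and> card (Y \<tau>) = 2 * s + 2"
      "\<And>\<tau> \<sigma>. \<tau> \<in> I \<Longrightarrow> \<sigma> \<in> I \<Longrightarrow> \<tau> \<noteq> \<sigma> \<Longrightarrow> Y \<tau> \<inter> Y \<sigma> = {}"
      "\<And>Q. Q \<in> set W \<Longrightarrow> 2 \<le> card (R Q - (\<Union>\<tau>\<in>I. Y \<tau>))"
    and D: "\<And>\<tau>. \<tau> \<in> I \<Longrightarrow> finite (D \<tau>) \<and> card (D \<tau>) = s \<and> D \<tau> \<inter> \<Union>(set W) = {} \<and> homog c True (Y \<tau>) (D \<tau>)"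
      "\<And>\<tau> \<sigma>. \<tau> \<in> I \<Longrightarrow> \<sigma> \<in> I \<Longrightarrow> \<tau> \<noteq> \<sigma> \<Longrightarrow> D \<tau> \<inter> D \<sigma> = {}"
  shows "\<exists>P P' X. spans c P P' X \<and> X \<subseteq> \<Union>(set W) \<union> (\<Union>\<tau>\<in>I. D \<tau>) \<and>
    (\<Sum>Q\<in>set W. card (R Q)) + s * card I \<le> card X"
proof -
  define J where "J Q = {\<tau> \<in> I. cl \<tau> = Q}" for Q
  \<comment> \<open>All that the path covers in its first stay in \<open>Q\<close>: the usable
    vertices of \<open>Q\<close> and everything absorbed by the tuples located there.\<close>
  define X where "X Q = R Q \<union> (\<Union>\<tau>\<in>J Q. D \<tau>)" for Q
  have LW: "L t \<subseteq> \<Union>(set W)" if "t + 1 < length W" for t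
  proof -
    have "W ! t \<in> set W" "W ! (t + 1) \<in> set W" using that by auto
    then show ?thesis using link_subset[OF L(1)[OF that]] by blast
  qed
  have disjW: "Q \<inter> Q' = {}" if "Q \<in> set W" "Q' \<in> set W" "Q \<noteq> Q'" for Q Q'
    using W(2) that unfolding disjoint_def by simp
  have XQ: "spans c Q Q (X Q)" if Q: "Q \<in> set W" for Q
  proof -
    define A where "A = R Q - (\<Union>\<tau>\<in>I. Y \<tau>)"
    \<comment> \<open>Only the tuples located in \<open>Q\<close> are set aside; \<open>A'\<close>
      contains \<open>A\<close> and hence the two vertices needed to span it.\<close>
    define A' where "A' = R Q - (\<Union>\<tau>\<in>J Q. Y \<tau>)"
    have sub: "A \<subseteq> A'" "A' \<subseteq> Q" "finite A'" using R(1)[OF Q] unfolding A_def A'_def J_def by auto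
    have "2 \<le> card A" unfolding A_def by (rule I(4)[OF Q])
    also have "card A \<le> card A'" using sub by (intro card_mono)
    finally have "spans c A' A' A'" using sub W(3)[OF Q] red_clique_subset by (intro spans_clique)
    then have A': "spans c Q Q A'" using sub spans_mono by blast
    show ?thesis
    proof (cases "J Q = {}")
      case True
      then have "X Q = A'" unfolding X_def A'_def by simp
      then show ?thesis using A' by simp
    next
      case False
      have JI: "\<tau> \<in> I" "cl \<tau> = Q" if "\<tau> \<in> J Q" for \<tau> using that by (auto simp: J_def)
      have YQ: "Y \<tau> \<subseteq> R Q" "Y \<tau> \<subseteq> Q" if "\<tau> \<in> J Q" for \<tau> using I(2)[OF JI(1)[OF that]] JI(2)[OF that] R(1)[OF Q] by auto
      have DQ: "D \<tau> \<inter> Q = {}" if "\<tau> \<in> J Q" for \<tau> using D(1)[OF JI(1)[OF that]] Q by blast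
      have one: "spans c Q Q (Y \<tau> \<union> D \<tau>)" if \<tau>: "\<tau> \<in> J Q" for \<tau>
      proof -
        have "spans c (Y \<tau>) (Y \<tau>) (Y \<tau> \<union> D \<tau>)"
        proof (rule spans_absorb)
          show "finite (Y \<tau>)" using YQ(1)[OF \<tau>] R(1)[OF Q] finite_subset by blast
          show "finite (D \<tau>)" "card (D \<tau>) = s" using D(1)[OF JI(1)[OF \<tau>]] by auto
          show "card (Y \<tau>) = 2 * s + 2" using I(2)[OF JI(1)[OF \<tau>]] by simp
          show "Y \<tau> \<inter> D \<tau> = {}" using YQ(2)[OF \<tau>] DQ[OF \<tau>] by blast
          show "c {x, x', y}" if "x \<in> Y \<tau>" "x' \<in> Y \<tau>" "x \<noteq> x'" "y \<in> D \<tau>" for x x' y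
            using D(1)[OF JI(1)[OF \<tau>]] that unfolding homog_def by simp
        qed
        then show ?thesis using YQ(2)[OF \<tau>] spans_mono by metis
      qed
      have "spans c Q Q (\<Union>\<tau>\<in>J Q. Y \<tau> \<union> D \<tau>)"
      proof (rule spans_UN[OF _ False one W(3)[OF Q]])
        show "finite (J Q)" using I(1) by (simp add: J_def)
        fix \<tau> \<sigma> assume *: "\<tau> \<in> J Q" "\<sigma> \<in> J Q" "\<tau> \<noteq> \<sigma>"
        have "Y \<tau> \<inter> Y \<sigma> = {}" "D \<tau> \<inter> D \<sigma> = {}" using I(3) D(2) JI * by simp_all
        then show "(Y \<tau> \<union> D \<tau>) \<inter> (Y \<sigma> \<union> D \<sigma>) = {}"
          using YQ(2)[OF *(1)] YQ(2)[OF *(2)] DQ[OF *(1)] DQ[OF *(2)] by blast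
      qed
      then have "spans c Q Q (A' \<union> (\<Union>\<tau>\<in>J Q. Y \<tau> \<union> D \<tau>))"
      proof (rule spans_Un[OF A' _ W(3)[OF Q]])
        show "A' \<inter> (\<Union>\<tau>\<in>J Q. Y \<tau> \<union> D \<tau>) = {}" using sub(2) DQ unfolding A'_def by blast
      qed
      moreover have "A' \<union> (\<Union>\<tau>\<in>J Q. Y \<tau> \<union> D \<tau>) = X Q" using YQ(1) unfolding A'_def X_def by blast
      ultimately show ?thesis by simp
    qed
  qed
  define n where "n = length W - 1"
  have nW: "n < length W" "\<And>t. t < n \<longleftrightarrow> t + 1 < length W" using W(1) by (auto simp: n_def)
  have DL: "D \<tau> \<inter> L t = {}" if "\<tau> \<in> I" "t < n" for \<tau> t using D(1)[OF that(1)] LW[of t] nW that(2) by blast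
  have XX: "X Q \<inter> X Q' = {}" if QQ: "Q \<in> set W" "Q' \<in> set W" "Q \<noteq> Q'" for Q Q'
  proof -
    have "D \<tau> \<inter> D \<sigma> = {}" if "\<tau> \<in> J Q" "\<sigma> \<in> J Q'" for \<tau> \<sigma>
      by (rule D(2)) (use that QQ(3) in \<open>auto simp: J_def\<close>)
    moreover have "R Q \<inter> R Q' = {}" using disjW[OF QQ] R(1)[OF QQ(1)] R(1)[OF QQ(2)] by blast
    moreover have "D \<tau> \<inter> R Q = {}" "D \<tau> \<inter> R Q' = {}" if "\<tau> \<in> I" for \<tau>
      using D(1)[OF that] R(1) QQ(1,2) by blast+
    ultimately show ?thesis unfolding X_def J_def by blast
  qed
  have fD: "finite (D \<tau>)" if "\<tau> \<in> I" for \<tau> using D(1)[OF that] by simp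
  have "spans c (W ! 0) (W ! n) ((\<Union>t<n. L t) \<union> (\<Union>t\<le>n. X (W ! t)))"
  proof (rule walk_spans[OF nW(1) W(3) W(2)])
    show "X Q \<inter> L t = {}" if "Q \<in> set W" "t < n" for Q t
    proof -
      have "R Q \<inter> L t = {}" using R(2)[OF that(1)] that(2) nW(2) by simp
      then show ?thesis using DL[OF _ that(2)] unfolding X_def J_def by blast
    qed
  qed (use step L XQ XX nW in auto)
  moreover have setW: "(\<Union>t\<le>n. X (W ! t)) = (\<Union>Q\<in>set W. X Q)"
  proof -
    have "set W = (!) W ` {..n}" using W(1) unfolding n_def
      by (metis One_nat_def Suc_pred atMost_atLeast0 atLeastLessThanSuc_atLeastAtMost length_greater_0_conv list.set_map map_nth set_upt)
    then show ?thesis by simp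
  qed
  ultimately have sp: "spans c (W ! 0) (W ! n) ((\<Union>t<n. L t) \<union> (\<Union>Q\<in>set W. X Q))" by simp
  have XU: "(\<Union>Q\<in>set W. X Q) = (\<Union>Q\<in>set W. R Q) \<union> (\<Union>\<tau>\<in>I. D \<tau>)"
    using I(2) unfolding X_def J_def by blast
  have fX: "finite ((\<Union>t<n. L t) \<union> (\<Union>Q\<in>set W. X Q))" using spans_finite[OF sp] .
  have "(\<Sum>Q\<in>set W. card (R Q)) + s * card I = card (\<Union>Q\<in>set W. R Q) + card (\<Union>\<tau>\<in>I. D \<tau>)"
  proof -
    have "card (\<Union>Q\<in>set W. R Q) = (\<Sum>Q\<in>set W. card (R Q))"
    proof (rule card_UN_disjoint)
      show "\<forall>Q\<in>set W. \<forall>Q'\<in>set W. Q \<noteq> Q' \<longrightarrow> R Q \<inter> R Q' = {}"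
      proof (intro ballI impI)
        fix Q Q' assume "Q \<in> set W" "Q' \<in> set W" "Q \<noteq> Q'"
        then show "R Q \<inter> R Q' = {}" using disjW[of Q Q'] R(1)[of Q] R(1)[of Q'] by blast
      qed
    qed (use R(1) in auto)
    moreover have "card (\<Union>\<tau>\<in>I. D \<tau>) = (\<Sum>\<tau>\<in>I. card (D \<tau>))"
      by (rule card_UN_disjoint) (use I(1) D in auto)
    moreover have "(\<Sum>\<tau>\<in>I. card (D \<tau>)) = s * card I" using D(1) by simp
    ultimately show ?thesis by simp
  qed
  also have "\<dots> = card ((\<Union>Q\<in>set W. R Q) \<union> (\<Union>\<tau>\<in>I. D \<tau>))"
  proof (rule card_Un_disjoint[symmetric])
    have "D \<tau> \<inter> R Q = {}" if "\<tau> \<in> I" "Q \<in> set W" for \<tau> Q using D(1)[OF that(1)] R(1)[OF that(2)] that(2) by blast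
    then show "(\<Union>Q\<in>set W. R Q) \<inter> (\<Union>\<tau>\<in>I. D \<tau>) = {}" by blast
  qed (use R(1) fD I(1) in auto)
  also have "\<dots> \<le> card ((\<Union>t<n. L t) \<union> (\<Union>Q\<in>set W. X Q))" unfolding XU[symmetric] by (rule card_mono[OF fX]) auto
  finally have cX: "(\<Sum>Q\<in>set W. card (R Q)) + s * card I \<le> card ((\<Union>t<n. L t) \<union> (\<Union>Q\<in>set W. X Q))" .
  have "(\<Union>t<n. L t) \<subseteq> \<Union>(set W)" using LW nW(2) by blast
  moreover have "(\<Union>Q\<in>set W. R Q) \<subseteq> \<Union>(set W)" using R(1) by blast
  ultimately have "(\<Union>t<n. L t) \<union> (\<Union>Q\<in>set W. X Q) \<subseteq> \<Union>(set W) \<union> (\<Union>\<tau>\<in>I. D \<tau>)" unfolding XU by blast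
  with sp cX show ?thesis by blast
qed

section \<open>Almost partitions into red cliques, and the absorption property\<close>

lemma clique_partition:
  assumes "finite V" "K > 0"
    and "\<And>X. X \<subseteq> V \<Longrightarrow> M \<le> card X \<Longrightarrow> \<exists>Y\<subseteq>X. card Y = K \<and> red_clique c Y"
  shows "\<exists>C. finite C \<and> disjoint C \<and> (\<forall>Q\<in>C. Q \<subseteq> V \<and> card Q = K \<and> red_clique c Q) \<and> card V \<le> M + K * card C"
  using assms(1,3)
proof (induction V rule: finite_psubset_induct)
  case (psubset V)
  show ?case
  proof (cases "M \<le> card V")
    case False
    then show ?thesis by (intro exI[of _ "{}"]) simp
  next
    case True
    then obtain Y where Y: "Y \<subseteq> V" "card Y = K" "red_clique c Y" using psubset.prems[of V] by auto
    have fY: "finite Y" using Y(1) psubset.hyps finite_subset by blast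
    have nY: "Y \<noteq> {}" using Y(2) assms(2) by auto
    have "\<exists>C. finite C \<and> disjoint C \<and> (\<forall>Q\<in>C. Q \<subseteq> V - Y \<and> card Q = K \<and> red_clique c Q) \<and> card (V - Y) \<le> M + K * card C"
    proof (rule psubset.IH)
      show "V - Y \<subset> V" using nY Y(1) by blast
      show "\<exists>Y\<subseteq>X. card Y = K \<and> red_clique c Y" if "X \<subseteq> V - Y" "M \<le> card X" for X
        by (rule psubset.prems) (use that in auto)
    qed
    then obtain C where C: "finite C" "disjoint C" "\<forall>Q\<in>C. Q \<subseteq> V - Y \<and> card Q = K \<and> red_clique c Q"
      "card (V - Y) \<le> M + K * card C" by metis
    have "Y \<inter> Q = {}" if "Q \<in> C" for Q using C(3) that by blast
    then have d: "disjoint (insert Y C)" using C(2) unfolding disjoint_def by (metis Int_commute insert_iff)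
    have "Y \<notin> C" using C(3) nY by blast
    then have "card V \<le> M + K * card (insert Y C)"
      using C(1,4) Y(1,2) fY card_Diff_subset[OF fY Y(1)] by simp
    moreover have "\<forall>Q\<in>insert Y C. Q \<subseteq> V \<and> card Q = K \<and> red_clique c Q" using C(3) Y by blast
    ultimately show ?thesis using d C(1) by (intro exI[of _ "insert Y C"]) simp
  qed
qed

text \<open>\<open>TT\<close> is irreflexive, so \<open>z\<close> lies in another part than
  \<open>x\<close> and \<open>y\<close>. Edges are never degenerate, and a blue clique, which only
  speaks of 3-sets, controls them all.\<close>

lemma H_E_card_3: "e \<in> H_E chi TT m \<Longrightarrow> card e = 3"
  unfolding H_E_def TT_def by (auto simp: card_insert_if)

lemma blue_clique_copy:
  assumes "Y \<subseteq> {..<N}" "card Y = chi * m" "red_clique (\<lambda>e. \<not> c e) Y"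
  shows "has_copy N c False (H_V chi m) (H_E chi TT m)"
proof -
  have H: "H_V chi m = {..<chi} \<times> {..<m}" by (auto simp: H_V_def)
  have "finite Y" using assms(1) finite_subset by blast
  then obtain f where f: "inj_on f (H_V chi m)" "f ` H_V chi m \<subseteq> Y"
    using card_le_inj[of "H_V chi m" Y] assms(2) by (auto simp: H)
  have "c (f ` e) = False" if e: "e \<in> H_E chi TT m" for e
  proof -
    have eH: "e \<subseteq> H_V chi m" using e unfolding H_E_def by auto
    then have "card (f ` e) = 3" using H_E_card_3[OF e] f(1) by (metis card_image inj_on_subset)
    moreover have "f ` e \<subseteq> Y" using eH f(2) by blast
    ultimately show ?thesis using assms(3) unfolding red_clique_def by simp
  qed
  then show ?thesis unfolding has_copy_def using f assms(1) by (intro exI[of _ f]) auto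
qed

text \<open>
  The red components \<open>i \<in> I\<close> have \<open>\<nu> i\<close> usable vertices in \<open>t i\<close> cliques. Whenever the components in
  \<open>A\<close> and \<open>B\<close> are large enough for \<open>T\<close> disjoint homogeneous tuples, the tight path through component
  \<open>i \<in> A\<close> gains \<open>s\<close> vertices of another component for every tuple \<open>\<tau> \<in> NS i\<close>, that is, for every tuple
  in which \<open>i\<close> does not send blue arcs to all of \<open>B\<close>.
\<close>
definition absorbing ::
    "nat \<Rightarrow> (nat set \<Rightarrow> bool) \<Rightarrow> nat \<Rightarrow> nat \<Rightarrow> nat \<Rightarrow> 'i set \<Rightarrow> ('i \<Rightarrow> nat) \<Rightarrow> ('i \<Rightarrow> nat) \<Rightarrow> bool" where
  "absorbing N c chi s E I \<nu> t \<longleftrightarrow>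
     (\<forall>A B T. A \<subseteq> B \<and> B \<subseteq> I \<and> (\<forall>i\<in>A. (2 * s + 2) * T + E * t i \<le> \<nu> i) \<and>
        (\<forall>i\<in>B - A. s * T + E * t i \<le> \<nu> i) \<longrightarrow>
      (\<exists>NS. (\<forall>i\<in>A. NS i \<subseteq> {..<T} \<and>
               (\<exists>P P' X. spans c P P' X \<and> X \<subseteq> {..<N} \<and> \<nu> i + s * card (NS i) \<le> card X)) \<and>
          (\<forall>\<tau><T. \<exists>G. semicomplete B G \<and> \<not> has_TT B G chi \<and>
               (\<forall>i\<in>A. \<tau> \<notin> NS i \<longrightarrow> (\<forall>j\<in>B. i \<noteq> j \<longrightarrow> G i j)))))"

text \<open>The components are walks, and \<open>G\<close> is the digraph of blue arcs of one tuple.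
  If component \<open>i\<close> lacks some blue arc in tuple \<tau>, homogeneity makes the triples
  of that direction red, and \<open>s\<close> vertices of the other part are absorbed. Vertices
  absorbed in different tuples are distinct, whether they come from one component or from
  two.\<close>

lemma walks_absorbing:
  fixes \<W> :: "nat set list set" and R :: "nat set list \<Rightarrow> nat set \<Rightarrow> nat set"
  assumes S: "\<And>B P X. finite B \<Longrightarrow> card B \<le> r \<Longrightarrow> (\<And>i. i \<in> B \<Longrightarrow> X i \<subseteq> P i \<and> finite (X i) \<and> E \<le> card (X i)) \<Longrightarrow>
       (\<And>i j. i \<in> B \<Longrightarrow> j \<in> B \<Longrightarrow> i \<noteq> j \<Longrightarrow> \<not> rlinked c k (P i) (P j)) \<Longrightarrow>
       \<exists>Y :: nat set list \<Rightarrow> nat set. (\<forall>i\<in>B. Y i \<subseteq> X i \<and> card (Y i) = 2 * s + 2) \<and> good_tuple c B Y"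
    and E: "2 * s + 4 \<le> E" and s: "0 < s" "m \<le> s"
    and noH: "\<not> has_copy N c False (H_V chi m) (H_E chi TT m)"
    and fin: "finite \<W>" "card \<W> \<le> r"
    and W: "\<And>W. W \<in> \<W> \<Longrightarrow> W \<noteq> []"
      "\<And>W Q. W \<in> \<W> \<Longrightarrow> Q \<in> set W \<Longrightarrow> Q \<subseteq> {..<N} \<and> red_clique c Q"
      "\<And>W W' Q Q'. W \<in> \<W> \<Longrightarrow> W' \<in> \<W> \<Longrightarrow> Q \<in> set W \<Longrightarrow> Q' \<in> set W' \<Longrightarrow> W \<noteq> W' \<or> Q \<noteq> Q' \<Longrightarrow> Q \<inter> Q' = {}"
      "\<And>W t. W \<in> \<W> \<Longrightarrow> t + 1 < length W \<Longrightarrow> W ! t \<noteq> W ! (t + 1)"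
      "\<And>W W' Q Q'. W \<in> \<W> \<Longrightarrow> W' \<in> \<W> \<Longrightarrow> W \<noteq> W' \<Longrightarrow> Q \<in> set W \<Longrightarrow> Q' \<in> set W' \<Longrightarrow> \<not> rlinked c k Q Q'"
    and L: "\<And>W t. W \<in> \<W> \<Longrightarrow> t + 1 < length W \<Longrightarrow> link c (W ! t) (W ! (t + 1)) (L W t)"
      "\<And>W t t'. W \<in> \<W> \<Longrightarrow> t + 1 < length W \<Longrightarrow> t' + 1 < length W \<Longrightarrow> t \<noteq> t' \<Longrightarrow> L W t \<inter> L W t' = {}"
    and R: "\<And>W Q. W \<in> \<W> \<Longrightarrow> Q \<in> set W \<Longrightarrow> R W Q \<subseteq> Q \<and> 2 \<le> card (R W Q)"
      "\<And>W Q t. W \<in> \<W> \<Longrightarrow> Q \<in> set W \<Longrightarrow> t + 1 < length W \<Longrightarrow> R W Q \<inter> L W t = {}"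
  shows "absorbing N c chi s E \<W> (\<lambda>W. \<Sum>Q\<in>set W. card (R W Q)) (\<lambda>W. card (set W))"
  unfolding absorbing_def
proof (intro allI impI, elim conjE)
  fix A B T
  assume AB: "A \<subseteq> B" "B \<subseteq> \<W>"
    and sA: "\<forall>i\<in>A. (2 * s + 2) * T + E * card (set i) \<le> (\<Sum>Q\<in>set i. card (R i Q))"
    and sB: "\<forall>i\<in>B - A. s * T + E * card (set i) \<le> (\<Sum>Q\<in>set i. card (R i Q))"
  \<comment> \<open>An absorbing part needs \<open>2 * s + 2\<close> vertices for the pattern of
    \<open>spans_absorb\<close>; every other part only has to supply \<open>s\<close>.\<close>
  define p where "p i = (if i \<in> A then 2 * s + 2 else s)" for i
  have BW: "i \<in> \<W>" if "i \<in> B" for i using AB that by auto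
  have fR: "finite (R W Q)" if "W \<in> \<W>" "Q \<in> set W" for W Q 
  proof (rule finite_subset)
    show "R W Q \<subseteq> {..<N}" using R(1)[OF that] W(2)[OF that] by blast
  qed simp
  have fB: "finite B" using finite_subset[OF AB(2) fin(1)] .
  have cB: "card B \<le> r" using card_mono[OF fin(1) AB(2)] fin(2) by linarith
  have disjR: "R W Q \<inter> R W' Q' = {}" if "W \<in> \<W>" "W' \<in> \<W>" "Q \<in> set W" "Q' \<in> set W'" "W \<noteq> W' \<or> Q \<noteq> Q'" for W W' Q Q'
    using W(3)[OF that] R(1)[OF that(1,3)] R(1)[OF that(2,4)] by blast
  have "\<exists>cl Y. (\<forall>\<tau><T. good_tuple c B (Y \<tau>) \<and> (\<forall>i\<in>B. cl \<tau> i \<in> set i \<and> Y \<tau> i \<subseteq> R i (cl \<tau> i) \<and> card (Y \<tau> i) = p i)) \<and>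
     (\<forall>i\<in>B. (\<forall>\<tau><T. \<forall>\<sigma><T. \<tau> \<noteq> \<sigma> \<longrightarrow> Y \<tau> i \<inter> Y \<sigma> i = {}) \<and> (\<forall>Q\<in>set i. 2 \<le> card (R i Q - (\<Union>\<tau><T. Y \<tau> i))))"
  proof (rule extract_tuples[where S = E])
    show "finite (R i Q) \<and> 2 \<le> card (R i Q)" if "i \<in> B" "Q \<in> set i" for i Q
      using R(1)[OF BW[OF that(1)] that(2)] fR[OF BW[OF that(1)] that(2)] by simp
    show "R i Q \<inter> R i Q' = {}" if "i \<in> B" "Q \<in> set i" "Q' \<in> set i" "Q \<noteq> Q'" for i Q Q'
      using disjR[of i i Q Q'] BW that by simp
    show "0 < p i \<and> p i + 2 \<le> E" for i using s E by (simp add: p_def)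
    show "p i * T + E * card (set i) \<le> (\<Sum>Q\<in>set i. card (R i Q))" if "i \<in> B" for i
      using sA sB that by (simp add: p_def)
    fix cl :: "nat set list \<Rightarrow> nat set" and X
    assume X: "\<And>i. i \<in> B \<Longrightarrow> cl i \<in> set i \<and> X i \<subseteq> R i (cl i) \<and> E \<le> card (X i)"
    have "\<exists>Y. (\<forall>i\<in>B. Y i \<subseteq> X i \<and> card (Y i) = 2 * s + 2) \<and> good_tuple c B Y"
    proof (rule S[OF fB cB])
      show "X i \<subseteq> cl i \<and> finite (X i) \<and> E \<le> card (X i)" if "i \<in> B" for i
        using X[OF that] R(1)[OF BW[OF that], of "cl i"] fR[OF BW[OF that], of "cl i"] finite_subset by blast
      show "\<not> rlinked c k (cl i) (cl j)" if "i \<in> B" "j \<in> B" "i \<noteq> j" for i j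
        using W(5)[OF BW[OF that(1)] BW[OF that(2)] that(3)] X that by blast
    qed
    then obtain Y where Y: "\<And>i. i \<in> B \<Longrightarrow> Y i \<subseteq> X i" "\<And>i. i \<in> B \<Longrightarrow> card (Y i) = 2 * s + 2" "good_tuple c B Y" by metis
    have "\<exists>Z. Z \<subseteq> Y i \<and> card Z = p i" if "i \<in> B" for i
      using obtain_subset_with_card_n[of "p i" "Y i"] Y(2)[OF that] s by (metis p_def le_add2 mult_2 trans_le_add1 order_refl)
    then obtain Z where Z: "\<And>i. i \<in> B \<Longrightarrow> Z i \<subseteq> Y i" "\<And>i. i \<in> B \<Longrightarrow> card (Z i) = p i" by metis
    have "good_tuple c B Z" by (rule good_tuple_mono[OF Y(3) Z(1)])
    moreover have "Z i \<subseteq> X i" if "i \<in> B" for i using Z(1)[OF that] Y(1)[OF that] by blast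
    ultimately show "\<exists>Y. (\<forall>i\<in>B. Y i \<subseteq> X i \<and> card (Y i) = p i) \<and> good_tuple c B Y"
      using Z(2) by (intro exI[of _ Z]) simp
  qed auto
  then obtain cl Y where Y0:
    "\<forall>\<tau><T. good_tuple c B (Y \<tau>) \<and> (\<forall>i\<in>B. cl \<tau> i \<in> set i \<and> Y \<tau> i \<subseteq> R i (cl \<tau> i) \<and> card (Y \<tau> i) = p i)"
    "\<forall>i\<in>B. (\<forall>\<tau><T. \<forall>\<sigma><T. \<tau> \<noteq> \<sigma> \<longrightarrow> Y \<tau> i \<inter> Y \<sigma> i = {}) \<and> (\<forall>Q\<in>set i. 2 \<le> card (R i Q - (\<Union>\<tau><T. Y \<tau> i)))"
    by (elim exE conjE)
  then have Y: "\<And>\<tau>. \<tau> < T \<Longrightarrow> good_tuple c B (Y \<tau>)"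
      "\<And>\<tau> i. \<tau> < T \<Longrightarrow> i \<in> B \<Longrightarrow> cl \<tau> i \<in> set i \<and> Y \<tau> i \<subseteq> R i (cl \<tau> i) \<and> card (Y \<tau> i) = p i"
      "\<And>i \<tau> \<sigma>. i \<in> B \<Longrightarrow> \<tau> < T \<Longrightarrow> \<sigma> < T \<Longrightarrow> \<tau> \<noteq> \<sigma> \<Longrightarrow> Y \<tau> i \<inter> Y \<sigma> i = {}"
      "\<And>i Q. i \<in> B \<Longrightarrow> Q \<in> set i \<Longrightarrow> 2 \<le> card (R i Q - (\<Union>\<tau><T. Y \<tau> i))"
    by simp_all
  have Ycl: "Y \<tau> i \<subseteq> cl \<tau> i" "cl \<tau> i \<in> set i" if "\<tau> < T" "i \<in> B" for \<tau> i
    using Y(2)[OF that] R(1)[OF BW[OF that(2)]] by blast+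
  have Ydisj: "Y \<tau> i \<inter> Y \<sigma> j = {}" if "\<tau> < T" "\<sigma> < T" "i \<in> B" "j \<in> B" "i \<noteq> j" for \<tau> \<sigma> i j
    using W(3)[OF BW[OF that(3)] BW[OF that(4)] Ycl(2)[OF that(1,3)] Ycl(2)[OF that(2,4)]] that(5)
      Ycl(1)[OF that(1,3)] Ycl(1)[OF that(2,4)] by blast
  define NS where "NS i = {\<tau>. \<tau> < T \<and> (\<exists>j\<in>B. i \<noteq> j \<and> \<not> homog c False (Y \<tau> i) (Y \<tau> j))}" for i
  show "\<exists>NS. (\<forall>i\<in>A. NS i \<subseteq> {..<T} \<and>
      (\<exists>P P' X. spans c P P' X \<and> X \<subseteq> {..<N} \<and> (\<Sum>Q\<in>set i. card (R i Q)) + s * card (NS i) \<le> card X)) \<and>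
      (\<forall>\<tau><T. \<exists>G. semicomplete B G \<and> \<not> has_TT B G chi \<and> (\<forall>i\<in>A. \<tau> \<notin> NS i \<longrightarrow> (\<forall>j\<in>B. i \<noteq> j \<longrightarrow> G i j)))"
  proof (intro exI[of _ NS] conjI ballI allI impI)
    \<comment> \<open>Each path is built on its own. Different components may absorb from each
      other, since a single long path is sought.\<close>
    fix i assume i: "i \<in> A"
    then have iB: "i \<in> B" and iW: "i \<in> \<W>" using AB by auto
    show "NS i \<subseteq> {..<T}" by (auto simp: NS_def)
    have "\<exists>j D. j \<in> B \<and> j \<noteq> i \<and> D \<subseteq> Y \<tau> j \<and> finite D \<and> card D = s \<and> homog c True (Y \<tau> i) D" if "\<tau> \<in> NS i" for \<tau>
    proof -
      from that obtain j where j: "\<tau> < T" "j \<in> B" "i \<noteq> j" "\<not> homog c False (Y \<tau> i) (Y \<tau> j)" by (auto simp: NS_def)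
      then have h: "homog c True (Y \<tau> i) (Y \<tau> j)" using Y(1)[OF j(1)] iB unfolding good_tuple_def by blast
      have "s \<le> card (Y \<tau> j)" using Y(2)[OF j(1,2)] by (simp add: p_def)
      then obtain D where D: "D \<subseteq> Y \<tau> j" "card D = s" by (meson obtain_subset_with_card_n)
      have "finite D" using D(2) s(1) by (metis card.infinite less_numeral_extra(3))
      moreover have "homog c True (Y \<tau> i) D" using homog_mono[OF h _ D(1)] by simp
      ultimately show ?thesis using D j by blast
    qed
    then obtain jj D where D: "\<And>\<tau>. \<tau> \<in> NS i \<Longrightarrow> jj \<tau> \<in> B \<and> jj \<tau> \<noteq> i \<and> D \<tau> \<subseteq> Y \<tau> (jj \<tau>) \<and> finite (D \<tau>) \<and>
       card (D \<tau>) = s \<and> homog c True (Y \<tau> i) (D \<tau>)" by metis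
    have NT: "\<tau> < T" if "\<tau> \<in> NS i" for \<tau> using that by (simp add: NS_def)
    have Dcl: "D \<tau> \<subseteq> cl \<tau> (jj \<tau>)" if "\<tau> \<in> NS i" for \<tau> using D[OF that] Ycl(1)[OF NT[OF that]] by blast
    have "\<exists>P P' X. spans c P P' X \<and> X \<subseteq> \<Union>(set i) \<union> (\<Union>\<tau>\<in>NS i. D \<tau>) \<and>
       (\<Sum>Q\<in>set i. card (R i Q)) + s * card (NS i) \<le> card X"
    proof (rule walk_path[where L = "L i" and cl = "\<lambda>\<tau>. cl \<tau> i" and Y = "\<lambda>\<tau>. Y \<tau> i"])
      show "i \<noteq> []" by (rule W(1)[OF iW])
      show "disjoint (set i)" unfolding disjoint_def using W(3)[OF iW iW] by simp
      show "red_clique c Q" if "Q \<in> set i" for Q using W(2)[OF iW that] by simp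
      show "i ! t \<noteq> i ! (t + 1)" if "t + 1 < length i" for t by (rule W(4)[OF iW that])
      show "link c (i ! t) (i ! (t + 1)) (L i t)" if "t + 1 < length i" for t by (rule L(1)[OF iW that])
      show "L i t \<inter> L i t' = {}" if "t + 1 < length i" "t' + 1 < length i" "t \<noteq> t'" for t t' by (rule L(2)[OF iW that])
      show "R i Q \<subseteq> Q \<and> finite (R i Q)" if "Q \<in> set i" for Q using R(1)[OF iW that] fR[OF iW that] by simp
      show "R i Q \<inter> L i t = {}" if "Q \<in> set i" "t + 1 < length i" for Q t by (rule R(2)[OF iW that])
      show "finite (NS i)" unfolding NS_def by simp
      show "cl \<tau> i \<in> set i \<and> Y \<tau> i \<subseteq> R i (cl \<tau> i) \<and> card (Y \<tau> i) = 2 * s + 2" if "\<tau> \<in> NS i" for \<tau>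
        using Y(2)[OF NT[OF that] iB] i by (simp add: p_def)
      show "Y \<tau> i \<inter> Y \<sigma> i = {}" if "\<tau> \<in> NS i" "\<sigma> \<in> NS i" "\<tau> \<noteq> \<sigma>" for \<tau> \<sigma>
        by (rule Y(3)[OF iB NT[OF that(1)] NT[OF that(2)] that(3)])
      show "2 \<le> card (R i Q - (\<Union>\<tau>\<in>NS i. Y \<tau> i))" if "Q \<in> set i" for Q
      proof -
        have "card (R i Q - (\<Union>\<tau><T. Y \<tau> i)) \<le> card (R i Q - (\<Union>\<tau>\<in>NS i. Y \<tau> i))"
          using fR[OF iW that] NT by (intro card_mono) auto
        then show ?thesis using Y(4)[OF iB that] by linarith
      qed
      show "finite (D \<tau>) \<and> card (D \<tau>) = s \<and> D \<tau> \<inter> \<Union>(set i) = {} \<and> homog c True (Y \<tau> i) (D \<tau>)" if "\<tau> \<in> NS i" for \<tau>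
      proof -
        have jB: "jj \<tau> \<in> B" "jj \<tau> \<noteq> i" using D[OF that] by auto
        have "cl \<tau> (jj \<tau>) \<inter> Q = {}" if "Q \<in> set i" for Q
          using W(3)[OF BW[OF jB(1)] iW Ycl(2)[OF NT[OF \<open>\<tau> \<in> NS i\<close>] jB(1)] that] jB(2) by simp
        then have "D \<tau> \<inter> \<Union>(set i) = {}" using Dcl[OF that] by blast
        then show ?thesis using D[OF that] by simp
      qed
      show "D \<tau> \<inter> D \<sigma> = {}" if "\<tau> \<in> NS i" "\<sigma> \<in> NS i" "\<tau> \<noteq> \<sigma>" for \<tau> \<sigma>
      proof -
        have "Y \<tau> (jj \<tau>) \<inter> Y \<sigma> (jj \<sigma>) = {}"
        proof (cases "jj \<tau> = jj \<sigma>")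
          case True
          then show ?thesis using Y(3)[of "jj \<tau>" \<tau> \<sigma>] D[OF that(1)] NT that by simp
        next
          case False
          then show ?thesis using Ydisj[OF NT[OF that(1)] NT[OF that(2)]] D[OF that(1)] D[OF that(2)] by simp
        qed
        then show ?thesis using D[OF that(1)] D[OF that(2)] by blast
      qed
    qed
    moreover have "\<Union>(set i) \<union> (\<Union>\<tau>\<in>NS i. D \<tau>) \<subseteq> {..<N}"
    proof -
      have "Q \<subseteq> {..<N}" if "Q \<in> set i" for Q using W(2)[OF iW that] by simp
      moreover have "D \<tau> \<subseteq> {..<N}" if "\<tau> \<in> NS i" for \<tau>
      proof -
        have jB: "jj \<tau> \<in> B" using D[OF that] by auto
        have "cl \<tau> (jj \<tau>) \<subseteq> {..<N}" using W(2)[OF BW[OF jB] Ycl(2)[OF NT[OF that] jB]] by simp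
        then show ?thesis using Dcl[OF that] by blast
      qed
      ultimately show ?thesis by (simp add: UN_subset_iff Sup_le_iff)
    qed
    ultimately show "\<exists>P P' X. spans c P P' X \<and> X \<subseteq> {..<N} \<and> (\<Sum>Q\<in>set i. card (R i Q)) + s * card (NS i) \<le> card X"
      by (meson order_trans)
  next
    fix \<tau> assume \<tau>: "\<tau> < T"
    show "\<exists>G. semicomplete B G \<and> \<not> has_TT B G chi \<and> (\<forall>i\<in>A. \<tau> \<notin> NS i \<longrightarrow> (\<forall>j\<in>B. i \<noteq> j \<longrightarrow> G i j))"
    proof (intro exI[of _ "\<lambda>i j. homog c False (Y \<tau> i) (Y \<tau> j)"] conjI)
      show "semicomplete B (\<lambda>i j. homog c False (Y \<tau> i) (Y \<tau> j))" using Y(1)[OF \<tau>] by (simp add: good_tuple_def)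
      show "\<not> has_TT B (\<lambda>i j. homog c False (Y \<tau> i) (Y \<tau> j)) chi"
      proof
        assume "has_TT B (\<lambda>i j. homog c False (Y \<tau> i) (Y \<tau> j)) chi"
        then have "has_copy N c False (H_V chi m) (H_E chi TT m)"
        proof (rule blue_copy)
          show "Y \<tau> i \<subseteq> {..<N}" if "i \<in> B" for i
            using Ycl(1)[OF \<tau> that] W(2)[OF BW[OF that] Ycl(2)[OF \<tau> that]] by blast
          show "m \<le> card (Y \<tau> i)" if "i \<in> B" for i using Y(2)[OF \<tau> that] s(2) by (simp add: p_def)
          show "Y \<tau> i \<inter> Y \<tau> j = {}" if "i \<in> B" "j \<in> B" "i \<noteq> j" for i j by (rule Ydisj[OF \<tau> \<tau> that])
        qed
        then show False using noH by simp
      qed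
      show "\<forall>i\<in>A. \<tau> \<notin> NS i \<longrightarrow> (\<forall>j\<in>B. i \<noteq> j \<longrightarrow> homog c False (Y \<tau> i) (Y \<tau> j))"
        using \<tau> unfolding NS_def by blast
    qed
  qed
qed

section \<open>The red components\<close>

text \<open>The order of the quantifiers matters. \<open>E\<close> bounds the vertices given up per
  clique, and \<open>sum t I\<close> counts the cliques; by \<open>K * sum t I \<le> N\<close> the
  total loss \<open>E * sum t I\<close> is a small fraction of \<open>N\<close> once
  \<open>K\<close> is large against \<open>E\<close>. \<open>M\<close> is the Ramsey number for red
  cliques of size \<open>K\<close> and bounds the uncovered vertices.\<close>

lemma red_components:
  fixes chi m s :: nat
  assumes s: "0 < s" "m \<le> s"
  shows "\<exists>E. \<forall>K\<ge>E. \<exists>M. \<forall>N c. \<not> has_copy N c False (H_V chi m) (H_E chi TT m) \<longrightarrow>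
    (\<exists>(I :: nat set list set) \<nu> t. finite I \<and> card I < dir_ramsey chi \<and>
       N \<le> sum \<nu> I + M + E * sum t I \<and> K * sum t I \<le> N \<and> absorbing N c chi s E I \<nu> t)"
proof -
  define r where "r = dir_ramsey chi"
  \<comment> \<open>\<open>walk_cover\<close> visits each clique at most \<open>2 ^ r\<close> times,
    and \<open>walk_links\<close> then asks for more than \<open>16 * w\<close> disjoint
    links.\<close>
  define w :: nat where "w = 2 ^ r"
  define k where "k = 16 * w + 1"
  have q2: "2 \<le> 2 * s + 2" by simp
  obtain S1 :: nat where S1: "\<forall>(c::nat set \<Rightarrow> bool) (B::nat set list set) P X. finite B \<and> card B \<le> r \<and>
     (\<forall>i\<in>B. X i \<subseteq> P i \<and> finite (X i) \<and> S1 \<le> card (X i)) \<and>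
     (\<forall>i\<in>B. \<forall>j\<in>B. i \<noteq> j \<longrightarrow> \<not> rlinked c k (P i) (P j)) \<longrightarrow>
     (\<exists>Y. (\<forall>i\<in>B. Y i \<subseteq> X i \<and> card (Y i) = 2 * s + 2) \<and> good_tuple c B Y)"
    using ex_good_tuple[where k = r and n = k, OF q2] by (elim exE)
  \<comment> \<open>\<open>S1\<close> serves tuples indexed by walks, \<open>S2\<close> tuples
    indexed by cliques; the index types differ.\<close>
  obtain S2 :: nat where S2: "\<forall>(c::nat set \<Rightarrow> bool) (B::nat set set) P X. finite B \<and> card B \<le> r \<and>
     (\<forall>i\<in>B. X i \<subseteq> P i \<and> finite (X i) \<and> S2 \<le> card (X i)) \<and>
     (\<forall>i\<in>B. \<forall>j\<in>B. i \<noteq> j \<longrightarrow> \<not> rlinked c k (P i) (P j)) \<longrightarrow>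
     (\<exists>Y. (\<forall>i\<in>B. Y i \<subseteq> X i \<and> card (Y i) = 2 * s + 2) \<and> good_tuple c B Y)"
    using ex_good_tuple[where k = r and n = k, OF q2] by (elim exE)
  \<comment> \<open>\<open>S1\<close> and \<open>S2\<close> are the sizes from which tuples can be
    extracted, \<open>8 * w\<close> vertices per clique go to links, and \<open>2 * s + 4\<close>
    leaves two vertices when a tuple is removed.\<close>
  define E where "E = S1 + S2 + 8 * w + 2 * s + 4"
  have "\<exists>M. \<forall>N c. \<not> has_copy N c False (H_V chi m) (H_E chi TT m) \<longrightarrow>
    (\<exists>(I :: nat set list set) \<nu> t. finite I \<and> card I < dir_ramsey chi \<and>
       N \<le> sum \<nu> I + M + E * sum t I \<and> K * sum t I \<le> N \<and> absorbing N c chi s E I \<nu> t)"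
    if K: "E \<le> K" for K
  proof -
    obtain M :: nat where M: "\<forall>(c::nat set \<Rightarrow> bool) X. finite X \<and> M \<le> card X \<longrightarrow>
     (\<exists>Y\<subseteq>X. card Y = K \<and> red_clique c Y) \<or> (\<exists>Y\<subseteq>X. card Y = chi * m \<and> red_clique (\<lambda>e. \<not> c e) Y)"
      using red_clique_or_blue_clique[where K = K and L = "chi * m"] by (elim exE)
    have "\<exists>(I :: nat set list set) \<nu> t. finite I \<and> card I < dir_ramsey chi \<and>
       N \<le> sum \<nu> I + M + E * sum t I \<and> K * sum t I \<le> N \<and> absorbing N c chi s E I \<nu> t"
      if noH: "\<not> has_copy N c False (H_V chi m) (H_E chi TT m)" for N c
    proof -
      have K0: "0 < K" using K by (simp add: E_def)
      have red: "\<exists>Y\<subseteq>X. card Y = K \<and> red_clique c Y" if X: "X \<subseteq> {..<N}" "M \<le> card X" for X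
      proof -
        have "finite X" using X(1) finite_subset by blast
        then have "(\<exists>Y\<subseteq>X. card Y = K \<and> red_clique c Y) \<or> (\<exists>Y\<subseteq>X. card Y = chi * m \<and> red_clique (\<lambda>e. \<not> c e) Y)"
          using M X(2) by simp
        moreover have False if "Y \<subseteq> X" "card Y = chi * m" "red_clique (\<lambda>e. \<not> c e) Y" for Y
          using blue_clique_copy[of Y N chi m c] that X(1) noH by (metis order_trans)
        ultimately show ?thesis by metis
      qed
      have "\<exists>C. finite C \<and> disjoint C \<and> (\<forall>Q\<in>C. Q \<subseteq> {..<N} \<and> card Q = K \<and> red_clique c Q) \<and>
          card {..<N} \<le> M + K * card C"
        by (rule clique_partition[OF finite_lessThan K0 red])
      then obtain C where C: "finite C" "disjoint C"
        "\<forall>Q\<in>C. Q \<subseteq> {..<N} \<and> card Q = K \<and> red_clique c Q" "N \<le> M + K * card C"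
        by (elim exE conjE) simp
      have fQ: "finite Q" if "Q \<in> C" for Q using C(3) that finite_subset by blast
      have dC: "P \<inter> Q = {}" if "P \<in> C" "Q \<in> C" "P \<noteq> Q" for P Q using C(2) that unfolding disjoint_def by simp
      define G where "G P Q \<longleftrightarrow> P \<noteq> Q \<and> rlinked c k P Q" for P Q :: "nat set"
      have symG: "symp G" by (rule sympI) (auto simp: G_def rlinked_sym)
      have noind: "\<exists>x\<in>J. \<exists>y\<in>J. x \<noteq> y \<and> G x y" if J: "J \<subseteq> C" "card J = r" for J
      proof (rule ccontr)
        assume nG: "\<not> ?thesis"
        have fJ: "finite J" using J(1) C(1) finite_subset by blast
        have "\<exists>Y. (\<forall>i\<in>J. Y i \<subseteq> i \<and> card (Y i) = 2 * s + 2) \<and> good_tuple c J Y"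
        proof (rule S2[rule_format, where P = "\<lambda>i. i" and X = "\<lambda>i. i"], intro conjI ballI impI)
          show "S2 \<le> card i" if "i \<in> J" for i using C(3) J(1) K that by (force simp: E_def)
          show "\<not> rlinked c k i j" if "i \<in> J" "j \<in> J" "i \<noteq> j" for i j using nG that unfolding G_def by metis
        qed (use fJ J fQ in auto)
        then obtain Y where Y: "\<And>i. i \<in> J \<Longrightarrow> Y i \<subseteq> i" "\<And>i. i \<in> J \<Longrightarrow> card (Y i) = 2 * s + 2" "good_tuple c J Y"
          by metis
        have "has_TT J (\<lambda>i j. homog c False (Y i) (Y j)) chi"
          by (rule has_TT_if_dir_ramsey_le[OF fJ]) (use Y(3) J(2) in \<open>simp_all add: good_tuple_def r_def\<close>)
        then have "has_copy N c False (H_V chi m) (H_E chi TT m)"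
        proof (rule blue_copy)
          show "Y i \<subseteq> {..<N}" if "i \<in> J" for i using Y(1)[OF that] C(3) J(1) that by blast
          show "m \<le> card (Y i)" if "i \<in> J" for i using Y(2)[OF that] s by simp
          show "Y i \<inter> Y j = {}" if "i \<in> J" "j \<in> J" "i \<noteq> j" for i j
            using dC[of i j] Y(1)[OF that(1)] Y(1)[OF that(2)] J(1) that by blast
        qed
        then show False using noH by simp
      qed
      obtain \<W> where \<W>: "finite \<W>" "card \<W> < r"
        "\<And>W. W \<in> \<W> \<Longrightarrow> W \<noteq> [] \<and> successively G W \<and> (\<forall>x. count_list W x \<le> 2 ^ r)"
        "\<And>W W'. W \<in> \<W> \<Longrightarrow> W' \<in> \<W> \<Longrightarrow> W \<noteq> W' \<Longrightarrow> set W \<inter> set W' = {}"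
        "(\<Union>W\<in>\<W>. set W) = C"
        "\<And>W W' x y. W \<in> \<W> \<Longrightarrow> W' \<in> \<W> \<Longrightarrow> W \<noteq> W' \<Longrightarrow> x \<in> set W \<Longrightarrow> y \<in> set W' \<Longrightarrow> \<not> G x y"
      proof (rule walk_cover[where r = r, OF C(1) symG])
        show "\<exists>x\<in>J. \<exists>y\<in>J. x \<noteq> y \<and> G x y" if "J \<subseteq> C" "card J = r" for J
          by (rule noind[OF that])
      qed (rule that; simp)
      have WC: "Q \<in> C" if "W \<in> \<W>" "Q \<in> set W" for W Q using \<W>(5) that by blast
      have disjW: "disjoint (set W)" if "W \<in> \<W>" for W
        using WC[OF that] dC unfolding disjoint_def by simp
      have mult: "count_list W Q \<le> w" if "W \<in> \<W>" for W Q using \<W>(3)[OF that] by (simp add: w_def)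
      have "\<exists>L. (\<forall>t. t + 1 < length W \<longrightarrow> link c (W ! t) (W ! (t + 1)) (L t)) \<and>
         (\<forall>t t'. t + 1 < length W \<longrightarrow> t' + 1 < length W \<longrightarrow> t \<noteq> t' \<longrightarrow> L t \<inter> L t' = {})" if "W \<in> \<W>" for W
      proof (rule walk_links[OF _ mult[OF that] disjW[OF that]])
        show "successively (rlinked c k) W"
          by (rule successively_mono[of G]) (use \<W>(3)[OF that] in \<open>auto simp: G_def\<close>)
        show "16 * w < k" by (simp add: k_def)
      qed
      then obtain L where L: "\<And>W t. W \<in> \<W> \<Longrightarrow> t + 1 < length W \<Longrightarrow> link c (W ! t) (W ! (t + 1)) (L W t)"
        "\<And>W t t'. W \<in> \<W> \<Longrightarrow> t + 1 < length W \<Longrightarrow> t' + 1 < length W \<Longrightarrow> t \<noteq> t' \<Longrightarrow> L W t \<inter> L W t' = {}"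
        by metis
      define U where "U W = (\<Union>t\<in>{t. t + 1 < length W}. L W t)" for W
      define R where "R W Q = Q - U W" for W Q
      have cR: "K \<le> card (R W Q) + 8 * w" if "W \<in> \<W>" "Q \<in> set W" for W Q
      proof -
        have links: "t + 1 < length W \<and> link c (W ! t) (W ! (t + 1)) (L W t)" if "t \<in> {t. t + 1 < length W}" for t
          using L(1)[OF \<open>W \<in> \<W>\<close>] that by simp
        have "(\<Union>t\<in>{t. t + 1 < length W}. L W t \<inter> Q) = Q \<inter> U W" unfolding U_def by blast
        then have "finite (Q \<inter> U W)" "card (Q \<inter> U W) \<le> 8 * w"
          using links_meeting_clique[where I = "{t. t + 1 < length W}", OF mult[OF that(1)] disjW[OF that(1)] links that(2)]
          by simp_all
        moreover have "card (R W Q) = card Q - card (Q \<inter> U W)"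
          unfolding R_def using card_Diff_subset_Int[OF \<open>finite (Q \<inter> U W)\<close>] .
        moreover have "card Q = K" using C(3) WC[OF that] by simp
        ultimately show ?thesis by linarith
      qed
      define \<nu> where "\<nu> W = (\<Sum>Q\<in>set W. card (R W Q))" for W
      define t where "t W = card (set W)" for W :: "nat set list"
      have sumt: "sum t \<W> = card C"
      proof -
        have "card (\<Union>W\<in>\<W>. set W) = (\<Sum>W\<in>\<W>. card (set W))"
          by (rule card_UN_disjoint) (use \<W>(1,4) in auto)
        then show ?thesis using \<W>(5) by (simp add: t_def)
      qed
      have "K * sum t \<W> \<le> sum \<nu> \<W> + 8 * w * sum t \<W>"
      proof -
        have "K * t W \<le> \<nu> W + 8 * w * t W" if "W \<in> \<W>" for W
        proof -
          have "K * t W = (\<Sum>Q\<in>set W. K)" by (simp add: t_def)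
          also have "\<dots> \<le> (\<Sum>Q\<in>set W. card (R W Q) + 8 * w)" by (rule sum_mono) (rule cR[OF that])
          also have "\<dots> = \<nu> W + 8 * w * t W" by (simp add: \<nu>_def t_def sum.distrib)
          finally show ?thesis .
        qed
        then have "(\<Sum>W\<in>\<W>. K * t W) \<le> (\<Sum>W\<in>\<W>. \<nu> W + 8 * w * t W)" by (rule sum_mono)
        then show ?thesis by (simp add: sum.distrib sum_distrib_left)
      qed
      moreover have "8 * w * sum t \<W> \<le> E * sum t \<W>" by (rule mult_le_mono1) (simp add: E_def)
      ultimately have N: "N \<le> sum \<nu> \<W> + M + E * sum t \<W>" using C(4) unfolding sumt by linarith
      have "K * sum t \<W> \<le> N"
      proof -
        have "card (\<Union>Q\<in>C. Q) = (\<Sum>Q\<in>C. card Q)"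
          by (rule card_UN_disjoint) (use C(1) fQ dC in auto)
        also have "\<dots> = K * card C" using C(3) by simp
        finally have "K * card C = card (\<Union>Q\<in>C. Q)" by simp
        also have "\<dots> \<le> card {..<N}" by (rule card_mono) (use C(3) in auto)
        finally show ?thesis using sumt by simp
      qed
      moreover have "absorbing N c chi s E \<W> \<nu> t"
        unfolding \<nu>_def t_def
      proof (rule walks_absorbing[where k = k and r = r and L = L])
        fix B :: "nat set list set" and P X
        assume *: "finite B" "card B \<le> r" "\<And>i. i \<in> B \<Longrightarrow> X i \<subseteq> P i \<and> finite (X i) \<and> E \<le> card (X i)"
          "\<And>i j. i \<in> B \<Longrightarrow> j \<in> B \<Longrightarrow> i \<noteq> j \<Longrightarrow> \<not> rlinked c k (P i) (P j)"
        show "\<exists>Y. (\<forall>i\<in>B. Y i \<subseteq> X i \<and> card (Y i) = 2 * s + 2) \<and> good_tuple c B Y"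
        proof (rule S1[rule_format, where P = P], intro conjI ballI impI)
          show "S1 \<le> card (X i)" if "i \<in> B" for i using *(3)[OF that] by (simp add: E_def)
          show "X i \<subseteq> P i" "finite (X i)" if "i \<in> B" for i using *(3)[OF that] by simp_all
        qed (use * in simp_all)
      next
        show "2 * s + 4 \<le> E" by (simp add: E_def)
        show "card \<W> \<le> r" using \<W>(2) by simp
        show "W \<noteq> []" if "W \<in> \<W>" for W using \<W>(3)[OF that] by simp
        show "Q \<subseteq> {..<N} \<and> red_clique c Q" if "W \<in> \<W>" "Q \<in> set W" for W Q using C(3) WC[OF that] by simp
        show "Q \<inter> Q' = {}" if "W \<in> \<W>" "W' \<in> \<W>" "Q \<in> set W" "Q' \<in> set W'" "W \<noteq> W' \<or> Q \<noteq> Q'" for W W' Q Q'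
        proof -
          have "Q \<noteq> Q'" using \<W>(4)[OF that(1,2)] that by blast
          then show ?thesis using dC WC that by metis
        qed
        show "W ! t \<noteq> W ! (t + 1)" if "W \<in> \<W>" "t + 1 < length W" for W t
          using \<W>(3)[OF that(1)] that(2) by (auto simp: successively_conv_nth G_def)
        show "\<not> rlinked c k Q Q'" if "W \<in> \<W>" "W' \<in> \<W>" "W \<noteq> W'" "Q \<in> set W" "Q' \<in> set W'" for W W' Q Q'
        proof -
          have "Q \<noteq> Q'" using \<W>(4)[OF that(1-3)] that(4,5) by blast
          then show ?thesis using \<W>(6)[OF that] by (simp add: G_def)
        qed
        show "R W Q \<subseteq> Q \<and> 2 \<le> card (R W Q)" if "W \<in> \<W>" "Q \<in> set W" for W Q
          using cR[OF that] K by (auto simp: R_def E_def)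
        show "R W Q \<inter> L W t = {}" if "W \<in> \<W>" "Q \<in> set W" "t + 1 < length W" for W Q t
          using that(3) unfolding R_def U_def by blast
      qed (use \<W>(1) s noH L in auto)
      ultimately show ?thesis using N \<W>(1,2) unfolding r_def
        by (intro exI[of _ \<W>] exI[of _ \<nu>] exI[of _ t]) simp
    qed
    then show ?thesis by (intro exI[of _ M]) simp
  qed
  then show ?thesis by (intro exI[of _ E]) simp
qed

lemma spans_has_path:
  assumes "spans c P P' X" "X \<subseteq> {..<N}" "n \<le> card X"
  shows "has_copy N c True (tight_path_V n) (tight_path_E n)"
proof -
  obtain xs where xs: "anchored c P P' xs" "set xs = X" using assms(1) unfolding spans_def by blast
  then have d: "distinct xs" "tight c xs" by (simp_all add: anchored_def)
  have len: "n \<le> length xs" using assms(3) xs(2) d(1) by (metis distinct_card)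
  have "inj_on ((!) xs) {..<n}" using d(1) len by (auto simp: inj_on_def nth_eq_iff_index_eq)
  moreover have "(!) xs ` {..<n} \<subseteq> {..<N}"
  proof
    fix v assume "v \<in> (!) xs ` {..<n}"
    then obtain i where "i < n" "v = xs ! i" by auto
    then have "v \<in> set xs" using len by simp
    then show "v \<in> {..<N}" using xs(2) assms(2) by blast
  qed
  moreover have "c ((!) xs ` e) = True" if e: "e \<in> tight_path_E n" for e
  proof -
    obtain i where "e = {i, i + 1, i + 2}" "i + 2 < n" using e unfolding tight_path_E_def by blast
    then show ?thesis using tight_nth[OF d(2), of i] len by simp
  qed
  ultimately show ?thesis unfolding has_copy_def tight_path_V_def by (intro exI[of _ "(!) xs"]) simp
qed

section \<open>Averaging over tuples\<close>

text \<open>The pairs of a component \<open>i\<close> and a tuple \<tau> in \<open>NS i\<close> are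
  counted in both orders.\<close>

lemma sum_card_ge:
  fixes NS :: "'i \<Rightarrow> nat set"
  assumes "finite A" "\<And>i. i \<in> A \<Longrightarrow> NS i \<subseteq> {..<T}"
    and "\<And>\<tau>. \<tau> < T \<Longrightarrow> card {i \<in> A. \<tau> \<notin> NS i} \<le> U"
  shows "real T * (real (card A) - real U) \<le> (\<Sum>i\<in>A. real (card (NS i)))"
proof -
  have "real (card A) - real U \<le> real (card {i \<in> A. \<tau> \<in> NS i})" if "\<tau> < T" for \<tau>
  proof -
    have "card A = card {i \<in> A. \<tau> \<in> NS i} + card {i \<in> A. \<tau> \<notin> NS i}"
      using assms(1) by (subst card_Un_disjoint[symmetric]) (auto intro: arg_cong[where f = card])
    then show ?thesis using assms(3)[OF that] by linarith
  qed
  then have "(\<Sum>\<tau><T. real (card A) - real U) \<le> (\<Sum>\<tau><T. real (card {i \<in> A. \<tau> \<in> NS i}))"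
    by (intro sum_mono) simp
  also have "\<dots> = real (\<Sum>\<tau><T. \<Sum>i\<in>A. if \<tau> \<in> NS i then 1 else 0)"
    using assms(1) by (simp add: sum.If_cases Int_def)
  also have "(\<Sum>\<tau><T. \<Sum>i\<in>A. if \<tau> \<in> NS i then 1 else 0) = (\<Sum>i\<in>A. \<Sum>\<tau><T. if \<tau> \<in> NS i then 1 else (0::nat))"
    by (rule sum.swap)
  also have "\<dots> = (\<Sum>i\<in>A. card (NS i))"
  proof (rule sum.cong[OF refl])
    fix i assume "i \<in> A"
    then have "{..<T} \<inter> NS i = NS i" using assms(2) by blast
    then show "(\<Sum>\<tau><T. if \<tau> \<in> NS i then 1 else (0::nat)) = card (NS i)"
      by (simp add: sum.If_cases)
  qed
  finally show ?thesis by simp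
qed

text \<open>\<open>G\<close> ranges over all digraphs that a tuple may produce, so \<open>U\<close>
  bounds the number of sources, the members of \<open>A\<close> that may fail to absorb, in every
  tuple at once.\<close>

definition source_bound :: "'i set \<Rightarrow> 'i set \<Rightarrow> nat \<Rightarrow> nat \<Rightarrow> bool" where
  "source_bound A B chi U \<longleftrightarrow>
     (\<forall>G. semicomplete B G \<and> \<not> has_TT B G chi \<longrightarrow> card {i \<in> A. \<forall>j\<in>B. i \<noteq> j \<longrightarrow> G i j} \<le> U)"

text \<open>The path of component \<open>i\<close> has at least \<open>\<nu> i\<close> vertices plus
  \<open>s\<close> per absorbing tuple, and at most \<open>n\<close> since no red path on
  \<open>n\<close> vertices exists. Summation over \<open>A\<close> brings in the count of sources
  per tuple.\<close>

lemma absorbing_average: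
  fixes n s T U :: nat
  assumes abs: "absorbing N c chi s E I \<nu> t" and "finite I" "A \<subseteq> B" "B \<subseteq> I"
    and sz: "\<And>i. i \<in> A \<Longrightarrow> (2 * s + 2) * T + E * t i \<le> \<nu> i" "\<And>i. i \<in> B - A \<Longrightarrow> s * T + E * t i \<le> \<nu> i"
    and U: "source_bound A B chi U"
    and nored: "\<not> has_copy N c True (tight_path_V n) (tight_path_E n)"
  shows "(\<Sum>i\<in>A. real (\<nu> i)) + real s * real T * (real (card A) - real U) \<le> real (card A) * real n"
proof -
  have "\<exists>NS. (\<forall>i\<in>A. NS i \<subseteq> {..<T} \<and>
               (\<exists>P P' X. spans c P P' X \<and> X \<subseteq> {..<N} \<and> \<nu> i + s * card (NS i) \<le> card X)) \<and>
          (\<forall>\<tau><T. \<exists>G. semicomplete B G \<and> \<not> has_TT B G chi \<and>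
               (\<forall>i\<in>A. \<tau> \<notin> NS i \<longrightarrow> (\<forall>j\<in>B. i \<noteq> j \<longrightarrow> G i j)))"
    by (rule abs[unfolded absorbing_def, rule_format]) (use assms in auto)
  then obtain NS where NS:
    "\<forall>i\<in>A. NS i \<subseteq> {..<T} \<and> (\<exists>P P' X. spans c P P' X \<and> X \<subseteq> {..<N} \<and> \<nu> i + s * card (NS i) \<le> card X)"
    "\<forall>\<tau><T. \<exists>G. semicomplete B G \<and> \<not> has_TT B G chi \<and> (\<forall>i\<in>A. \<tau> \<notin> NS i \<longrightarrow> (\<forall>j\<in>B. i \<noteq> j \<longrightarrow> G i j))"
    by (elim exE conjE)
  have fA: "finite A" using assms(2-4) by (meson finite_subset)
  have less: "\<nu> i + s * card (NS i) \<le> n" if iA: "i \<in> A" for i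
  proof (rule ccontr)
    assume "\<not> ?thesis"
    moreover obtain P P' X where "spans c P P' X" "X \<subseteq> {..<N}" "\<nu> i + s * card (NS i) \<le> card X"
      using NS(1) iA by metis
    ultimately show False using spans_has_path[of c P P' X N n] nored by simp
  qed
  have "card {i \<in> A. \<tau> \<notin> NS i} \<le> U" if \<tau>: "\<tau> < T" for \<tau>
  proof -
    obtain G where G: "semicomplete B G" "\<not> has_TT B G chi" "\<forall>i\<in>A. \<tau> \<notin> NS i \<longrightarrow> (\<forall>j\<in>B. i \<noteq> j \<longrightarrow> G i j)"
      using NS(2) \<tau> by metis
    have "card {i \<in> A. \<tau> \<notin> NS i} \<le> card {i \<in> A. \<forall>j\<in>B. i \<noteq> j \<longrightarrow> G i j}"
      by (rule card_mono) (use fA G(3) in auto)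
    also have "\<dots> \<le> U" using U G(1,2) unfolding source_bound_def by simp
    finally show ?thesis .
  qed
  then have "real T * (real (card A) - real U) \<le> (\<Sum>i\<in>A. real (card (NS i)))"
    by (intro sum_card_ge[OF fA]) (use NS(1) in auto)
  then have "real s * (real T * (real (card A) - real U)) \<le> real s * (\<Sum>i\<in>A. real (card (NS i)))"
    by (rule mult_left_mono) simp
  moreover have "(\<Sum>i\<in>A. real (\<nu> i) + real s * real (card (NS i))) \<le> (\<Sum>i\<in>A. real n)"
  proof (rule sum_mono)
    fix i assume "i \<in> A"
    from less[OF this] have "real (\<nu> i + s * card (NS i)) \<le> real n" by (simp only: of_nat_le_iff)
    then show "real (\<nu> i) + real s * real (card (NS i)) \<le> real n" by simp
  qed
  ultimately show ?thesis by (simp add: sum.distrib sum_distrib_left mult.assoc)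
qed

text \<open>Component sizes \<open>x i\<close> are measured in units of the path length \<open>n\<close>.\<close>
lemma scaled_components:
  fixes \<beta> \<eta> :: real and chi m :: nat
  assumes "\<beta> > 0" "\<eta> > 0"
  shows "\<exists>n0. \<forall>n\<ge>n0. \<forall>N c. real N \<le> \<beta> * real n \<and> \<not> has_copy N c False (H_V chi m) (H_E chi TT m) \<and>
      \<not> has_copy N c True (tight_path_V n) (tight_path_E n) \<longrightarrow>
    (\<exists>(I :: nat set list set) (x :: nat set list \<Rightarrow> real). finite I \<and> card I < dir_ramsey chi \<and>
       real N \<le> (sum x I + \<eta>) * real n \<and>
       (\<forall>A B \<gamma> U. A \<subseteq> B \<and> B \<subseteq> I \<and> 0 \<le> \<gamma> \<and> \<gamma> \<le> 1 \<and> (\<forall>i\<in>A. 2 * \<gamma> + \<eta> \<le> x i) \<and> (\<forall>i\<in>B. \<gamma> + \<eta> \<le> x i) \<and>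
          source_bound A B chi U \<longrightarrow>
          sum x A + \<gamma> * (real (card A) - real U) \<le> real (card A) + \<eta>))"
proof -
  \<comment> \<open>A large \<open>s\<close> makes the two extra vertices in
    \<open>2 * s + 2\<close> cheap: over all tuples they cost a component at most
    \<open>\<eta> * n / 2\<close>.\<close>
  define s where "s = m + 1 + nat \<lceil>4 / \<eta>\<rceil>"
  have s: "0 < s" "m \<le> s" by (simp_all add: s_def)
  have "4 / \<eta> \<le> real s" unfolding s_def using assms(2) by linarith
  then have s4: "4 \<le> \<eta> * real s" using assms(2) by (simp add: field_simps)
  obtain E where E: "\<forall>K\<ge>E. \<exists>M. \<forall>N c. \<not> has_copy N c False (H_V chi m) (H_E chi TT m) \<longrightarrow>
    (\<exists>(I :: nat set list set) \<nu> t. finite I \<and> card I < dir_ramsey chi \<and>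
       N \<le> sum \<nu> I + M + E * sum t I \<and> K * sum t I \<le> N \<and> absorbing N c chi s E I \<nu> t)"
    using red_components[OF s, of chi] by (elim exE)
  \<comment> \<open>Given \<open>N \<le> \<beta> * n\<close>, the loss of \<open>E\<close> vertices
    per clique is at most \<open>\<eta> * n / 2\<close> in total.\<close>
  define K where "K = E + 1 + nat \<lceil>2 * real E * \<beta> / \<eta>\<rceil>"
  have K: "E \<le> K" "0 < K" by (simp_all add: K_def)
  have "2 * real E * \<beta> / \<eta> \<le> real K" unfolding K_def by linarith
  then have KE: "2 * real E * \<beta> \<le> \<eta> * real K" using assms(2) by (simp add: field_simps)
  obtain M where M: "\<forall>N c. \<not> has_copy N c False (H_V chi m) (H_E chi TT m) \<longrightarrow>
    (\<exists>(I :: nat set list set) \<nu> t. finite I \<and> card I < dir_ramsey chi \<and>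
       N \<le> sum \<nu> I + M + E * sum t I \<and> K * sum t I \<le> N \<and> absorbing N c chi s E I \<nu> t)"
    using E[rule_format, OF K(1)] by (elim exE)
  \<comment> \<open>Makes \<open>M\<close> at most \<open>\<eta> * n / 2\<close>, and the rounding
    error of at most \<open>s\<close> per member of \<open>A\<close> at most
    \<open>\<eta> * n\<close> in total.\<close>
  define n0 where "n0 = 1 + nat \<lceil>2 * real M / \<eta>\<rceil> + nat \<lceil>real s * real (dir_ramsey chi) / \<eta>\<rceil>"
  show ?thesis
  proof (intro exI[of _ n0] allI impI, elim conjE)
    fix n N c
    assume n: "n0 \<le> n" and N: "real N \<le> \<beta> * real n"
      and noH: "\<not> has_copy N c False (H_V chi m) (H_E chi TT m)"
      and nored: "\<not> has_copy N c True (tight_path_V n) (tight_path_E n)"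
    have n1: "0 < real n" using n by (simp add: n0_def)
    have "2 * real M / \<eta> \<le> real n" "real s * real (dir_ramsey chi) / \<eta> \<le> real n"
      using n unfolding n0_def by linarith+
    then have nM: "2 * real M \<le> \<eta> * real n" and ns: "real s * real (dir_ramsey chi) \<le> \<eta> * real n"
      using assms(2) by (simp_all add: field_simps)
    obtain I :: "nat set list set" and \<nu> t where I: "finite I" "card I < dir_ramsey chi"
      "N \<le> sum \<nu> I + M + E * sum t I" "K * sum t I \<le> N" "absorbing N c chi s E I \<nu> t"
      using M[rule_format, OF noH] by (elim exE conjE)
    have Et: "2 * (real E * real (sum t I)) \<le> \<eta> * real n"
    proof -
      have "real (K * sum t I) \<le> real N" using I(4) by (simp only: of_nat_le_iff)
      then have "real K * real (sum t I) \<le> \<beta> * real n" using N by simp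
      then have "2 * real E * (real K * real (sum t I)) \<le> 2 * real E * (\<beta> * real n)"
        by (intro mult_left_mono) auto
      also have "\<dots> = (2 * real E * \<beta>) * real n" by simp
      also have "\<dots> \<le> (\<eta> * real K) * real n" using KE by (intro mult_right_mono) auto
      finally have "real K * (2 * (real E * real (sum t I))) \<le> real K * (\<eta> * real n)" by (simp add: algebra_simps)
      then show ?thesis using K(2) by simp
    qed
    define x where "x i = real (\<nu> i) / real n" for i
    have xn: "x i * real n = real (\<nu> i)" for i using n1 by (simp add: x_def)
    have sumx: "sum x A * real n = (\<Sum>i\<in>A. real (\<nu> i))" for A by (simp add: sum_distrib_right xn)
    have "real N \<le> real (sum \<nu> I + M + E * sum t I)" using I(3) by (simp only: of_nat_le_iff)
    also have "\<dots> = sum x I * real n + real M + real E * real (sum t I)" using sumx by simp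
    finally have "2 * real N \<le> 2 * (sum x I * real n) + 2 * real M + 2 * (real E * real (sum t I))" by simp
    then have Nx: "real N \<le> (sum x I + \<eta>) * real n" using nM Et by (simp add: distrib_right)
    have main: "sum x A + \<gamma> * (real (card A) - real U) \<le> real (card A) + \<eta>"
      if AB: "A \<subseteq> B" "B \<subseteq> I" and \<gamma>: "0 \<le> \<gamma>" "\<gamma> \<le> 1"
        and xA: "\<And>i. i \<in> A \<Longrightarrow> 2 * \<gamma> + \<eta> \<le> x i" and xB: "\<And>i. i \<in> B \<Longrightarrow> \<gamma> + \<eta> \<le> x i"
        and U: "source_bound A B chi U" for A B \<gamma> U
    proof -
      \<comment> \<open>The largest number of tuples that takes at most \<open>\<gamma> * n\<close>
        vertices from a supplying component.\<close>
      define T where "T = nat \<lfloor>\<gamma> * real n / real s\<rfloor>"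
      have pos: "0 \<le> \<gamma> * real n / real s" using \<gamma> by simp
      have Tr: "real T \<le> \<gamma> * real n / real s" "\<gamma> * real n / real s - 1 \<le> real T"
        unfolding T_def using pos by linarith+
      have sT: "real s * real T \<le> \<gamma> * real n" "\<gamma> * real n - real s \<le> real s * real T"
        using Tr s(1) by (simp_all add: field_simps)
      have "4 * real T \<le> \<eta> * real s * real T" using s4 by (intro mult_right_mono) auto
      also have "\<dots> = \<eta> * (real s * real T)" by simp
      also have "\<dots> \<le> \<eta> * (\<gamma> * real n)" using sT(1) assms(2) by (intro mult_left_mono) auto
      also have "\<dots> \<le> \<eta> * (1 * real n)" using \<gamma> assms(2) by (intro mult_left_mono mult_right_mono) auto
      finally have T4: "4 * real T \<le> \<eta> * real n" by simp
      have ti: "2 * (real E * real (t i)) \<le> \<eta> * real n" if "i \<in> I" for i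
      proof -
        have "t i \<le> sum t I" using that I(1) by (intro member_le_sum) auto
        then have "real (t i) \<le> real (sum t I)" by (simp only: of_nat_le_iff)
        then have "real E * real (t i) \<le> real E * real (sum t I)" by (rule mult_left_mono) simp
        then show ?thesis using Et by linarith
      qed
      have szA: "(2 * s + 2) * T + E * t i \<le> \<nu> i" if "i \<in> A" for i
      proof -
        have "2 * (\<gamma> * real n) + \<eta> * real n \<le> real (\<nu> i)"
          using mult_right_mono[OF xA[OF that], of "real n"] xn[of i] by (simp add: distrib_right)
        then have "2 * (real s * real T) + 2 * real T + real E * real (t i) \<le> real (\<nu> i)"
          using sT(1) T4 ti[of i] that AB by auto
        then have "real ((2 * s + 2) * T + E * t i) \<le> real (\<nu> i)" by (simp add: algebra_simps)
        then show ?thesis by (simp only: of_nat_le_iff)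
      qed
      have szB: "s * T + E * t i \<le> \<nu> i" if "i \<in> B - A" for i
      proof -
        have "\<gamma> * real n + \<eta> * real n \<le> real (\<nu> i)"
          using mult_right_mono[OF xB[of i], of "real n"] that xn[of i] by (simp add: distrib_right)
        moreover have "0 \<le> \<eta> * real n" using assms(2) by simp
        moreover have "2 * (real E * real (t i)) \<le> \<eta> * real n" using ti[of i] that AB by auto
        ultimately have "real s * real T + real E * real (t i) \<le> real (\<nu> i)" using sT(1) by linarith
        then have "real (s * T + E * t i) \<le> real (\<nu> i)" by simp
        then show ?thesis by (simp only: of_nat_le_iff)
      qed
      have av: "(\<Sum>i\<in>A. real (\<nu> i)) + real s * real T * (real (card A) - real U) \<le> real (card A) * real n"
        by (rule absorbing_average[OF I(5,1) AB szA szB U nored])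
      have cA: "card A \<le> dir_ramsey chi" using card_mono[OF I(1) subset_trans[OF AB]] I(2) by linarith
      have "\<gamma> * real n * (real (card A) - real U) - \<eta> * real n \<le> real s * real T * (real (card A) - real U)"
      \<comment> \<open>Rounding \<open>T\<close> down costs at most \<open>s\<close> per unit of
        \<open>card A - U\<close> when this difference is nonnegative, and helps when it is
        negative.\<close>
      proof (cases "U \<le> card A")
        case True
        then have "(\<gamma> * real n - real s) * (real (card A) - real U) \<le> real s * real T * (real (card A) - real U)"
          using sT(2) by (intro mult_right_mono) auto
        moreover have "real s * (real (card A) - real U) \<le> real s * real (dir_ramsey chi)"
          using cA by (intro mult_left_mono) auto
        ultimately show ?thesis using ns by (simp add: left_diff_distrib)
      next
        case False
        then have "\<gamma> * real n * (real (card A) - real U) \<le> real s * real T * (real (card A) - real U)"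
          using sT(1) by (intro mult_right_mono_neg) auto
        moreover have "0 \<le> \<eta> * real n" using assms(2) by simp
        ultimately show ?thesis by linarith
      qed
      then have "sum x A * real n + \<gamma> * real n * (real (card A) - real U) \<le> real (card A) * real n + \<eta> * real n"
        using av sumx[of A] by linarith
      then have "(sum x A + \<gamma> * (real (card A) - real U)) * real n \<le> (real (card A) + \<eta>) * real n"
        by (simp add: algebra_simps)
      then show ?thesis using n1 by (simp only: mult_le_cancel_right_pos)
    qed
    show "\<exists>(I :: nat set list set) (x :: nat set list \<Rightarrow> real). finite I \<and> card I < dir_ramsey chi \<and>
       real N \<le> (sum x I + \<eta>) * real n \<and>
       (\<forall>A B \<gamma> U. A \<subseteq> B \<and> B \<subseteq> I \<and> 0 \<le> \<gamma> \<and> \<gamma> \<le> 1 \<and> (\<forall>i\<in>A. 2 * \<gamma> + \<eta> \<le> x i) \<and> (\<forall>i\<in>B. \<gamma> + \<eta> \<le> x i) \<and>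
          source_bound A B chi U \<longrightarrow>
          sum x A + \<gamma> * (real (card A) - real U) \<le> real (card A) + \<eta>)"
    proof (intro exI[of _ I] exI[of _ x] conjI allI impI)
      fix A B :: "nat set list set" and \<gamma> U
      assume "A \<subseteq> B \<and> B \<subseteq> I \<and> 0 \<le> \<gamma> \<and> \<gamma> \<le> 1 \<and> (\<forall>i\<in>A. 2 * \<gamma> + \<eta> \<le> x i) \<and>
        (\<forall>i\<in>B. \<gamma> + \<eta> \<le> x i) \<and> source_bound A B chi U"
      then show "sum x A + \<gamma> * (real (card A) - real U) \<le> real (card A) + \<eta>" by (intro main[of A B]) simp_all
    qed (use I Nx in auto)
  qed
qed

section \<open>Bounding the total size of the components\<close>

lemma ramsey3_le:
  assumes "\<And>c :: nat set \<Rightarrow> bool. has_copy N c True VG EG \<or> has_copy N c False VH EH"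
  shows "ramsey3 VG EG VH EH \<le> N"
  unfolding ramsey3_def using assms by (intro Least_le) simp

lemma dir_ramsey_ge_4:
  assumes "3 \<le> chi"
  shows "4 \<le> dir_ramsey chi"
proof -
  have "2 + (chi - 2) = chi" using assms by simp
  then have "2 + 2 * (chi - 2) \<le> dir_ramsey chi" using dir_ramsey_add[of 2 "chi - 2"] dir_ramsey_2 by simp
  then show ?thesis using assms by linarith
qed

lemma source_bound_if_card:
  assumes "finite B" "A \<subseteq> B" "chi \<ge> 4 \<or> chi = 3 \<and> (card B = 3 \<or> 4 < dir_ramsey 3)"
  shows "source_bound A B chi (dir_ramsey chi - 1 - card B)"
  unfolding source_bound_def
proof (intro allI impI)
  fix G assume G: "semicomplete B G \<and> \<not> has_TT B G chi"
  define U where "U = {i \<in> A. \<forall>j\<in>B. i \<noteq> j \<longrightarrow> G i j}"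
  have "card B + card U < dir_ramsey chi"
    by (rule card_plus_sources_le[OF assms(1), of G]) (use G assms(2,3) in \<open>auto simp: U_def\<close>)
  then show "card {i \<in> A. \<forall>j\<in>B. i \<noteq> j \<longrightarrow> G i j} \<le> dir_ramsey chi - 1 - card B"
    unfolding U_def by linarith
qed

text \<open>The hypothesis \<open>avg\<close> is what \<open>scaled_components\<close> provides.\<close>
lemma sum_sizes_le_main:
  fixes x :: "'i \<Rightarrow> real" and \<eta> :: real
  assumes fin: "finite I" "card I \<le> R" and R: "R = dir_ramsey chi - 1"
    and chi: "chi \<ge> 4 \<or> chi = 3 \<and> 4 < dir_ramsey 3" and \<eta>: "0 \<le> \<eta>"
    and avg: "\<And>A B \<gamma> U. A \<subseteq> B \<Longrightarrow> B \<subseteq> I \<Longrightarrow> 0 \<le> \<gamma> \<Longrightarrow> \<gamma> \<le> 1 \<Longrightarrow> (\<And>i. i \<in> A \<Longrightarrow> 2 * \<gamma> + \<eta> \<le> x i) \<Longrightarrow>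
       (\<And>i. i \<in> B \<Longrightarrow> \<gamma> + \<eta> \<le> x i) \<Longrightarrow> source_bound A B chi U \<Longrightarrow>
       sum x A + \<gamma> * (real (card A) - real U) \<le> real (card A) + \<eta>"
  shows "sum x I \<le> 2 / 3 * real R + (1 + real R) * \<eta>"
proof -
  \<comment> \<open>The thresholds of \<open>B\<close> and \<open>A\<close> belong to \<gamma> =
    1/3: a supplier spends \<gamma> and an absorber 2\<gamma>.\<close>
  define B where "B = {j \<in> I. 1 / 3 + \<eta> \<le> x j}"
  define A where "A = {i \<in> I. 2 / 3 + \<eta> \<le> x i}"
  have AB: "A \<subseteq> B" "B \<subseteq> I" by (auto simp: A_def B_def)
  have fAB: "finite A" "finite B" using AB fin(1) by (meson finite_subset)+
  have card: "card A \<le> card B" "card B \<le> card I" using AB fin(1) fAB by (auto intro: card_mono)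
  have U: "source_bound A B chi (R - card B)"
    unfolding R by (rule source_bound_if_card[OF fAB(2) AB(1)]) (use chi in auto)
  have "sum x A + 1 / 3 * (real (card A) - real (R - card B)) \<le> real (card A) + \<eta>"
    by (rule avg[OF AB _ _ _ _ U]) (auto simp: A_def B_def)
  then have 1: "sum x A \<le> 2 / 3 * real (card A) + (real R - real (card B)) / 3 + \<eta>"
    using card fin(2) by (simp add: of_nat_diff field_simps)
  have "sum x (B - A) \<le> (\<Sum>i\<in>B - A. 2 / 3 + \<eta>)"
    by (rule sum_mono) (use AB in \<open>auto simp: A_def\<close>)
  then have 2: "sum x (B - A) \<le> (real (card B) - real (card A)) * (2 / 3 + \<eta>)"
    using card AB fAB by (simp add: card_Diff_subset of_nat_diff)
  have "sum x (I - B) \<le> (\<Sum>i\<in>I - B. 1 / 3 + \<eta>)"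
    by (rule sum_mono) (auto simp: B_def)
  then have 3: "sum x (I - B) \<le> (real (card I) - real (card B)) * (1 / 3 + \<eta>)"
    using card AB fAB by (simp add: card_Diff_subset of_nat_diff)
  have "sum x I = sum x A + sum x (B - A) + sum x (I - B)"
    using sum.subset_diff[OF AB(2) fin(1), of x] sum.subset_diff[OF AB(1) fAB(2), of x] by simp
  then have "sum x I \<le> (real (card I) + real R) / 3 + \<eta> + (real (card I) - real (card A)) * \<eta>"
    using 1 2 3 by (simp add: field_simps)
  moreover have "(real (card I) - real (card A)) * \<eta> \<le> real R * \<eta>"
    using fin(2) \<eta> by (intro mult_right_mono) auto
  moreover have "real (card I) \<le> real R" using fin(2) by simp
  ultimately show ?thesis by (simp add: field_simps)
qed

text \<open>
  The remaining case \<open>R(3) = 4\<close>: with three components, the largest one absorbs exactly the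
  vertices it lacks, in any of the other two.
\<close>
lemma sum_sizes_le_3:
  fixes x :: "'i \<Rightarrow> real" and \<eta> :: real
  assumes fin: "finite I" "card I \<le> 3" and R: "dir_ramsey 3 = 4" and \<eta>: "0 < \<eta>" "\<eta> \<le> 1 / 20"
    and avg: "\<And>A B \<gamma> U. A \<subseteq> B \<Longrightarrow> B \<subseteq> I \<Longrightarrow> 0 \<le> \<gamma> \<Longrightarrow> \<gamma> \<le> 1 \<Longrightarrow> (\<And>i. i \<in> A \<Longrightarrow> 2 * \<gamma> + \<eta> \<le> x i) \<Longrightarrow>
       (\<And>i. i \<in> B \<Longrightarrow> \<gamma> + \<eta> \<le> x i) \<Longrightarrow> source_bound A B 3 U \<Longrightarrow>
       sum x A + \<gamma> * (real (card A) - real U) \<le> real (card A) + \<eta>"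
    and one: "\<And>i. i \<in> I \<Longrightarrow> x i \<le> 1 + \<eta>"
  shows "sum x I \<le> 2 + 5 * \<eta>"
proof (rule ccontr)
  assume "\<not> ?thesis"
  then have big: "2 + 5 * \<eta> < sum x I" by simp
  have "sum x I \<le> (\<Sum>i\<in>I. 1 + \<eta>)" by (rule sum_mono) (rule one)
  then have "2 + 5 * \<eta> < real (card I) * (1 + \<eta>)" using big by simp
  \<comment> \<open>Two components hold at most 2 + 2\<eta> together.\<close>
  have "card I = 3"
  proof (rule ccontr)
    assume "card I \<noteq> 3"
    then have "real (card I) \<le> 2" using fin(2) by simp
    then have "real (card I) * (1 + \<eta>) \<le> 2 * (1 + \<eta>)" using \<eta>(1) by (intro mult_right_mono) auto
    then show False using \<open>2 + 5 * \<eta> < real (card I) * (1 + \<eta>)\<close> \<eta>(1) by simp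
  qed
  have "I \<noteq> {}" using \<open>card I = 3\<close> by auto
  then obtain a where a: "a \<in> I" "\<And>i. i \<in> I \<Longrightarrow> x i \<le> x a"
    using Max_in[of "x ` I"] Max_ge[of "x ` I"] fin(1) by (metis (no_types, lifting) finite_imageI image_iff image_is_empty)
  have "sum x I \<le> (\<Sum>i\<in>I. x a)" by (rule sum_mono) (rule a(2))
  then have xa: "2 + 5 * \<eta> < 3 * x a" using big \<open>card I = 3\<close> by simp
  \<comment> \<open>Component \<open>a\<close> lacks \<open>1 - x a\<close>; the surplus of 2\<eta>
    beats the error \<eta> in \<open>avg\<close>.\<close>
  define \<gamma> where "\<gamma> = 1 - x a + 2 * \<eta>"
  have \<gamma>: "0 \<le> \<gamma>" "\<gamma> \<le> 1" using one[OF a(1)] xa \<eta> by (simp_all add: \<gamma>_def)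
  \<comment> \<open>Equivalent to \<open>2 + 5 * \<eta> \<le> 3 * x a\<close>, the origin of the
    constant 5.\<close>
  have A: "2 * \<gamma> + \<eta> \<le> x a" using xa by (simp add: \<gamma>_def)
  \<comment> \<open>For \<open>j\<close> other than \<open>a\<close>, the third component holds at
    most 1 + \<eta>, so \<open>x j\<close> exceeds \<open>1 - x a + 4 * \<eta>\<close>.\<close>
  have B: "\<gamma> + \<eta> \<le> x j" if "j \<in> I" for j
  proof (cases "j = a")
    case True
    then show ?thesis using A \<gamma>(1) by simp
  next
    case False
    have "sum x (I - {a} - {j}) \<le> (\<Sum>i\<in>I - {a} - {j}. 1 + \<eta>)" by (rule sum_mono) (use one in auto)
    moreover have "card (I - {a} - {j}) = 1" using fin(1) a(1) that False \<open>card I = 3\<close> by simp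
    moreover have "sum x I = x a + (x j + sum x (I - {a} - {j}))"
      using sum.remove[OF fin(1) a(1), of x] sum.remove[of "I - {a}" j x] fin(1) that False by simp
    ultimately have "sum x I \<le> x a + x j + (1 + \<eta>)" by simp
    then show ?thesis using big \<eta>(1) by (simp add: \<gamma>_def)
  qed
  \<comment> \<open>The bound is 0 here: in a semicomplete digraph on three vertices, a source
    together with an arc between the other two forms a transitive triangle.\<close>
  have "source_bound {a} I 3 (dir_ramsey 3 - 1 - card I)"
    by (rule source_bound_if_card) (use fin a \<open>card I = 3\<close> in auto)
  then have "sum x {a} + \<gamma> * (real (card {a}) - real (dir_ramsey 3 - 1 - card I)) \<le> real (card {a}) + \<eta>"
    by (intro avg[of "{a}" I \<gamma>]) (use a(1) \<gamma> A B in auto)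
  then show False using R \<open>card I = 3\<close> \<eta>(1) by (simp add: \<gamma>_def)
qed

theorem theorem1p14:
  fixes chi m :: nat and \<epsilon> :: real
  assumes "chi \<ge> 2" and "m \<ge> 2" and "\<epsilon> > 0"
  shows "\<exists>n0::nat. \<forall>n\<ge>n0.
     real (ramsey3 (tight_path_V n) (tight_path_E n) (H_V chi m) (H_E chi TT m))
       \<le> (if chi = 2 then (1 + \<epsilon>) * real n
          else (2/3 + \<epsilon>) * (real (dir_ramsey chi) - 1) * real n)"
proof -
  define R where "R = dir_ramsey chi - 1"
  define \<beta> where "\<beta> = (if chi = 2 then 1 + \<epsilon> else (2/3 + \<epsilon>) * real R)"
  \<comment> \<open>The errors add up to at most 3\<eta>, 2R\<eta> and 7\<eta> in the three cases,
    so a small fraction of \<epsilon> suffices. The cap at 1 supplies the bound 1/20 required by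
    \<open>sum_sizes_le_3\<close>.\<close>
  define \<eta> where "\<eta> = min \<epsilon> 1 / 20"
  have \<eta>: "0 < \<eta>" "\<eta> \<le> \<epsilon> / 20" "\<eta> \<le> 1 / 20" using assms(3) by (auto simp: \<eta>_def)
  have r: "2 \<le> dir_ramsey chi" using le_dir_ramsey[of chi] assms(1) by simp
  have R1: "real (dir_ramsey chi) - 1 = real R" "1 \<le> R" using r by (simp_all add: R_def of_nat_diff)
  have \<beta>: "0 < \<beta>" using assms(3) R1(2) by (simp add: \<beta>_def)
  obtain n1 where n1: "\<forall>n\<ge>n1. \<forall>N c. real N \<le> \<beta> * real n \<and> \<not> has_copy N c False (H_V chi m) (H_E chi TT m) \<and>
      \<not> has_copy N c True (tight_path_V n) (tight_path_E n) \<longrightarrow>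
    (\<exists>(I :: nat set list set) (x :: nat set list \<Rightarrow> real). finite I \<and> card I < dir_ramsey chi \<and>
       real N \<le> (sum x I + \<eta>) * real n \<and>
       (\<forall>A B \<gamma> U. A \<subseteq> B \<and> B \<subseteq> I \<and> 0 \<le> \<gamma> \<and> \<gamma> \<le> 1 \<and> (\<forall>i\<in>A. 2 * \<gamma> + \<eta> \<le> x i) \<and> (\<forall>i\<in>B. \<gamma> + \<eta> \<le> x i) \<and>
          source_bound A B chi U \<longrightarrow>
          sum x A + \<gamma> * (real (card A) - real U) \<le> real (card A) + \<eta>))"
    using scaled_components[OF \<beta> \<eta>(1), of chi m] by (elim exE)
  define n0 where "n0 = n1 + 1 + nat \<lceil>1 / \<eta>\<rceil>"
  have "real (ramsey3 (tight_path_V n) (tight_path_E n) (H_V chi m) (H_E chi TT m)) \<le> \<beta> * real n"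
    if n: "n0 \<le> n" for n
  proof -
    have "n1 \<le> n" "0 < real n" using n by (simp_all add: n0_def)
    have "1 / \<eta> \<le> real n" using n unfolding n0_def by linarith
    then have n\<eta>: "1 \<le> \<eta> * real n" using \<eta>(1) by (simp add: field_simps)
    \<comment> \<open>Rounding down costs less than one vertex, which is at most
      \<open>\<eta> * n\<close> by the choice of \<open>n0\<close>.\<close>
    define N where "N = nat \<lfloor>\<beta> * real n\<rfloor>"
    have "0 \<le> \<beta> * real n" using \<beta> by simp
    then have N: "real N \<le> \<beta> * real n" "\<beta> * real n - 1 \<le> real N" unfolding N_def by linarith+
    have "has_copy N c True (tight_path_V n) (tight_path_E n) \<or> has_copy N c False (H_V chi m) (H_E chi TT m)" for c
    proof (rule ccontr)
      assume "\<not> ?thesis"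
      then have no: "real N \<le> \<beta> * real n \<and> \<not> has_copy N c False (H_V chi m) (H_E chi TT m) \<and>
        \<not> has_copy N c True (tight_path_V n) (tight_path_E n)" using N(1) by simp
      note comp = mp[OF spec[OF spec[OF mp[OF spec[OF n1] \<open>n1 \<le> n\<close>]]] no]
      obtain I :: "nat set list set" and x :: "nat set list \<Rightarrow> real" where I: "finite I" "card I < dir_ramsey chi"
        "real N \<le> (sum x I + \<eta>) * real n" and
        I4: "\<forall>A B \<gamma> U. A \<subseteq> B \<and> B \<subseteq> I \<and> 0 \<le> \<gamma> \<and> \<gamma> \<le> 1 \<and> (\<forall>i\<in>A. 2 * \<gamma> + \<eta> \<le> x i) \<and> (\<forall>i\<in>B. \<gamma> + \<eta> \<le> x i) \<and>
          source_bound A B chi U \<longrightarrow>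
          sum x A + \<gamma> * (real (card A) - real U) \<le> real (card A) + \<eta>"
        using comp by (elim exE conjE)
      have avg: "sum x A + \<gamma> * (real (card A) - real U) \<le> real (card A) + \<eta>"
        if "A \<subseteq> B" "B \<subseteq> I" "0 \<le> \<gamma>" "\<gamma> \<le> 1" "\<And>i. i \<in> A \<Longrightarrow> 2 * \<gamma> + \<eta> \<le> x i" "\<And>i. i \<in> B \<Longrightarrow> \<gamma> + \<eta> \<le> x i"
          "source_bound A B chi U" for A B \<gamma> U
        using I4[rule_format, of A B \<gamma> U] that by simp
      have "\<beta> * real n \<le> (sum x I + 2 * \<eta>) * real n" using N(2) I(3) n\<eta> by (simp add: distrib_right)
      then have sum: "\<beta> \<le> sum x I + 2 * \<eta>" using \<open>0 < real n\<close> by simp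
      \<comment> \<open>With \<gamma> = 0 nothing is absorbed: the usable vertices of a single
        component already lie on one red path.\<close>
      have one: "x i \<le> 1 + \<eta>" if "i \<in> I" for i
      proof (cases "\<eta> \<le> x i")
        case True
        have "source_bound {i} {i} chi 1" 
          unfolding source_bound_def
        proof (intro allI impI)
          fix G :: "nat set list \<Rightarrow> nat set list \<Rightarrow> bool"
          have "card {j \<in> {i}. \<forall>k\<in>{i}. j \<noteq> k \<longrightarrow> G j k} \<le> card {i}" by (rule card_mono) auto
          then show "card {j \<in> {i}. \<forall>k\<in>{i}. j \<noteq> k \<longrightarrow> G j k} \<le> 1" by simp
        qed
        then have "sum x {i} + 0 * (real (card {i}) - real 1) \<le> real (card {i}) + \<eta>"
          by (intro avg[of "{i}" "{i}" 0 1]) (use that True in auto)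
        then show ?thesis by simp
      qed (use \<eta> in simp)
      have cI: "card I \<le> R" using I(2) by (simp add: R_def)
      \<comment> \<open>The exact value of R(3) is left open; it is at least 4, and both
        possibilities are covered.\<close>
      consider "chi = 2" | "chi \<ge> 4 \<or> chi = 3 \<and> 4 < dir_ramsey 3" | "chi = 3" "dir_ramsey 3 = 4"
        using assms(1) dir_ramsey_ge_4[of 3] by linarith
      then show False
      proof cases
        \<comment> \<open>R(2) = 2 leaves at most one component.\<close>
        case 1
        have "sum x I \<le> (\<Sum>i\<in>I. 1 + \<eta>)" by (rule sum_mono) (rule one)
        also have "\<dots> = real (card I) * (1 + \<eta>)" by simp
        also have "\<dots> \<le> 1 * (1 + \<eta>)"
          using cI 1 dir_ramsey_2 \<eta>(1) by (intro mult_right_mono) (auto simp: R_def)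
        finally have "sum x I \<le> 1 + \<eta>" by simp
        moreover have "\<beta> = 1 + \<epsilon>" using 1 by (simp add: \<beta>_def)
        ultimately show False using sum \<eta> assms(3) by linarith
      next
        case 2
        have R3: "3 \<le> real R" using dir_ramsey_ge_4[of chi] 2 by (auto simp: R_def)
        have "sum x I \<le> 2 / 3 * real R + (1 + real R) * \<eta>"
          by (rule sum_sizes_le_main[OF I(1) cI R_def 2 less_imp_le[OF \<eta>(1)] avg])
        moreover have "\<beta> = 2 / 3 * real R + \<epsilon> * real R" using 2 by (auto simp: \<beta>_def algebra_simps)
        ultimately have "\<epsilon> * real R \<le> (3 + real R) * \<eta>" using sum by (simp add: algebra_simps)
        also have "\<dots> \<le> (2 * real R) * \<eta>" using R3 \<eta>(1) by (intro mult_right_mono) auto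
        also have "\<dots> \<le> (2 * real R) * (\<epsilon> / 20)" using \<eta>(2) by (intro mult_left_mono) auto
        finally show False using R3 assms(3) by (simp add: field_simps)
      next
        case 3
        have "sum x I \<le> 2 + 5 * \<eta>"
          by (rule sum_sizes_le_3[OF I(1) _ 3(2) \<eta>(1,3) avg[unfolded 3(1)] one]) (use cI 3 in \<open>simp_all add: R_def\<close>)
        then show False using sum \<eta> assms(3) 3 by (simp add: \<beta>_def R_def algebra_simps)
      qed
    qed
    then have "ramsey3 (tight_path_V n) (tight_path_E n) (H_V chi m) (H_E chi TT m) \<le> N"
      by (rule ramsey3_le)
    then show ?thesis using N(1) by linarith
  qed
  then show ?thesis unfolding R1(1) \<beta>_def by (intro exI[of _ n0]) auto
qed

end
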